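(* For every $\alpha>0$ and $\beta\in\mathbb R$, the $H$-minimal global intrinsic $X_1$-graph $$\mathcal S=\{(x,y,t)\in\mathbb H^1 \mid x=y(\alpha t+\beta)\}$$ is unstable. More precisely, there exist $a\in C_0^\infty(\mathcal S)$, $a\not\equiv 0$, and $h\in C_0^\infty(\mathcal S)$, $h\not\equiv 0$, such that with either $\mathcal X=aX_1$ or $\mathcal X=h\,\boldsymbol\nu_H$ one has $\mathcal V^H_{II}(\mathcal S;\mathcal X)<0$.
   Context: Heisenberg group: $\mathbb H^1=(\mathbb R^3,\circ)$ with $(x,y,t)\circ(x',y',t')=(x+x',\,y+y',\,t+t'+\tfrac12(xy'-x'y))$. Left-invariant vector fields: $X_1=\partial_x-\frac y2\partial_t$, $X_2=\partial_y+\frac x2\partial_t$, $T=\partial_t$. $\langle\cdot,\cdot\rangle$ is the left-invariant Riemannian metric making $\{X_1,X_2,T\}$ orthonormal, with norm $|\cdot|$. Surfaces: a $C^2$ surface $\mathcal S\subset\mathbb H^1$ is locally the zero set of a $C^2$ function $\phi$ with $\nabla\phi:=X_1\phi\,X_1+X_2\phi\,X_2+T\phi\,T\neq0$, oriented so that its (non-unit) normal is $\boldsymbol N=\nabla\phi$. Set $p=X_1\phi$, $q=X_2\phi$, $\omega=T\phi$, $W=\sqrt{p^2+q^2}$. The characteristic locus $\Sigma(\mathcal S)$ is the set of $g\in\mathcal S$ at which the tangent plane of $\mathcal S$ is spanned by $X_1,X_2$, i.e. where $W=0$. Off $\Sigma(\mathcal S)$ set $\overline p=p/W$, $\overline q=q/W$;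 the horizontal Gauss map is $\boldsymbol\nu_H=\overline p X_1+\overline q X_2$. The horizontal mean curvature is $\mathcal H=X_1\overline p+X_2\overline q$, and $\mathcal S$ is $H$-minimal if $\mathcal H\equiv0$ on $\mathcal S$. For the surface in the claim one takes $\phi(x,y,t)=x-y(\alpha t+\beta)$; then $\Sigma(\mathcal S)=\varnothing$. Global intrinsic $X_1$-graph: a set of the form $\{(0,u,v)\circ(\psi(u,v),0,0): (u,v)\in\mathbb R^2\}$ for a function $\psi:\mathbb R^2\to\mathbb R$. For the surface in the claim, $\psi(u,v)=\frac{2u(\alpha v+\beta)}{2+\alpha u^2}$. Perimeter: $P_H(\mathcal S)=\int_{\mathcal S}d\sigma_H$, with $d\sigma_H=\frac{W}{|\boldsymbol N|}d\sigma$, where $d\sigma$ is the Riemannian surface measure. Variations: for a vector field $\mathcal X=aX_1+bX_2+kT$ with coefficients in $C^2_0(\mathcal S)$ (subscript $0$ means compact support in $\mathcal S$), let $\mathcal S^\lambda=\mathcal S+\lambda\mathcal X=\{g+\lambda\mathcal X(g):g\in\mathcal S\}$, where $\mathcal X(g)$ is viewed as a vector in $\mathbb R^3$. Define $$\mathcal V^H_I(\mathcal S;\mathcal X)=\frac{d}{d\lambda}P_H(\mathcal S^\lambda)\Big|_{\lambda=0},\qquad \mathcal V^H_{II}(\mathcal S;\mathcal X)=\frac{d^2}{d\lambda^2}P_H(\mathcal S^\lambda)\Big|_{\lambda=0},$$ where, since $\mathcal X$ has compact support, the perimeter is understood to be computed on the deformation of a fixed bounded piece of $\mathcal S$ containing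 the support of $\mathcal X$. A $C^2$ oriented $H$-minimal surface $\mathcal S$ with $\Sigma(\mathcal S)=\varnothing$ is stationary if $\mathcal V_I^H(\mathcal S;\mathcal X)=0$ for all $\mathcal X\in C_0^2(\mathcal S,\mathbb H^1)$, $\mathcal X\not\equiv0$ (this is equivalent to $H$-minimality). A stationary $\mathcal S$ is stable if $\mathcal V_{II}^H(\mathcal S;\mathcal X)\ge0$ for all such $\mathcal X$, and unstable if there is such an $\mathcal X$ with $\mathcal V_{II}^H(\mathcal S;\mathcal X)<0$. *)

theory Defs
  imports "HOL-Analysis.Analysis"
begin

section \<open>Functions of class \<open>C\<^sup>k\<close>\<close>

fun Ck_on :: "nat \<Rightarrow> ('a::real_normed_vector \<Rightarrow> 'b::real_normed_vector) \<Rightarrow> 'a set \<Rightarrow> bool" where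
  "Ck_on 0 f U \<longleftrightarrow> continuous_on U f"
| "Ck_on (Suc k) f U \<longleftrightarrow>
     (\<forall>x\<in>U. f differentiable (at x)) \<and> (\<forall>v. Ck_on k (\<lambda>x. frechet_derivative f (at x) v) U)"

text \<open>Only meant for open \<open>U\<close>. The order \<open>\<infinity>\<close> gives the smooth functions.\<close>

definition C_on :: "enat \<Rightarrow> ('a::real_normed_vector \<Rightarrow> 'b::real_normed_vector) \<Rightarrow> 'a set \<Rightarrow> bool" where
  "C_on n f U \<longleftrightarrow> (\<forall>k. enat k \<le> n \<longrightarrow> Ck_on k f U)"


section \<open>The Heisenberg group\<close>

type_synonym heis = "real \<times> real \<times> real"

fun heis_mult :: "heis \<Rightarrow> heis \<Rightarrow> heis"  (infixl "\<circ>\<^sub>H" 70) where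
  "(x, y, t) \<circ>\<^sub>H (x', y', t') = (x + x', y + y', t + t' + (x * y' - x' * y) / 2)"

text \<open>A vector field is a function assigning to a point its coordinate vector with
  respect to \<open>\<partial>\<^sub>x, \<partial>\<^sub>y, \<partial>\<^sub>t\<close>.\<close>

fun X1 :: "heis \<Rightarrow> heis" where "X1 (x, y, t) = (1, 0, - y / 2)"
fun X2 :: "heis \<Rightarrow> heis" where "X2 (x, y, t) = (0, 1, x / 2)"
fun XT :: "heis \<Rightarrow> heis" where "XT (x, y, t) = (0, 0, 1)"

text \<open>The vector \<open>(a, b, c)\<close> at \<open>(x, y, t)\<close> equals
  \<open>a X\<^sub>1 + b X\<^sub>2 + (c + (y a - x b) / 2) T\<close>; the metric is the
  Euclidean inner product of these frame coordinates.\<close>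

fun frame_coords :: "heis \<Rightarrow> heis \<Rightarrow> real \<times> real \<times> real" where
  "frame_coords (x, y, t) (a, b, c) = (a, b, c + (y * a - x * b) / 2)"

definition heis_metric :: "heis \<Rightarrow> heis \<Rightarrow> heis \<Rightarrow> real" where
  "heis_metric g v w = frame_coords g v \<bullet> frame_coords g w"

definition heis_norm :: "heis \<Rightarrow> heis \<Rightarrow> real" where
  "heis_norm g v = sqrt (heis_metric g v v)"

lemma heis_metric_orthonormal_frame:
  "heis_metric g (X1 g) (X1 g) = 1" "heis_metric g (X2 g) (X2 g) = 1" "heis_metric g (XT g) (XT g) = 1"
  "heis_metric g (X1 g) (X2 g) = 0" "heis_metric g (X1 g) (XT g) = 0" "heis_metric g (X2 g) (XT g) = 0"
  by (cases g; simp add: heis_metric_def)+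

definition deriv_along :: "(heis \<Rightarrow> heis) \<Rightarrow> (heis \<Rightarrow> real) \<Rightarrow> heis \<Rightarrow> real" where
  "deriv_along X f g = frechet_derivative f (at g) (X g)"

definition heis_grad :: "(heis \<Rightarrow> real) \<Rightarrow> heis \<Rightarrow> heis" where
  "heis_grad f g = deriv_along X1 f g *\<^sub>R X1 g + deriv_along X2 f g *\<^sub>R X2 g + deriv_along XT f g *\<^sub>R XT g"


section \<open>Surfaces\<close>

text \<open>Horizontal data of the level sets of \<open>\<phi>\<close>: here \<open>p = X\<^sub>1\<phi>\<close> and \<open>q = X\<^sub>2\<phi>\<close>.\<close>

definition hor_W :: "(heis \<Rightarrow> real) \<Rightarrow> heis \<Rightarrow> real" where
  "hor_W \<phi> g = sqrt ((deriv_along X1 \<phi> g)\<^sup>2 + (deriv_along X2 \<phi> g)\<^sup>2)"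

definition p_bar :: "(heis \<Rightarrow> real) \<Rightarrow> heis \<Rightarrow> real" where
  "p_bar \<phi> g = deriv_along X1 \<phi> g / hor_W \<phi> g"

definition q_bar :: "(heis \<Rightarrow> real) \<Rightarrow> heis \<Rightarrow> real" where
  "q_bar \<phi> g = deriv_along X2 \<phi> g / hor_W \<phi> g"

definition nu_H :: "(heis \<Rightarrow> real) \<Rightarrow> heis \<Rightarrow> heis" where
  "nu_H \<phi> g = p_bar \<phi> g *\<^sub>R X1 g + q_bar \<phi> g *\<^sub>R X2 g"

definition hor_mean_curvature :: "(heis \<Rightarrow> real) \<Rightarrow> heis \<Rightarrow> real" where
  "hor_mean_curvature \<phi> g = deriv_along X1 (p_bar \<phi>) g + deriv_along X2 (q_bar \<phi>) g"

definition defining_function :: "enat \<Rightarrow> heis set \<Rightarrow> heis set \<Rightarrow> (heis \<Rightarrow> real) \<Rightarrow> bool" where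
  "defining_function n S U \<phi> \<longleftrightarrow>
     open U \<and> C_on n \<phi> U \<and> (\<forall>g\<in>U. heis_grad \<phi> g \<noteq> 0) \<and> S \<inter> U = {g \<in> U. \<phi> g = 0}"

text \<open>A \<open>C\<^sup>2\<close> surface \<open>S\<close> oriented by the (non-unit) normal \<open>N\<close>: locally \<open>S\<close> is the zero set of
  some \<open>\<phi>\<close> with \<open>N = \<nabla>\<phi>\<close> along \<open>S\<close>.\<close>

definition oriented_defining_function ::
    "heis set \<Rightarrow> (heis \<Rightarrow> heis) \<Rightarrow> heis set \<Rightarrow> (heis \<Rightarrow> real) \<Rightarrow> bool" where
  "oriented_defining_function S N U \<phi> \<longleftrightarrow>
     defining_function 2 S U \<phi> \<and> (\<forall>g\<in>S \<inter> U. N g = heis_grad \<phi> g)"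

definition oriented_C2_surface :: "heis set \<Rightarrow> (heis \<Rightarrow> heis) \<Rightarrow> bool" where
  "oriented_C2_surface S N \<longleftrightarrow> (\<forall>g\<in>S. \<exists>U \<phi>. g \<in> U \<and> oriented_defining_function S N U \<phi>)"

definition characteristic_locus :: "heis set \<Rightarrow> heis set" where
  "characteristic_locus S =
     {g \<in> S. \<exists>U \<phi>. g \<in> U \<and> defining_function 2 S U \<phi> \<and> hor_W \<phi> g = 0}"

text \<open>Along \<open>S\<close> the horizontal mean curvature depends only on the orientation, not on
  the choice of the defining function.\<close>

definition H_minimal :: "heis set \<Rightarrow> (heis \<Rightarrow> heis) \<Rightarrow> bool" where
  "H_minimal S N \<longleftrightarrow>
     (\<forall>g\<in>S. \<exists>U \<phi>. g \<in> U \<and> oriented_defining_function S N U \<phi> \<and>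
        (\<forall>h\<in>S \<inter> U. hor_W \<phi> h \<noteq> 0 \<longrightarrow> hor_mean_curvature \<phi> h = 0))"

definition global_X1_graph :: "(real \<times> real \<Rightarrow> real) \<Rightarrow> heis set" where
  "global_X1_graph \<psi> = {(0, u, v) \<circ>\<^sub>H (\<psi> (u, v), 0, 0) | u v. True}"


section \<open>Riemannian surface measure and horizontal perimeter\<close>

text \<open>\<open>area_element\<close> is the square root of the determinant of the Gram matrix of the
  coordinate vectors with respect to the left-invariant metric.\<close>

definition area_element :: "(real \<times> real \<Rightarrow> heis) \<Rightarrow> real \<times> real \<Rightarrow> real" where
  "area_element \<Phi> w =
     (let \<Phi>u = frechet_derivative \<Phi> (at w) (1, 0); \<Phi>v = frechet_derivative \<Phi> (at w) (0, 1); g = \<Phi> w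
      in sqrt (heis_metric g \<Phi>u \<Phi>u * heis_metric g \<Phi>v \<Phi>v - (heis_metric g \<Phi>u \<Phi>v)\<^sup>2))"

definition local_parametrization :: "heis set \<Rightarrow> (real \<times> real) set \<Rightarrow> (real \<times> real \<Rightarrow> heis) \<Rightarrow> bool" where
  "local_parametrization M U \<Phi> \<longleftrightarrow>
     open U \<and> C_on 1 \<Phi> U \<and> (\<forall>w\<in>U. area_element \<Phi> w \<noteq> 0) \<and>
     openin (top_of_set M) (\<Phi> ` U) \<and> (\<exists>\<Phi>'. homeomorphism U (\<Phi> ` U) \<Phi> \<Phi>')"

definition is_surface_measure :: "heis set \<Rightarrow> heis measure \<Rightarrow> bool" where
  "is_surface_measure M \<sigma> \<longleftrightarrow>
     sets \<sigma> = sets (restrict_space borel M) \<and>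
     (\<forall>U \<Phi>. local_parametrization M U \<Phi> \<longrightarrow>
        (\<forall>B\<in>sets \<sigma>. emeasure \<sigma> (B \<inter> \<Phi> ` U) =
           (\<integral>\<^sup>+w\<in>U. ennreal (area_element \<Phi> w) * indicator B (\<Phi> w) \<partial>lborel)))"

definition surface_measure :: "heis set \<Rightarrow> heis measure" where
  "surface_measure M = (THE \<sigma>. is_surface_measure M \<sigma>)"

text \<open>The density \<open>W / |N|\<close> depends only on the tangent plane, so any \<open>C\<^sup>1\<close> defining function
  near the point gives the same value.\<close>

definition perimeter_density :: "heis set \<Rightarrow> heis \<Rightarrow> real" where
  "perimeter_density M g =
     (THE r. \<exists>U \<phi>. g \<in> U \<and> defining_function 1 M U \<phi> \<and> r = hor_W \<phi> g / heis_norm g (heis_grad \<phi> g))"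

definition H_perimeter :: "heis set \<Rightarrow> real" where
  "H_perimeter M = (\<integral>g. perimeter_density M g \<partial>surface_measure M)"


section \<open>Variations\<close>

definition support_in :: "heis set \<Rightarrow> (heis \<Rightarrow> 'b::real_vector) \<Rightarrow> heis set" where
  "support_in S f = closure {g \<in> S. f g \<noteq> 0}"

text \<open>Test functions on \<open>S\<close>. Regularity on \<open>S\<close> means having local extensions of that
  regularity to open subsets of \<open>\<real>\<^sup>3\<close>; values off \<open>S\<close> are irrelevant.\<close>

definition C0_surface :: "enat \<Rightarrow> heis set \<Rightarrow> (heis \<Rightarrow> real) \<Rightarrow> bool" where
  "C0_surface n S f \<longleftrightarrow>
     (\<forall>g\<in>S. \<exists>U F. open U \<and> g \<in> U \<and> C_on n F U \<and> (\<forall>h\<in>S \<inter> U. F h = f h)) \<and>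
     compact (support_in S f) \<and> support_in S f \<subseteq> S"

definition test_field :: "heis set \<Rightarrow> (heis \<Rightarrow> heis) \<Rightarrow> bool" where
  "test_field S X \<longleftrightarrow>
     (\<exists>a b k. C0_surface 2 S a \<and> C0_surface 2 S b \<and> C0_surface 2 S k \<and>
        (\<forall>g\<in>S. X g = a g *\<^sub>R X1 g + b g *\<^sub>R X2 g + k g *\<^sub>R XT g)) \<and>
     (\<exists>g\<in>S. X g \<noteq> 0)"

definition deformation :: "heis set \<Rightarrow> (heis \<Rightarrow> heis) \<Rightarrow> real \<Rightarrow> heis set" where
  "deformation K X l = (\<lambda>g. g + l *\<^sub>R X g) ` K"

text \<open>The perimeter is computed on the deformation of a relatively compact open piece \<open>K\<close> of \<open>S\<close>
  containing the support of \<open>X\<close>. The variations do not depend on \<open>K\<close>, so the value is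
  required to be the same for every such piece.\<close>

definition piece_for :: "heis set \<Rightarrow> (heis \<Rightarrow> heis) \<Rightarrow> heis set \<Rightarrow> bool" where
  "piece_for S X K \<longleftrightarrow>
     openin (top_of_set S) K \<and> compact (closure K) \<and> closure K \<subseteq> S \<and> support_in S X \<subseteq> K"

definition has_first_variation :: "heis set \<Rightarrow> (heis \<Rightarrow> heis) \<Rightarrow> real \<Rightarrow> bool" where
  "has_first_variation S X v \<longleftrightarrow>
     (\<exists>K. piece_for S X K) \<and>
     (\<forall>K. piece_for S X K \<longrightarrow>
        ((\<lambda>l. H_perimeter (deformation K X l)) has_real_derivative v) (at 0))"

definition has_second_variation :: "heis set \<Rightarrow> (heis \<Rightarrow> heis) \<Rightarrow> real \<Rightarrow> bool" where
  "has_second_variation S X v \<longleftrightarrow>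
     (\<exists>K. piece_for S X K) \<and>
     (\<forall>K. piece_for S X K \<longrightarrow>
        (\<exists>P'. (\<forall>\<^sub>F l in nhds 0. ((\<lambda>l. H_perimeter (deformation K X l)) has_real_derivative P' l) (at l)) \<and>
              (P' has_real_derivative v) (at 0)))"

definition stationary :: "heis set \<Rightarrow> (heis \<Rightarrow> heis) \<Rightarrow> bool" where
  "stationary S N \<longleftrightarrow>
     oriented_C2_surface S N \<and> H_minimal S N \<and> characteristic_locus S = {} \<and>
     (\<forall>X. test_field S X \<longrightarrow> has_first_variation S X 0)"

definition unstable :: "heis set \<Rightarrow> (heis \<Rightarrow> heis) \<Rightarrow> bool" where
  "unstable S N \<longleftrightarrow>
     stationary S N \<and> (\<exists>X v. test_field S X \<and> has_second_variation S X v \<and> v < 0)"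


section \<open>The surfaces \<open>x = y (\<alpha> t + \<beta>)\<close>\<close>

definition strip :: "real \<Rightarrow> real \<Rightarrow> heis set" where
  "strip \<alpha> \<beta> = {(x, y, t). x = y * (\<alpha> * t + \<beta>)}"

definition strip_phi :: "real \<Rightarrow> real \<Rightarrow> heis \<Rightarrow> real" where
  "strip_phi \<alpha> \<beta> = (\<lambda>(x, y, t). x - y * (\<alpha> * t + \<beta>))"

definition strip_psi :: "real \<Rightarrow> real \<Rightarrow> real \<times> real \<Rightarrow> real" where
  "strip_psi \<alpha> \<beta> = (\<lambda>(u, v). 2 * u * (\<alpha> * v + \<beta>) / (2 + \<alpha> * u\<^sup>2))"

end

theory Submission
  imports Defs
begin

text \<open>The surface \<open>x = y (\<alpha> t + \<beta>)\<close> is ruled by horizontal straight lines, and the ruling makes every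
computation explicit. With \<open>u = y\<close> and \<open>s = \<alpha> t + \<beta>\<close> it is parametrized by
\<open>(u, s) \<mapsto> (u s, u, (s - \<beta>) / \<alpha>)\<close>; the rulings are the lines \<open>s = const\<close>, and the horizontal
normal \<open>\<nu>\<^sub>H = (X\<^sub>1 - s X\<^sub>2) / sqrt (1 + s\<^sup>2)\<close> has constant components along each of them.

Let \<open>\<theta> = dt + (y dx - x dy) / 2\<close> be the contact form, and let \<open>\<Phi>\<close> be a parametrization whose
projection to the \<open>yt\<close>-plane is a diffeomorphism onto its image. The perimeter of the image is the integral of the length
of the planar vector \<open>(dy \<and> \<theta>, dx \<and> \<theta>) (\<Phi>\<^sub>u, \<Phi>\<^sub>s)\<close> (\<open>H_perimeter_eq\<close>): surface measure is the
push-forward of the area element, because any other local parametrization differs by a \<open>C\<^sup>1\<close> change of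
coordinates to which the change-of-variables formula applies, and the factor \<open>W / |N|\<close> discards the
vertical part of the normal. For small \<open>\<lambda>\<close> the deformed surface still projects diffeomorphically
to the \<open>yt\<close>-plane (\<open>deformed_patch\<close>), and on it both components of the planar vector are cubic polynomials in \<open>\<lambda>\<close>. Hence
the perimeter can be differentiated twice under the integral sign (\<open>variations\<close>).

Put \<open>\<mu> = 1 / \<alpha> + u\<^sup>2 / 2\<close>. The integrand of the first variation is a divergence, so the surface is stationary
(\<open>first_variation_zero\<close>). For \<open>X = a X\<^sub>1\<close>, one integration by parts in \<open>s\<close> brings the second variation to
\<open>\<integral> (1 + s\<^sup>2) powr (-3/2) * (((\<mu> a)\<^sub>u)\<^sup>2 / \<mu> - a\<^sup>2) du ds\<close>, and for \<open>X = h \<nu>\<^sub>H\<close> the second variation is the same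
expression in \<open>h\<close> with exponent \<open>-1/2\<close>. For a product \<open>f(u) \<chi>(s) / (\<alpha> \<mu>)\<close> the sign is therefore that of the one-dimensional
integral of \<open>(f')\<^sup>2 / \<mu> - f\<^sup>2 / \<mu>\<^sup>2\<close>. Dilating a fixed bump, \<open>f(u) = bump (u / \<rho>)\<close>, makes the first term
contribute \<open>O(1 / \<rho>)\<close>, since \<open>1 / \<mu> \<le> \<alpha>\<close>, while the second one stays bounded away from \<open>0\<close>
(\<open>gap_integral_negative\<close>). So the second variation is negative for large \<open>\<rho>\<close>, and the same test function serves
both kinds of fields.\<close>

section \<open>Calculus of functions of class \<open>C\<^sup>k\<close>\<close>

lemma Ck_on_cong:
  assumes "open U" "\<And>x. x \<in> U \<Longrightarrow> f x = g x" "Ck_on k f U"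
  shows "Ck_on k g U"
  using assms(2,3)
proof (induction k arbitrary: f g)
  case 0
  then show ?case by (metis Ck_on.simps(1) continuous_on_cong)
next
  case (Suc k)
  have der: "(g has_derivative frechet_derivative f (at x)) (at x)" if "x \<in> U" for x
  proof (rule has_derivative_transform_within_open[OF _ \<open>open U\<close> that])
    show "(f has_derivative frechet_derivative f (at x)) (at x)"
      using Suc.prems that by (simp add: frechet_derivative_works[symmetric])
  qed (use Suc.prems in auto)
  have "Ck_on k (\<lambda>x. frechet_derivative g (at x) v) U" for v
    by (rule Suc.IH[of "\<lambda>x. frechet_derivative f (at x) v"])
       (use Suc.prems in \<open>auto simp: frechet_derivative_at[OF der]\<close>)
  with der show ?case by (auto simp: differentiable_def)
qed

text \<open>Lets any formula for the derivative replace \<^const>\<open>frechet_derivative\<close> in the recursion.\<close>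

lemma Ck_on_SucI:
  assumes "open U" "\<And>x. x \<in> U \<Longrightarrow> (f has_derivative f' x) (at x)"
    and "\<And>v. Ck_on k (\<lambda>x. f' x v) U"
  shows "Ck_on (Suc k) f U"
proof -
  have "Ck_on k (\<lambda>x. frechet_derivative f (at x) v) U" for v
    by (rule Ck_on_cong[OF \<open>open U\<close> _ assms(3)[of v]]) (simp add: frechet_derivative_at[OF assms(2)])
  then show ?thesis using assms(2) by (auto simp: differentiable_def)
qed

lemma Ck_on_has_derivative:
  assumes "Ck_on (Suc k) f U" "x \<in> U"
  shows "(f has_derivative frechet_derivative f (at x)) (at x)"
  using assms by (simp add: frechet_derivative_works[symmetric])

lemma Ck_on_SucD: "Ck_on (Suc k) f U \<Longrightarrow> Ck_on k f U"
proof (induction k arbitrary: f)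
  case 0
  then show ?case
    by (auto simp: differentiable_imp_continuous_within continuous_at_imp_continuous_on)
next
  case (Suc k)
  then show ?case by (metis Ck_on.simps(2))
qed

lemma Ck_on_const: "open U \<Longrightarrow> Ck_on k (\<lambda>x. c) U"
proof (induction k arbitrary: c)
  case (Suc k)
  show ?case by (rule Ck_on_SucI[where f' = "\<lambda>x v. 0"]) (use Suc in auto)
qed simp

lemma Ck_on_bounded_linear:
  assumes "open U" "bounded_linear f"
  shows "Ck_on k f U"
proof (cases k)
  case 0
  then show ?thesis using assms by (simp add: linear_continuous_on)
next
  case (Suc j)
  show ?thesis unfolding Suc
    by (rule Ck_on_SucI[where f' = "\<lambda>x. f"])
       (use assms in \<open>auto intro: bounded_linear_imp_has_derivative Ck_on_const\<close>)
qed

lemma Ck_on_add: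
  assumes "open U" "Ck_on k f U" "Ck_on k g U"
  shows "Ck_on k (\<lambda>x. f x + g x) U"
  using assms(2,3)
proof (induction k arbitrary: f g)
  case (Suc k)
  show ?case
  proof (rule Ck_on_SucI[OF \<open>open U\<close>])
    show "((\<lambda>x. f x + g x) has_derivative
        (\<lambda>v. frechet_derivative f (at x) v + frechet_derivative g (at x) v)) (at x)"
      if "x \<in> U" for x
      by (rule has_derivative_add; rule Ck_on_has_derivative[OF _ that]; rule Suc.prems)
    show "Ck_on k (\<lambda>x. frechet_derivative f (at x) v + frechet_derivative g (at x) v) U" for v
      by (rule Suc.IH) (use Suc.prems in auto)
  qed
qed (simp add: continuous_on_add)

lemma Ck_on_mult:
  fixes f g :: "'a::real_normed_vector \<Rightarrow> real"
  assumes "open U" "Ck_on k f U" "Ck_on k g U"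
  shows "Ck_on k (\<lambda>x. f x * g x) U"
  using assms(2,3)
proof (induction k arbitrary: f g)
  case (Suc k)
  show ?case
  proof (rule Ck_on_SucI[OF \<open>open U\<close>])
    show "((\<lambda>x. f x * g x) has_derivative
        (\<lambda>v. f x * frechet_derivative g (at x) v + frechet_derivative f (at x) v * g x)) (at x)"
      if "x \<in> U" for x
      by (rule has_derivative_mult; rule Ck_on_has_derivative[OF _ that]; rule Suc.prems)
    show "Ck_on k (\<lambda>x. f x * frechet_derivative g (at x) v + frechet_derivative f (at x) v * g x) U" for v
      by (intro Ck_on_add Suc.IH \<open>open U\<close> Ck_on_SucD[OF Suc.prems(1)] Ck_on_SucD[OF Suc.prems(2)])
         (use Suc.prems in auto)
  qed
qed (simp add: continuous_on_mult)

lemma Ck_on_minus: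
  fixes f :: "'a::real_normed_vector \<Rightarrow> real"
  assumes "open U" "Ck_on k f U"
  shows "Ck_on k (\<lambda>x. - f x) U"
  using Ck_on_mult[OF assms(1) Ck_on_const[OF assms(1)] assms(2), of "-1"] by simp

lemma Ck_on_diff:
  fixes f g :: "'a::real_normed_vector \<Rightarrow> real"
  assumes "open U" "Ck_on k f U" "Ck_on k g U"
  shows "Ck_on k (\<lambda>x. f x - g x) U"
  using Ck_on_add[OF assms(1,2) Ck_on_minus[OF assms(1,3)]] by simp

lemma Ck_on_power:
  fixes f :: "'a::real_normed_vector \<Rightarrow> real"
  assumes "open U" "Ck_on k f U"
  shows "Ck_on k (\<lambda>x. f x ^ n) U"
  by (induction n) (simp_all add: Ck_on_const Ck_on_mult assms)

lemma Ck_on_inverse: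
  fixes f :: "'a::real_normed_vector \<Rightarrow> real"
  assumes "open U" "Ck_on k f U" "\<And>x. x \<in> U \<Longrightarrow> f x \<noteq> 0"
  shows "Ck_on k (\<lambda>x. inverse (f x)) U"
  using assms(2)
proof (induction k)
  case (Suc k)
  note inv = Suc.IH[OF Ck_on_SucD[OF Suc.prems]]
  show ?case
  proof (rule Ck_on_SucI[OF \<open>open U\<close>])
    show "((\<lambda>x. inverse (f x)) has_derivative
        (\<lambda>v. - (inverse (f x) * frechet_derivative f (at x) v * inverse (f x)))) (at x)"
      if "x \<in> U" for x
      by (intro Deriv.has_derivative_inverse Ck_on_has_derivative[OF _ that] assms(3) that) (rule Suc.prems)
    show "Ck_on k (\<lambda>x. - (inverse (f x) * frechet_derivative f (at x) v * inverse (f x))) U" for v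
      by (intro Ck_on_minus Ck_on_mult \<open>open U\<close> inv) (use Suc.prems in auto)
  qed
qed (use assms(3) in \<open>auto intro!: continuous_on_inverse\<close>)

lemmas Ck_on_intros = Ck_on_const Ck_on_add Ck_on_mult Ck_on_minus Ck_on_diff
  Ck_on_power Ck_on_inverse

lemma C_onI: "(\<And>k. Ck_on k f U) \<Longrightarrow> C_on n f U"
  by (simp add: C_on_def)

lemma C_on_mono: "C_on n f U \<Longrightarrow> m \<le> n \<Longrightarrow> C_on m f U"
  by (auto simp: C_on_def)

lemma C_on_1I:
  assumes "open U" "\<And>x. x \<in> U \<Longrightarrow> (f has_derivative f' x) (at x)"
    and "\<And>v. continuous_on U (\<lambda>x. f' x v)"
  shows "C_on 1 f U"
proof -
  have "Ck_on 1 f U"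
    using Ck_on_SucI[OF assms(1,2), of 0] assms(3) by simp
  moreover from this have "Ck_on 0 f U"
    using Ck_on_SucD[of 0 f U] by simp
  moreover have "k = 0 \<or> k = 1" if "enat k \<le> 1" for k
    using that by (cases k) (auto simp: one_enat_def)
  ultimately show ?thesis
    by (metis C_on_def)
qed

lemma C_on_1D:
  assumes "C_on 1 f U"
  shows "\<And>x. x \<in> U \<Longrightarrow> (f has_derivative frechet_derivative f (at x)) (at x)"
    and "\<And>v. continuous_on U (\<lambda>x. frechet_derivative f (at x) v)"
proof -
  have "enat (Suc 0) \<le> 1" by (simp add: one_enat_def)
  then have Ck: "Ck_on (Suc 0) f U" using assms C_on_def by blast
  show "\<And>x. x \<in> U \<Longrightarrow> (f has_derivative frechet_derivative f (at x)) (at x)"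
    by (rule Ck_on_has_derivative[OF Ck])
  show "\<And>v. continuous_on U (\<lambda>x. frechet_derivative f (at x) v)"
    using Ck by simp
qed


section \<open>A smooth bump function\<close>

text \<open>These are the functions that differentiating \<open>exp (- 1 / x)\<close>, extended by \<open>0\<close>, produces: their span is closed
under differentiation, which gives smoothness by induction on the order, for all \<open>n\<close> at once.\<close>

definition flat_exp :: "nat \<Rightarrow> real \<Rightarrow> real" where
  "flat_exp n x = (if x > 0 then inverse x ^ n * exp (- inverse x) else 0)"

lemma flat_exp_over_x_tendsto_0: "((\<lambda>x. flat_exp n x / x) \<longlongrightarrow> 0) (at 0)"
proof -
  have "((\<lambda>x. inverse x ^ Suc n / exp (inverse x)) \<longlongrightarrow> (0::real)) (at_right 0)"
    using filterlim_compose[OF tendsto_power_div_exp_0 filterlim_inverse_at_top_right, of "Suc n"] by simp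
  then have "((\<lambda>x. flat_exp n x / x) \<longlongrightarrow> 0) (at_right 0)"
    by (rule Lim_transform_eventually)
       (auto simp: flat_exp_def eventually_at_filter exp_minus field_simps)
  moreover have "((\<lambda>x. flat_exp n x / x) \<longlongrightarrow> 0) (at_left 0)"
    by (rule tendsto_eventually) (auto simp: flat_exp_def eventually_at_filter)
  ultimately show ?thesis by (simp add: filterlim_split_at)
qed

lemma flat_exp_deriv:
  "(flat_exp n has_real_derivative flat_exp (n + 2) x - real n * flat_exp (n + 1) x) (at x)"
proof -
  consider "x > 0" | "x < 0" | "x = 0" by linarith
  then show ?thesis
  proof cases
    case 1
    have "((\<lambda>x. inverse x ^ n) has_real_derivative - real n * inverse x ^ (n + 1)) (at x)"
      using DERIV_power[OF DERIV_inverse[of x UNIV], of n] 1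
      by (cases n) (auto simp: algebra_simps)
    moreover have "((\<lambda>x. exp (- inverse x)) has_real_derivative exp (- inverse x) * inverse x ^ 2) (at x)"
      using 1 by (auto intro!: derivative_eq_intros simp: power2_eq_square)
    ultimately have "((\<lambda>x. inverse x ^ n * exp (- inverse x)) has_real_derivative
        - real n * inverse x ^ (n + 1) * exp (- inverse x) + exp (- inverse x) * inverse x ^ 2 * inverse x ^ n) (at x)"
      by (rule DERIV_mult)
    then have "((\<lambda>x. inverse x ^ n * exp (- inverse x)) has_real_derivative
        flat_exp (n + 2) x - real n * flat_exp (n + 1) x) (at x)"
      using 1 by (simp add: flat_exp_def power2_eq_square algebra_simps)
    then show ?thesis
      by (rule has_field_derivative_transform_within_open[where S = "{0<..}"]) (use 1 in \<open>auto simp: flat_exp_def\<close>)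
  next
    case 2
    have "((\<lambda>x. 0) has_real_derivative 0) (at x)" by simp
    then have "(flat_exp n has_real_derivative 0) (at x)"
      by (rule has_field_derivative_transform_within_open[where S = "{..<0}"]) (use 2 in \<open>auto simp: flat_exp_def\<close>)
    then show ?thesis using 2 by (simp add: flat_exp_def)
  next
    case 3
    have "(flat_exp n has_real_derivative 0) (at 0)"
      unfolding has_field_derivative_iff using flat_exp_over_x_tendsto_0[of n]
      by (simp add: flat_exp_def)
    then show ?thesis using 3 by (simp add: flat_exp_def)
  qed
qed

lemma Ck_on_flat_exp:
  assumes "open U" "Ck_on k f U"
  shows "Ck_on k (\<lambda>x. flat_exp n (f x)) U"
  using assms(2)
proof (induction k arbitrary: n)
  case 0
  have "continuous_on UNIV (flat_exp n)"
    by (rule DERIV_continuous_on[OF DERIV_subset[OF flat_exp_deriv]]) simp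
  then show ?case
    using 0 by (auto intro: continuous_on_compose2)
next
  case (Suc k)
  let ?g = "\<lambda>x. flat_exp (n + 2) (f x) + (- real n) * flat_exp (n + 1) (f x)"
  show ?case
  proof (rule Ck_on_SucI[OF \<open>open U\<close>])
    show "((\<lambda>x. flat_exp n (f x)) has_derivative (\<lambda>v. ?g x * frechet_derivative f (at x) v)) (at x)"
      if "x \<in> U" for x
      by (rule has_derivative_eq_rhs[OF has_derivative_compose[OF
            Ck_on_has_derivative[OF Suc.prems that] flat_exp_deriv[unfolded has_field_derivative_def]]])
         (auto simp: algebra_simps)
    show "Ck_on k (\<lambda>x. ?g x * frechet_derivative f (at x) v) U" for v
      by (intro Ck_on_mult Ck_on_add Ck_on_const \<open>open U\<close> Suc.IH Ck_on_SucD[OF Suc.prems])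
         (use Suc.prems in auto)
  qed
qed

definition bump :: "real \<Rightarrow> real" where
  "bump x = flat_exp 0 (1 - x) * flat_exp 0 (1 + x)"

definition bump' :: "real \<Rightarrow> real" where
  "bump' x = flat_exp 0 (1 - x) * flat_exp 2 (1 + x) - flat_exp 2 (1 - x) * flat_exp 0 (1 + x)"

lemma bump_deriv: "(bump has_real_derivative bump' x) (at x)"
  unfolding bump_def bump'_def
  by (auto intro!: derivative_eq_intros DERIV_chain2[OF flat_exp_deriv[of 0]] simp: numeral_2_eq_2)

lemma continuous_flat_exp: "continuous_on A (flat_exp n)"
  by (meson DERIV_isCont continuous_at_imp_continuous_on flat_exp_deriv)

lemma continuous_bump: "continuous_on A bump"
  by (meson DERIV_isCont continuous_at_imp_continuous_on bump_deriv)

lemma continuous_bump': "continuous_on A bump'"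
proof -
  have "continuous_on A (\<lambda>x. flat_exp n (1 - x))" "continuous_on A (\<lambda>x. flat_exp n (1 + x))" for n
    by (rule continuous_on_compose2[OF continuous_flat_exp[of UNIV]]; simp add: continuous_on_op_minus continuous_on_add)+
  then show ?thesis
    unfolding bump'_def by (intro continuous_on_diff continuous_on_mult)
qed

lemma bump_eq_0: "\<bar>x\<bar> \<ge> 1 \<Longrightarrow> bump x = 0" and bump'_eq_0: "\<bar>x\<bar> \<ge> 1 \<Longrightarrow> bump' x = 0"
  by (auto simp: bump_def bump'_def flat_exp_def)

lemma bump_pos: "\<bar>x\<bar> < 1 \<Longrightarrow> bump x > 0"
  by (auto simp: bump_def flat_exp_def)

lemma Ck_on_bump:
  assumes "open U" "Ck_on k f U"
  shows "Ck_on k (\<lambda>x. bump (f x)) U"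
  unfolding bump_def by (intro Ck_on_intros Ck_on_flat_exp assms)


section \<open>Change of variables in the plane\<close>

definition jac :: "(real \<times> real \<Rightarrow> real \<times> real) \<Rightarrow> real" where
  "jac L = fst (L (1, 0)) * snd (L (0, 1)) - fst (L (0, 1)) * snd (L (1, 0))"

definition of_vec2 :: "real^2 \<Rightarrow> real \<times> real" where "of_vec2 v = (v $ 1, v $ 2)"
definition to_vec2 :: "real \<times> real \<Rightarrow> real^2" where "to_vec2 p = vector [fst p, snd p]"

lemma of_to_vec2 [simp]: "of_vec2 (to_vec2 p) = p"
  by (simp add: of_vec2_def to_vec2_def)

lemma to_of_vec2 [simp]: "to_vec2 (of_vec2 v) = v"
  by (simp add: of_vec2_def to_vec2_def vec_eq_iff forall_2)

lemma linear_vec2: "linear of_vec2" "linear to_vec2"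
  by (auto intro!: linearI simp: of_vec2_def to_vec2_def vec_eq_iff forall_2)

lemma bounded_linear_vec2: "bounded_linear of_vec2" "bounded_linear to_vec2"
  using linear_vec2 linear_conv_bounded_linear by blast+

lemma measurable_vec2 [measurable]: "of_vec2 \<in> borel_measurable borel" "to_vec2 \<in> borel_measurable borel"
  using bounded_linear_vec2 by (auto intro!: borel_measurable_continuous_onI linear_continuous_on)

lemma lborel_plane_eq_distr: "(lborel :: (real \<times> real) measure) = distr (lborel :: (real^2) measure) borel of_vec2"
proof (rule lborel_eqI)
  fix l u :: "real \<times> real"
  assume lu: "\<And>b. b \<in> Basis \<Longrightarrow> l \<bullet> b \<le> u \<bullet> b"
  then have le: "fst l \<le> fst u" "snd l \<le> snd u"
    by (force simp: Basis_prod_def inner_prod_def)+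
  have pre: "of_vec2 -` box l u = box (to_vec2 l) (to_vec2 u)"
    by (auto simp: box_def of_vec2_def to_vec2_def Basis_vec_def Basis_prod_def inner_axis inner_prod_def forall_2)
  have B2: "(Basis :: (real^2) set) = {axis 1 1, axis 2 1}"
    by (auto simp: Basis_vec_def UNIV_2)
  have B: "(Basis :: (real \<times> real) set) = {(1, 0), (0, 1)}"
    by (auto simp: Basis_prod_def)
  have ne: "axis 1 1 \<noteq> (axis 2 1 :: real^2)"
    by (simp add: axis_eq_axis)
  have "emeasure (distr lborel borel of_vec2) (box l u) = emeasure lborel (box (to_vec2 l) (to_vec2 u))"
    by (subst emeasure_distr) (auto simp: pre)
  also have "\<dots> = (\<Prod>b\<in>Basis. (to_vec2 u - to_vec2 l) \<bullet> b)"
    by (rule emeasure_lborel_box) (use le in \<open>auto simp: B2 inner_axis to_vec2_def\<close>)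
  also have "(\<Prod>b\<in>Basis. (to_vec2 u - to_vec2 l) \<bullet> b) = (\<Prod>b\<in>Basis. (u - l) \<bullet> b)"
    using ne by (simp add: B B2 inner_axis to_vec2_def inner_prod_def)
  finally show "emeasure (distr lborel borel of_vec2) (box l u) = (\<Prod>b\<in>Basis. (u - l) \<bullet> b)" .
qed simp

lemma det_conj_vec2:
  assumes "linear L"
  shows "det (matrix (to_vec2 \<circ> L \<circ> of_vec2)) = jac L"
proof -
  have ax: "of_vec2 (axis 1 1) = (1, 0)" "of_vec2 (axis 2 1) = (0, 1)"
    by (auto simp: of_vec2_def axis_def)
  show ?thesis
    by (simp add: det_2 matrix_def ax jac_def) (simp add: to_vec2_def)
qed

text \<open>The coordinate isometry carries the formula for the measure of a differentiable image from \<open>real^2\<close> to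
  the product type.\<close>

lemma emeasure_differentiable_image:
  fixes \<theta> :: "real \<times> real \<Rightarrow> real \<times> real"
  assumes S: "S \<in> sets borel" and img: "\<theta> ` S \<in> sets borel"
    and der: "\<And>w. w \<in> S \<Longrightarrow> (\<theta> has_derivative \<theta>' w) (at w)"
    and inj: "inj_on \<theta> S" and fin: "emeasure lborel (\<theta> ` S) < \<infinity>"
    and meas: "(\<lambda>w. indicator S w * ennreal \<bar>jac (\<theta>' w)\<bar>) \<in> borel_measurable borel"
  shows "emeasure lborel (\<theta> ` S) = (\<integral>\<^sup>+w. indicator S w * ennreal \<bar>jac (\<theta>' w)\<bar> \<partial>lborel)"
proof -
  define f where "f = to_vec2 \<circ> \<theta> \<circ> of_vec2"
  define f' where "f' v = to_vec2 \<circ> \<theta>' (of_vec2 v) \<circ> of_vec2" for v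
  define S' where "S' = of_vec2 -` S"
  have S': "S' \<in> sets borel"
    using measurable_sets[OF measurable_vec2(1) S] by (simp add: S'_def)
  have f_img: "f ` S' = of_vec2 -` (\<theta> ` S)"
  proof (intro equalityI subsetI)
    fix v assume "v \<in> of_vec2 -` (\<theta> ` S)"
    then obtain w where w: "w \<in> S" "of_vec2 v = \<theta> w" by auto
    then have "f (to_vec2 w) = v" by (simp add: f_def flip: w(2))
    moreover have "to_vec2 w \<in> S'" using w by (simp add: S'_def)
    ultimately show "v \<in> f ` S'" by blast
  qed (auto simp: f_def S'_def)
  have f_img_sets: "f ` S' \<in> sets borel"
    unfolding f_img using measurable_sets[OF measurable_vec2(1) img] by simp
  have em: "emeasure lborel (f ` S') = emeasure lborel (\<theta> ` S)"
    by (subst lborel_plane_eq_distr, subst emeasure_distr) (use img in \<open>auto simp: f_img\<close>)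
  have lm: "f ` S' \<in> lmeasurable"
    using f_img_sets em fin by (auto simp: fmeasurable_def)
  have "((\<lambda>v. \<bar>det (matrix (f' v))\<bar>) has_integral measure lebesgue (f ` S')) S'"
  proof (subst has_measure_differentiable_image[symmetric, where f = f])
    show "S' \<in> sets lebesgue" using S' by simp
    show "inj_on f S'"
      unfolding f_def S'_def using inj by (auto simp: inj_on_def) (metis of_to_vec2 to_of_vec2)
    show "(f has_derivative f' v) (at v within S')" if "v \<in> S'" for v
    proof -
      have d: "(of_vec2 has_derivative of_vec2) (at v)"
        using bounded_linear_vec2 bounded_linear_imp_has_derivative by blast
      have "(\<theta> has_derivative \<theta>' (of_vec2 v)) (at (of_vec2 v))"
        using that der by (simp add: S'_def)
      from has_derivative_compose[OF has_derivative_compose[OF d this] bounded_linear_imp_has_derivative[OF bounded_linear_vec2(2)]]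
      show ?thesis unfolding f_def f'_def by (simp add: o_def has_derivative_at_withinI)
    qed
  qed (use lm in simp)
  moreover have "\<bar>det (matrix (f' v))\<bar> = \<bar>jac (\<theta>' (of_vec2 v))\<bar>" if "v \<in> S'" for v
    unfolding f'_def using that der[of "of_vec2 v"]
    by (subst det_conj_vec2) (auto simp: S'_def has_derivative_linear)
  ultimately have "((\<lambda>v. \<bar>jac (\<theta>' (of_vec2 v))\<bar>) has_integral measure lebesgue (f ` S')) S'"
    by (rule has_integral_eq[rotated])
  from nn_integral_has_integral_lebesgue[OF _ this]
  have "(\<integral>\<^sup>+v. ennreal (indicator S' v * \<bar>jac (\<theta>' (of_vec2 v))\<bar>) \<partial>lborel) = ennreal (measure lebesgue (f ` S'))"
    by simp
  also have "\<dots> = emeasure lborel (f ` S')"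
  proof -
    have "emeasure lebesgue (f ` S') = emeasure lborel (f ` S')"
      using f_img_sets by simp
    moreover have "emeasure lebesgue (f ` S') \<noteq> \<infinity>"
      using lm by (auto simp: fmeasurable_def)
    ultimately show ?thesis
      by (metis emeasure_eq_ennreal_measure infinity_ennreal_def)
  qed
  finally have "emeasure lborel (\<theta> ` S) = (\<integral>\<^sup>+v. ennreal (indicator S' v * \<bar>jac (\<theta>' (of_vec2 v))\<bar>) \<partial>lborel)"
    by (simp add: em)
  also have "\<dots> = (\<integral>\<^sup>+v. indicator S (of_vec2 v) * ennreal \<bar>jac (\<theta>' (of_vec2 v))\<bar> \<partial>lborel)"
    by (intro nn_integral_cong) (simp add: S'_def split: split_indicator)
  also have "\<dots> = (\<integral>\<^sup>+w. indicator S w * ennreal \<bar>jac (\<theta>' w)\<bar> \<partial>lborel)"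
    by (subst lborel_plane_eq_distr, subst nn_integral_distr) (use meas in simp_all)
  finally show ?thesis .
qed

text \<open>The image of \<open>|jac \<theta>'| dw\<close> under \<open>\<theta>\<close> and Lebesgue measure on \<open>\<theta> ` V\<close> agree on boxes, where they are finite,
hence on all Borel sets. The map \<open>\<tau>\<close> extends \<open>\<theta>\<close> by \<open>0\<close> to a globally Borel one.\<close>

lemma nn_integral_change_of_variables_plane:
  fixes \<theta> :: "real \<times> real \<Rightarrow> real \<times> real" and f :: "real \<times> real \<Rightarrow> ennreal"
  assumes V: "open V"
    and der: "\<And>w. w \<in> V \<Longrightarrow> (\<theta> has_derivative \<theta>' w) (at w)"
    and cont: "\<And>v. continuous_on V (\<lambda>w. \<theta>' w v)"
    and inj: "inj_on \<theta> V" and f: "f \<in> borel_measurable borel"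
  shows "(\<integral>\<^sup>+x. indicator (\<theta> ` V) x * f x \<partial>lborel) =
    (\<integral>\<^sup>+w. indicator V w * (ennreal \<bar>jac (\<theta>' w)\<bar> * f (\<theta> w)) \<partial>lborel)"
proof -
  have cont\<theta>: "continuous_on V \<theta>"
    by (meson continuous_at_imp_continuous_on der has_derivative_continuous)
  have op: "open (\<theta> ` V)"
    by (rule invariance_of_domain[OF cont\<theta> V inj])
  define J where "J w = indicator V w * ennreal \<bar>jac (\<theta>' w)\<bar>" for w
  have "continuous_on V (\<lambda>w. \<bar>jac (\<theta>' w)\<bar>)"
    unfolding jac_def using cont by (auto intro!: continuous_intros)
  then have "(\<lambda>w. indicator V w *\<^sub>R \<bar>jac (\<theta>' w)\<bar>) \<in> borel_measurable borel"
    by (intro borel_measurable_continuous_on_indicator) (simp add: V)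
  then have "(\<lambda>w. ennreal (indicator V w *\<^sub>R \<bar>jac (\<theta>' w)\<bar>)) \<in> borel_measurable borel"
    by measurable
  also have "(\<lambda>w. ennreal (indicator V w *\<^sub>R \<bar>jac (\<theta>' w)\<bar>)) = J"
    by (auto simp: J_def indicator_def fun_eq_iff)
  finally have J [measurable]: "J \<in> borel_measurable borel" .
  define \<tau> where "\<tau> w = (if w \<in> V then \<theta> w else 0)" for w
  have [measurable]: "V \<in> sets borel" using V by simp
  have "\<tau> = (\<lambda>w. indicator V w *\<^sub>R \<theta> w)"
    by (auto simp: \<tau>_def indicator_def fun_eq_iff)
  then have \<tau> [measurable]: "\<tau> \<in> borel_measurable borel"
    by (simp only:) (intro borel_measurable_continuous_on_indicator[OF _ cont\<theta>], simp add: V)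
  have key: "density lborel (indicator (\<theta> ` V)) = distr (density lborel J) borel \<tau>" (is "?\<mu> = ?\<nu>")
  proof (rule measure_eqI_generator_eq)
    let ?E = "range (\<lambda>(a, b). box a b :: (real \<times> real) set)"
    show "Int_stable ?E"
      by (auto simp: Int_stable_def box_Int_box)
    have "sets borel = sigma_sets UNIV ?E"
      by (simp add: borel_eq_box)
    then show "?E \<subseteq> Pow UNIV" "sets ?\<mu> = sigma_sets UNIV ?E" "sets ?\<nu> = sigma_sets UNIV ?E"
      by (simp_all only: sets_density sets_distr sets_lborel subset_Pow_Union Union_UNIV subset_UNIV Pow_UNIV)
    let ?A = "\<lambda>n::nat. box (- (real n *\<^sub>R One)) (real n *\<^sub>R One) :: (real \<times> real) set"
    show "range ?A \<subseteq> ?E" "(\<Union>i. ?A i) = UNIV"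
      unfolding UN_box_eq_UNIV by auto
    have mu: "emeasure ?\<mu> X = emeasure lborel (\<theta> ` V \<inter> X)" if "X \<in> sets borel" for X
      using that op by (subst emeasure_density) (auto simp: indicator_inter_arith[symmetric] nn_integral_indicator)
    have le: "emeasure ?\<mu> (box a b) < \<infinity>" for a b :: "real \<times> real"
    proof -
      have "emeasure ?\<mu> (box a b) \<le> emeasure lborel (box a b)"
        by (subst mu) (auto intro!: emeasure_mono)
      also have "\<dots> < \<infinity>" by (rule emeasure_lborel_box_finite)
      finally show ?thesis .
    qed
    show "emeasure ?\<mu> (?A i) \<noteq> \<infinity>" for i using le by (simp add: less_top[symmetric])
    show "emeasure ?\<mu> X = emeasure ?\<nu> X" if "X \<in> ?E" for X
    proof -
      from that obtain a b where X: "X = box a b" by auto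
      have S: "V \<inter> \<theta> -` X = V \<inter> \<tau> -` X" "open X" by (auto simp: \<tau>_def X open_box)
      have opS: "open (V \<inter> \<theta> -` X)"
        using continuous_open_preimage[OF cont\<theta> V \<open>open X\<close>] .
      have img: "\<theta> ` (V \<inter> \<theta> -` X) = \<theta> ` V \<inter> X" by auto
      have "emeasure ?\<mu> X = emeasure lborel (\<theta> ` (V \<inter> \<theta> -` X))"
        using \<open>open X\<close> by (simp add: mu img)
      also have "\<dots> = (\<integral>\<^sup>+w. indicator (V \<inter> \<theta> -` X) w * ennreal \<bar>jac (\<theta>' w)\<bar> \<partial>lborel)"
      proof (rule emeasure_differentiable_image)
        show "emeasure lborel (\<theta> ` (V \<inter> \<theta> -` X)) < \<infinity>"
          unfolding img using le[of a b] X by (simp add: mu)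
        show "(\<lambda>w. indicator (V \<inter> \<theta> -` X) w * ennreal \<bar>jac (\<theta>' w)\<bar>) \<in> borel_measurable borel"
        proof -
          have "(\<lambda>w. indicator (V \<inter> \<theta> -` X) w * J w) \<in> borel_measurable borel"
            by (intro borel_measurable_times_ennreal borel_measurable_indicator J) (simp add: opS)
          also have "(\<lambda>w. indicator (V \<inter> \<theta> -` X) w * J w) = (\<lambda>w. indicator (V \<inter> \<theta> -` X) w * ennreal \<bar>jac (\<theta>' w)\<bar>)"
            by (auto simp: J_def indicator_def fun_eq_iff)
          finally show ?thesis .
        qed
      qed (use opS op \<open>open X\<close> der inj in \<open>auto simp: img intro: inj_on_subset borel_open\<close>)
      also have "\<dots> = (\<integral>\<^sup>+w. J w * indicator (\<tau> -` X) w \<partial>lborel)"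
        unfolding S by (intro nn_integral_cong) (auto simp: J_def indicator_def)
      also have "\<dots> = emeasure ?\<nu> X"
        using \<open>open X\<close> measurable_sets[OF \<tau>, of X] by (simp add: emeasure_distr emeasure_density)
      finally show ?thesis .
    qed
  qed
  have "(\<integral>\<^sup>+x. indicator (\<theta> ` V) x * f x \<partial>lborel) = (\<integral>\<^sup>+x. f x \<partial>?\<mu>)"
    using op f by (subst nn_integral_density) auto
  also have "\<dots> = (\<integral>\<^sup>+w. J w * f (\<tau> w) \<partial>lborel)"
    unfolding key using f by (simp add: nn_integral_distr nn_integral_density)
  also have "\<dots> = (\<integral>\<^sup>+w. indicator V w * (ennreal \<bar>jac (\<theta>' w)\<bar> * f (\<theta> w)) \<partial>lborel)"
    by (intro nn_integral_cong) (auto simp: J_def \<tau>_def indicator_def)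
  finally show ?thesis .
qed


section \<open>Algebra of the left-invariant frame\<close>

definition cross :: "heis \<Rightarrow> heis \<Rightarrow> heis" where
  "cross a b = (fst (snd a) * snd (snd b) - snd (snd a) * fst (snd b),
     snd (snd a) * fst b - fst a * snd (snd b), fst a * fst (snd b) - fst (snd a) * fst b)"

text \<open>The length of the horizontal part of a vector given by its frame coordinates.\<close>

definition hnorm :: "heis \<Rightarrow> real" where
  "hnorm n = sqrt ((fst n)\<^sup>2 + (fst (snd n))\<^sup>2)"

lemma linear_frame_coords: "linear (frame_coords g)"
  by (cases g) (auto intro!: linearI simp: algebra_simps add_divide_distrib diff_divide_distrib)

lemma cross_norm: "(norm (cross a b))\<^sup>2 = (a \<bullet> a) * (b \<bullet> b) - (a \<bullet> b)\<^sup>2"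
  unfolding power2_norm_eq_inner
  by (cases a; cases b) (simp add: cross_def power2_eq_square algebra_simps)

text \<open>If \<open>n\<close> is orthogonal to \<open>a\<close> and \<open>b\<close>, then \<open>(a \<times> b) \<times> n = b (a \<bullet> n) - a (b \<bullet> n) = 0\<close>, which in
coordinates is the identity \<open>*\<close> below.\<close>

lemma parallel_of_orthogonal:
  assumes "n \<bullet> a = 0" "n \<bullet> b = 0" "cross a b \<noteq> 0"
  obtains \<mu> where "n = \<mu> *\<^sub>R cross a b"
proof -
  let ?c = "cross a b"
  have *: "(?c \<bullet> ?c) *\<^sub>R n = (n \<bullet> ?c) *\<^sub>R ?c"
  proof -
    obtain a1 a2 a3 b1 b2 b3 n1 n2 n3
      where [simp]: "a = (a1, a2, a3)" "b = (b1, b2, b3)" "n = (n1, n2, n3)" by (metis prod_cases3)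
    have h: "n1 * a1 + (n2 * a2 + n3 * a3) = 0" "n1 * b1 + (n2 * b2 + n3 * b3) = 0"
      using assms(1,2) by simp_all
    then show ?thesis
      by (simp add: cross_def, intro conjI) algebra+
  qed
  have "?c \<bullet> ?c \<noteq> 0" using assms(3) by simp
  then have "n = ((n \<bullet> ?c) / (?c \<bullet> ?c)) *\<^sub>R ?c"
    by (metis * divideR_right divide_inverse_commute scaleR_scaleR)
  then show ?thesis by (rule that)
qed

lemma hnorm_scaleR: "hnorm (\<mu> *\<^sub>R n) = \<bar>\<mu>\<bar> * hnorm n"
  by (simp add: hnorm_def power_mult_distrib real_sqrt_mult flip: distrib_left)

text \<open>The frame coordinates of the Riemannian gradient.\<close>

definition frame_deriv :: "(heis \<Rightarrow> real) \<Rightarrow> heis \<Rightarrow> heis" where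
  "frame_deriv \<phi> g = (deriv_along X1 \<phi> g, deriv_along X2 \<phi> g, deriv_along XT \<phi> g)"

lemma hor_W_eq: "hor_W \<phi> g = hnorm (frame_deriv \<phi> g)"
  by (simp add: hor_W_def hnorm_def frame_deriv_def)

lemma frame_coords_heis_grad: "frame_coords g (heis_grad \<phi> g) = frame_deriv \<phi> g"
  by (cases g) (simp add: heis_grad_def frame_deriv_def field_simps)

lemma heis_norm_grad: "heis_norm g (heis_grad \<phi> g) = norm (frame_deriv \<phi> g)"
  by (simp add: heis_norm_def heis_metric_def frame_coords_heis_grad norm_eq_sqrt_inner)

lemma heis_grad_eq_0_iff: "heis_grad \<phi> g = 0 \<longleftrightarrow> frame_deriv \<phi> g = 0"
proof
  assume "heis_grad \<phi> g = 0"
  then show "frame_deriv \<phi> g = 0"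
    by (metis frame_coords_heis_grad linear_0 linear_frame_coords)
qed (simp add: heis_grad_def frame_deriv_def zero_prod_def)

lemma derivative_in_frame:
  assumes "(\<phi> has_derivative D) (at g)"
  shows "D v = frame_deriv \<phi> g \<bullet> frame_coords g v"
proof -
  obtain x y t a b c where [simp]: "g = (x, y, t)" "v = (a, b, c)" by (metis prod_cases3)
  interpret D: linear D using assms by (rule has_derivative_linear)
  have "v = a *\<^sub>R X1 g + b *\<^sub>R X2 g + (c + (y * a - x * b) / 2) *\<^sub>R XT g"
    by (simp add: field_simps)
  then have "D v = a * D (X1 g) + b * D (X2 g) + (c + (y * a - x * b) / 2) * D (XT g)"
    by (metis D.add D.scaleR real_scaleR_def)
  then show ?thesis
    using frechet_derivative_at[OF assms] by (simp add: frame_deriv_def deriv_along_def inner_prod_def)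
qed

lemma frame_deriv_nonzero:
  assumes "(\<phi> has_derivative D) (at g)" "D v \<noteq> 0"
  shows "heis_grad \<phi> g \<noteq> 0"
  using derivative_in_frame[OF assms(1), of v] assms(2) by (auto simp: heis_grad_eq_0_iff)


section \<open>Linear maps of the plane\<close>

text \<open>Cramer's rule.\<close>

definition inv2 :: "(real \<times> real \<Rightarrow> real \<times> real) \<Rightarrow> real \<times> real \<Rightarrow> real \<times> real" where
  "inv2 L v = ((fst v * snd (L (0, 1)) - snd v * fst (L (0, 1))) / jac L,
     (snd v * fst (L (1, 0)) - fst v * snd (L (1, 0))) / jac L)"

lemma linear_plane: "linear L \<Longrightarrow> L v = fst v *\<^sub>R L (1, 0) + snd v *\<^sub>R L (0, 1)"
  for v :: "real \<times> real"
  by (metis (no_types, lifting) add.right_neutral add_0 linear_add linear_scale mult.right_neutral mult_zero_right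
      plus_prod_def prod.collapse real_scaleR_def scaleR_prod_def fst_conv snd_conv)

lemma linear_inv2: "linear (inv2 L)"
  by (auto intro!: linearI simp: inv2_def algebra_simps diff_divide_distrib add_divide_distrib)

lemma inv2_right:
  assumes "linear L" "jac L \<noteq> 0"
  shows "L (inv2 L v) = v"
proof -
  obtain p q r s where L: "L (1, 0) = (p, q)" "L (0, 1) = (r, s)" by (metis surj_pair)
  have d: "p * s - r * q \<noteq> 0" using assms(2) by (simp add: jac_def L)
  have "L (inv2 L v) = fst (inv2 L v) *\<^sub>R (p, q) + snd (inv2 L v) *\<^sub>R (r, s)"
    using linear_plane[OF assms(1)] L by metis
  also have "\<dots> = v"
  proof -
    obtain a b where v: "v = (a, b)" by (cases v)
    have "(a * s - b * r) * p + (b * p - a * q) * r = a * (p * s - r * q)"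
      "(a * s - b * r) * q + (b * p - a * q) * s = b * (p * s - r * q)" by algebra+
    with d show ?thesis
      by (simp add: v inv2_def jac_def L flip: add_divide_distrib)
  qed
  finally show ?thesis .
qed

text \<open>Under a change of parameters the normal is multiplied by the Jacobian; hence the area element transforms like a
density and the direction of the normal does not change.\<close>

lemma cross_chain:
  fixes A :: "real \<times> real \<Rightarrow> heis"
  assumes "linear A" "linear F"
  shows "cross (F (A (L (1, 0)))) (F (A (L (0, 1)))) = jac L *\<^sub>R cross (F (A (1, 0))) (F (A (0, 1)))"
proof -
  obtain p q r s where L: "L (1, 0) = (p, q)" "L (0, 1) = (r, s)" by (metis surj_pair)
  have "linear (F \<circ> A)" using assms linear_compose by blast
  from linear_plane[OF this]
  have "F (A (L (1, 0))) = p *\<^sub>R F (A (1, 0)) + q *\<^sub>R F (A (0, 1))"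
    "F (A (L (0, 1))) = r *\<^sub>R F (A (1, 0)) + s *\<^sub>R F (A (0, 1))"
    by (metis L fst_conv snd_conv o_apply)+
  then show ?thesis
    by (simp add: jac_def L cross_def algebra_simps)
qed

lemma continuous_on_linear_family:
  fixes A :: "'a::topological_space \<Rightarrow> real \<times> real \<Rightarrow> 'b::real_normed_vector"
  assumes "\<And>x. x \<in> U \<Longrightarrow> linear (A x)" "\<And>v. continuous_on U (\<lambda>x. A x v)"
    and "continuous_on S g" "g ` S \<subseteq> U" "continuous_on S h"
  shows "continuous_on S (\<lambda>p. A (g p) (h p))"
proof -
  have c: "continuous_on S (\<lambda>p. A (g p) v)" for v
    by (rule continuous_on_compose2[OF assms(2,3,4)])
  have "continuous_on S (\<lambda>p. fst (h p) *\<^sub>R A (g p) (1, 0) + snd (h p) *\<^sub>R A (g p) (0, 1))"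
    by (intro continuous_intros c assms)
  moreover have "A (g p) (h p) = fst (h p) *\<^sub>R A (g p) (1, 0) + snd (h p) *\<^sub>R A (g p) (0, 1)" if "p \<in> S" for p
    by (rule linear_plane) (use assms(1,4) that in auto)
  ultimately show ?thesis by (simp cong: continuous_on_cong)
qed


section \<open>The perimeter of a parametrized graph\<close>

text \<open>For \<open>L = \<Phi>'(w)\<close> and \<open>g = \<Phi>(w)\<close> this is the non-unit normal in frame coordinates. Its norm is the area element, and the
norm of its horizontal part will be the density of the perimeter.\<close>

definition frame_normal :: "heis \<Rightarrow> (real \<times> real \<Rightarrow> heis) \<Rightarrow> heis" where
  "frame_normal g L = cross (frame_coords g (L (1, 0))) (frame_coords g (L (0, 1)))"

lemma area_element_eq:
  assumes "(\<Phi> has_derivative L) (at w)"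
  shows "area_element \<Phi> w = norm (frame_normal (\<Phi> w) L)"
  unfolding area_element_def Let_def frechet_derivative_at[OF assms, symmetric] heis_metric_def
    frame_normal_def cross_norm[symmetric] by simp

text \<open>With the contact form \<open>\<theta> = dt + (y dx - x dy) / 2\<close> the horizontal components of the normal are \<open>dy \<and> \<theta>\<close> and
\<open>- dx \<and> \<theta>\<close>, and the vertical one is \<open>dx \<and> dy\<close>. If all of them vanish then so does \<open>dy \<and> dt\<close>, the Jacobian of the projection.\<close>

lemma frame_normal_nonzero:
  assumes "jac (snd \<circ> L) \<noteq> 0"
  shows "frame_normal g L \<noteq> 0"
proof
  assume *: "frame_normal g L = 0"
  obtain x y t a b c a' b' c' where [simp]: "g = (x, y, t)" "L (1, 0) = (a, b, c)" "L (0, 1) = (a', b', c')"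
    by (metis prod_cases3)
  have "b * (c' + (y * a' - x * b') / 2) - (c + (y * a - x * b) / 2) * b' = 0" "a * b' - b * a' = 0"
    using * by (simp_all add: frame_normal_def cross_def zero_prod_def)
  then have "b * c' - c * b' = 0" by algebra
  then show False using assms by (simp add: jac_def)
qed

text \<open>A defining function vanishes along the surface, so its differential annihilates \<open>\<Phi>\<^sub>u\<close> and \<open>\<Phi>\<^sub>v\<close>, and its
gradient is parallel to their cross product.\<close>

lemma C1_defining_function_normal:
  fixes \<Phi> :: "real \<times> real \<Rightarrow> heis"
  assumes \<phi>: "defining_function 1 M U' \<phi>" and U: "open U" "w \<in> U" "\<Phi> w \<in> U'" "\<Phi> ` U \<subseteq> M"
    and cont: "continuous_on U \<Phi>" and der: "(\<Phi> has_derivative L) (at w)"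
    and nz: "frame_normal (\<Phi> w) L \<noteq> 0"
  obtains \<mu> where "\<mu> \<noteq> 0" "frame_deriv \<phi> (\<Phi> w) = \<mu> *\<^sub>R frame_normal (\<Phi> w) L"
proof -
  let ?g = "\<Phi> w"
  have U': "open U'" and C: "C_on 1 \<phi> U'" and grad: "heis_grad \<phi> ?g \<noteq> 0"
    and zero: "\<And>h. h \<in> M \<Longrightarrow> h \<in> U' \<Longrightarrow> \<phi> h = 0"
    using \<phi> \<open>?g \<in> U'\<close> by (auto simp: defining_function_def)
  define D where "D = frechet_derivative \<phi> (at ?g)"
  have D: "(\<phi> has_derivative D) (at ?g)"
    unfolding D_def using C_on_1D(1)[OF C \<open>?g \<in> U'\<close>] .
  have "((\<lambda>w. \<phi> (\<Phi> w)) has_derivative (\<lambda>v. D (L v))) (at w)"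
    using has_derivative_compose[OF der D] .
  moreover have "((\<lambda>w. \<phi> (\<Phi> w)) has_derivative (\<lambda>v. 0)) (at w)"
  proof (rule has_derivative_transform_within_open[of "\<lambda>_. 0"])
    show "open (U \<inter> \<Phi> -` U')" by (rule continuous_open_preimage[OF cont U(1) U'])
    show "0 = \<phi> (\<Phi> w)" if "w \<in> U \<inter> \<Phi> -` U'" for w
      using that zero U(4) by (metis IntE image_subset_iff vimageE)
  qed (use U in auto)
  ultimately have "D (L v) = 0" for v by (metis has_derivative_unique)
  then have "frame_deriv \<phi> ?g \<bullet> frame_coords ?g (L v) = 0" for v
    using derivative_in_frame[OF D] by simp
  then obtain \<mu> where \<mu>: "frame_deriv \<phi> ?g = \<mu> *\<^sub>R frame_normal ?g L"
    unfolding frame_normal_def using nz parallel_of_orthogonal by (metis frame_normal_def)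
  moreover have "\<mu> \<noteq> 0" using grad \<mu> by (auto simp: heis_grad_eq_0_iff)
  ultimately show ?thesis using that by blast
qed

text \<open>A parametrized surface that projects diffeomorphically to the \<open>yt\<close>-plane. The implicit function theorem is then replaced by
the inverse of this projection, both for finding a defining function and for comparing parametrizations.\<close>

locale C1_graph_patch =
  fixes U :: "(real \<times> real) set" and \<Phi> :: "real \<times> real \<Rightarrow> heis"
    and \<Phi>' :: "real \<times> real \<Rightarrow> real \<times> real \<Rightarrow> heis"
  assumes open_U: "open U"
    and deriv: "\<And>w. w \<in> U \<Longrightarrow> (\<Phi> has_derivative \<Phi>' w) (at w)"
    and cont': "\<And>v. continuous_on U (\<lambda>w. \<Phi>' w v)"
    and inj: "inj_on (snd \<circ> \<Phi>) U"
    and jac: "\<And>w. w \<in> U \<Longrightarrow> jac (snd \<circ> \<Phi>' w) \<noteq> 0"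
begin

abbreviation "M \<equiv> \<Phi> ` U"
abbreviation "normal w \<equiv> frame_normal (\<Phi> w) (\<Phi>' w)"

text \<open>The inverse of the projection to the \<open>yt\<close>-plane; \<open>G' w\<close> is its derivative at the image of \<open>w\<close>.\<close>

definition "G = inv_into U (snd \<circ> \<Phi>)"
definition "G' w = inv2 (snd \<circ> \<Phi>' w)"

lemma cont: "continuous_on U \<Phi>"
  by (meson continuous_at_imp_continuous_on deriv has_derivative_continuous)

lemma linear': "w \<in> U \<Longrightarrow> linear (\<Phi>' w)"
  using deriv has_derivative_linear by blast

lemma linear_snd': "w \<in> U \<Longrightarrow> linear (snd \<circ> \<Phi>' w)"
  using linear' linear_compose linear_snd by blast

lemma inj_Phi: "inj_on \<Phi> U"
  using inj by (metis inj_on_imageI2)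

lemma G [simp]: "w \<in> U \<Longrightarrow> G (snd (\<Phi> w)) = w"
  unfolding G_def using inv_into_f_f[OF inj] by simp

lemma G_in: "p \<in> (snd \<circ> \<Phi>) ` U \<Longrightarrow> G p \<in> U" and snd_G: "p \<in> (snd \<circ> \<Phi>) ` U \<Longrightarrow> snd (\<Phi> (G p)) = p"
  by auto

lemma deriv_snd: "w \<in> U \<Longrightarrow> ((snd \<circ> \<Phi>) has_derivative (snd \<circ> \<Phi>' w)) (at w)"
  unfolding o_def by (rule has_derivative_snd[OF deriv])

lemma deriv_G: "w \<in> U \<Longrightarrow> (G has_derivative G' w) (at (snd (\<Phi> w)))"
  using has_derivative_inverse_on[OF open_U deriv_snd, where g = G and g' = G' and x = w] inv2_right[OF linear_snd' jac]
  by (simp add: G'_def fun_eq_iff o_def)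

lemma open_base: "open ((snd \<circ> \<Phi>) ` U)"
  by (rule invariance_of_domain[OF _ open_U inj]) (auto intro!: continuous_intros cont simp: o_def)

lemma cont_G: "continuous_on ((snd \<circ> \<Phi>) ` U) G"
  by (rule continuous_at_imp_continuous_on) (auto intro!: has_derivative_continuous deriv_G)

lemma cont_G':
  assumes "continuous_on S g" "g ` S \<subseteq> U" "continuous_on S h"
  shows "continuous_on S (\<lambda>p. G' (g p) (h p))"
proof -
  have c: "continuous_on S (\<lambda>p. \<Phi>' (g p) v)" for v
    by (rule continuous_on_compose2[OF cont' assms(1,2)])
  have "jac (snd \<circ> \<Phi>' (g p)) \<noteq> 0" if "p \<in> S" for p
    using jac that assms(2) by blast
  then show ?thesis
    unfolding G'_def inv2_def jac_def o_def by (intro continuous_intros c assms(3)) (auto simp: jac_def)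
qed

text \<open>Over its shadow on the \<open>yt\<close>-plane the patch is the zero set of \<open>x - f(y, t)\<close>.\<close>

lemma defining_function_exists:
  assumes "w \<in> U"
  obtains V \<phi> where "\<Phi> w \<in> V" "defining_function 1 M V \<phi>"
proof
  let ?V = "UNIV \<times> (snd \<circ> \<Phi>) ` U :: heis set"
  let ?\<phi> = "\<lambda>g. fst g - fst (\<Phi> (G (snd g)))"
  let ?D = "\<lambda>g v. fst v - fst (\<Phi>' (G (snd g)) (G' (G (snd g)) (snd v)))"
  show "\<Phi> w \<in> ?V" using assms by (auto simp: mem_Times_iff)
  have op: "open ?V" by (intro open_Times open_base open_UNIV)
  have Gin: "G (snd g) \<in> U" if "g \<in> ?V" for g using that G_in by (auto simp: mem_Times_iff)
  have D: "(?\<phi> has_derivative ?D g) (at g)" if "g \<in> ?V" for g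
  proof -
    have "(G has_derivative G' (G (snd g))) (at (snd g))"
      using deriv_G[OF Gin[OF that]] snd_G[of "snd g"] that by (auto simp: mem_Times_iff)
    then have "((\<lambda>g. G (snd g)) has_derivative (\<lambda>v. G' (G (snd g)) (snd v))) (at g)"
      by (rule has_derivative_compose[rotated]) (auto intro!: derivative_eq_intros)
    from has_derivative_compose[OF this deriv[OF Gin[OF that]]]
    show ?thesis
      by (auto intro!: derivative_eq_intros)
  qed
  have contGs: "continuous_on ?V (\<lambda>g. G (snd g))"
    by (rule continuous_on_compose2[OF cont_G]) (auto intro!: continuous_intros)
  have "C_on 1 ?\<phi> ?V"
  proof (rule C_on_1I[OF op D])
    have "continuous_on ?V (\<lambda>g. \<Phi>' (G (snd g)) (G' (G (snd g)) (snd v)))" for v :: heis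
    proof (rule continuous_on_linear_family[OF linear' cont' contGs])
      show "continuous_on ?V (\<lambda>g. G' (G (snd g)) (snd v))"
        by (rule cont_G'[OF contGs]) (use Gin in auto)
    qed (use Gin in auto)
    then show "continuous_on ?V (\<lambda>g. ?D g v)" for v
      by (intro continuous_intros)
  qed
  moreover have "heis_grad ?\<phi> g \<noteq> 0" if "g \<in> ?V" for g
  proof (rule frame_deriv_nonzero[OF D[OF that]])
    have "linear (\<Phi>' (G (snd g)))" "linear (G' (G (snd g)))"
      using linear' Gin[OF that] by (auto simp: G'_def linear_inv2)
    then show "?D g (1, 0) \<noteq> 0"
      using linear_0 by (metis diff_zero fst_conv fst_zero snd_conv zero_neq_one)
  qed
  moreover have "M \<inter> ?V = {g \<in> ?V. ?\<phi> g = 0}"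
  proof (intro equalityI subsetI)
    fix g assume "g \<in> {g \<in> ?V. ?\<phi> g = 0}"
    then have "g = \<Phi> (G (snd g))" "G (snd g) \<in> U"
      using snd_G[of "snd g"] Gin[of g] by (auto simp: prod_eq_iff mem_Times_iff)
    then show "g \<in> M \<inter> ?V" using \<open>g \<in> _\<close> by auto
  qed auto
  ultimately show "defining_function 1 M ?V ?\<phi>"
    unfolding defining_function_def using op by blast
qed

lemma normal_nonzero: "w \<in> U \<Longrightarrow> normal w \<noteq> 0"
  using frame_normal_nonzero jac by blast

text \<open>The quotient \<open>W / |N|\<close> is invariant under scaling, so every defining function gives the value of the normal.\<close>

lemma perimeter_density_eq:
  assumes "w \<in> U"
  shows "perimeter_density M (\<Phi> w) = hnorm (normal w) / norm (normal w)"
  unfolding perimeter_density_def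
proof (rule the_equality)
  have *: "hor_W \<phi> (\<Phi> w) / heis_norm (\<Phi> w) (heis_grad \<phi> (\<Phi> w)) = hnorm (normal w) / norm (normal w)"
    if V: "\<Phi> w \<in> V" and \<phi>: "defining_function 1 M V \<phi>" for V \<phi>
  proof -
    obtain \<mu> where "\<mu> \<noteq> 0" "frame_deriv \<phi> (\<Phi> w) = \<mu> *\<^sub>R normal w"
      using C1_defining_function_normal[OF \<phi> open_U assms V _ cont deriv[OF assms] normal_nonzero[OF assms]]
      by blast
    then show ?thesis
      by (simp add: hor_W_eq heis_norm_grad hnorm_scaleR)
  qed
  then show "\<exists>V \<phi>. \<Phi> w \<in> V \<and> defining_function 1 M V \<phi> \<and>
      hnorm (normal w) / norm (normal w) = hor_W \<phi> (\<Phi> w) / heis_norm (\<Phi> w) (heis_grad \<phi> (\<Phi> w))"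
    using defining_function_exists[OF assms] by metis
  show "r = hnorm (normal w) / norm (normal w)" if "\<exists>V \<phi>. \<Phi> w \<in> V \<and> defining_function 1 M V \<phi> \<and>
      r = hor_W \<phi> (\<Phi> w) / heis_norm (\<Phi> w) (heis_grad \<phi> (\<Phi> w))" for r
    using that * by auto
qed

lemma area_element: "w \<in> U \<Longrightarrow> area_element \<Phi> w = norm (normal w)"
  using area_element_eq[OF deriv] .

lemma continuous_frame_coords:
  assumes "continuous_on S g" "continuous_on S h"
  shows "continuous_on S (\<lambda>w. frame_coords (g w) (h w))"
proof -
  have "frame_coords a b = (fst b, fst (snd b), snd (snd b) + (fst (snd a) * fst b - fst a * fst (snd b)) / 2)" for a b
    by (cases a; cases b) simp
  then show ?thesis by (simp only:) (intro continuous_intros assms; simp)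
qed

lemma cont_normal: "continuous_on U normal"
  unfolding frame_normal_def cross_def
  by (intro continuous_intros continuous_frame_coords cont cont')

lemma local_parametrization: "local_parametrization M U \<Phi>"
proof -
  have "C_on 1 \<Phi> U" by (rule C_on_1I[OF open_U deriv cont'])
  moreover have "\<exists>\<Psi>. homeomorphism U M \<Phi> \<Psi>"
  proof
    show "homeomorphism U M \<Phi> (\<lambda>g. G (snd g))"
    proof (rule homeomorphismI[OF cont])
      show "continuous_on M (\<lambda>g. G (snd g))"
        by (rule continuous_on_compose2[OF cont_G]) (auto intro!: continuous_intros)
    qed auto
  qed
  ultimately show ?thesis
    unfolding local_parametrization_def using open_U area_element normal_nonzero by auto
qed

text \<open>Any other local parametrization differs by a \<open>C\<^sup>1\<close> change of coordinates, obtained by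
  inverting the projection to the \<open>yt\<close>-plane.\<close>

lemma transition:
  assumes "local_parametrization M V \<Psi>"
  obtains \<theta> :: "real \<times> real \<Rightarrow> real \<times> real" and \<theta>' where
    "\<And>w. w \<in> V \<Longrightarrow> \<theta> w \<in> U" "\<And>w. w \<in> V \<Longrightarrow> \<Phi> (\<theta> w) = \<Psi> w"
    "\<And>w. w \<in> V \<Longrightarrow> (\<theta> has_derivative \<theta>' w) (at w)"
    "\<And>v. continuous_on V (\<lambda>w. \<theta>' w v)" "inj_on \<theta> V"
    "\<And>w. w \<in> V \<Longrightarrow> area_element \<Psi> w = \<bar>jac (\<theta>' w)\<bar> * area_element \<Phi> (\<theta> w)"
proof -
  define \<theta> where "\<theta> w = G (snd (\<Psi> w))" for w
  define \<theta>' where "\<theta>' w v = G' (\<theta> w) (snd (frechet_derivative \<Psi> (at w) v))" for w v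
  from assms(1) have V: "open V" and C: "C_on 1 \<Psi> V" and "openin (top_of_set M) (\<Psi> ` V)"
    and "\<exists>\<Psi>'. homeomorphism V (\<Psi> ` V) \<Psi> \<Psi>'"
    by (auto simp: local_parametrization_def)
  then have sub: "\<Psi> ` V \<subseteq> M" and inj\<Psi>: "inj_on \<Psi> V"
    by (auto simp: openin_imp_subset homeomorphism_def intro: inj_on_inverseI dest: openin_imp_subset)
  note der\<Psi> = C_on_1D[OF C]
  have \<theta>: "\<theta> w \<in> U" "\<Phi> (\<theta> w) = \<Psi> w" if "w \<in> V" for w
    using sub that unfolding \<theta>_def by auto
  have der: "(\<theta> has_derivative \<theta>' w) (at w)" if "w \<in> V" for w
  proof -
    have "(G has_derivative G' (\<theta> w)) (at (snd (\<Psi> w)))"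
      using deriv_G[OF \<theta>(1)[OF that]] \<theta>(2)[OF that] by simp
    from has_derivative_compose[OF has_derivative_snd[OF der\<Psi>(1)[OF that]] this]
    show ?thesis unfolding \<theta>'_def by (simp add: \<theta>_def [abs_def])
  qed
  then have c\<theta>: "continuous_on V \<theta>"
    by (meson continuous_at_imp_continuous_on has_derivative_continuous)
  have cont\<theta>': "continuous_on V (\<lambda>w. \<theta>' w v)" for v
    unfolding \<theta>'_def by (rule cont_G'[OF c\<theta>]) (use \<theta> in \<open>auto intro!: continuous_intros der\<Psi>\<close>)
  have inj\<theta>: "inj_on \<theta> V" using \<theta> inj\<Psi> by (metis inj_on_def)
  have area: "area_element \<Psi> w = \<bar>jac (\<theta>' w)\<bar> * area_element \<Phi> (\<theta> w)" if "w \<in> V" for w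
  proof -
    have "((\<lambda>w. \<Phi> (\<theta> w)) has_derivative (\<lambda>v. \<Phi>' (\<theta> w) (\<theta>' w v))) (at w)"
      by (rule has_derivative_compose[OF der[OF that] deriv[OF \<theta>(1)[OF that]]])
    then have "(\<Psi> has_derivative (\<lambda>v. \<Phi>' (\<theta> w) (\<theta>' w v))) (at w)"
      by (rule has_derivative_transform_within_open[OF _ V that]) (use \<theta> in auto)
    then have "area_element \<Psi> w = norm (frame_normal (\<Psi> w) (\<lambda>v. \<Phi>' (\<theta> w) (\<theta>' w v)))"
      by (rule area_element_eq)
    also have "\<dots> = \<bar>jac (\<theta>' w)\<bar> * norm (normal (\<theta> w))"
      unfolding frame_normal_def \<theta>(2)[OF that]
      by (subst cross_chain[OF linear'[OF \<theta>(1)[OF that]] linear_frame_coords]) simp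
    finally show ?thesis using area_element \<theta>(1)[OF that] by simp
  qed
  show ?thesis by (rule that[OF \<theta> der cont\<theta>' inj\<theta> area])
qed

definition \<sigma> :: "heis measure" where
  "\<sigma> = distr (density (restrict_space lborel U) (\<lambda>w. ennreal (area_element \<Phi> w))) (restrict_space borel M) \<Phi>"

lemma measurable_Phi [measurable]: "\<Phi> \<in> restrict_space lborel U \<rightarrow>\<^sub>M restrict_space borel M"
proof -
  have "\<Phi> \<in> restrict_space borel U \<rightarrow>\<^sub>M restrict_space borel M"
    using borel_measurable_continuous_on_restrict[OF cont]
    by (auto simp: measurable_restrict_space2_iff space_restrict_space)
  then show ?thesis
    by (simp add: measurable_cong_sets[OF sets_restrict_space_cong[of lborel borel] refl])
qed

lemma measurable_area [measurable]: "area_element \<Phi> \<in> borel_measurable (restrict_space lborel U)"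
proof -
  have "continuous_on U (area_element \<Phi>)"
    using continuous_on_norm[OF cont_normal] by (simp add: area_element cong: continuous_on_cong)
  then have "area_element \<Phi> \<in> borel_measurable (restrict_space borel U)"
    by (rule borel_measurable_continuous_on_restrict)
  then show ?thesis
    by (simp add: measurable_cong_sets[OF sets_restrict_space_cong[of lborel borel] refl])
qed

lemma sets_\<sigma>: "sets \<sigma> = sets (restrict_space borel M)"
  by (simp add: \<sigma>_def)

lemma emeasure_\<sigma>:
  assumes B: "B \<in> sets (restrict_space borel M)"
  shows "emeasure \<sigma> B = (\<integral>\<^sup>+w. indicator U w * (ennreal (area_element \<Phi> w) * indicator B (\<Phi> w)) \<partial>lborel)"
proof -
  have U: "U \<in> sets lborel" using open_U by simp
  have "emeasure \<sigma> B = (\<integral>\<^sup>+x. indicator B x \<partial>\<sigma>)"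
    using B by (simp add: sets_\<sigma>)
  also have "\<dots> = (\<integral>\<^sup>+w. indicator B (\<Phi> w) \<partial>density (restrict_space lborel U) (\<lambda>w. ennreal (area_element \<Phi> w)))"
    unfolding \<sigma>_def using B by (subst nn_integral_distr) auto
  also have "\<dots> = (\<integral>\<^sup>+w. ennreal (area_element \<Phi> w) * indicator B (\<Phi> w) \<partial>restrict_space lborel U)"
    using B by (subst nn_integral_density) (auto intro!: measurable_compose[OF measurable_Phi])
  also have "\<dots> = (\<integral>\<^sup>+w. indicator U w * (ennreal (area_element \<Phi> w) * indicator B (\<Phi> w)) \<partial>lborel)"
    using U by (subst nn_integral_restrict_space) (auto simp: mult_ac)
  finally show ?thesis .
qed

lemma is_surface_measure_\<sigma>: "is_surface_measure M \<sigma>"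
  unfolding is_surface_measure_def
proof (intro conjI allI impI ballI)
  show "sets \<sigma> = sets (restrict_space borel M)" by (rule sets_\<sigma>)
  fix V \<Psi> B assume par: "local_parametrization M V \<Psi>" and B: "B \<in> sets \<sigma>"
  note B' = B[unfolded sets_\<sigma>]
  from par have V: "open V" and "openin (top_of_set M) (\<Psi> ` V)"
    by (auto simp: local_parametrization_def)
  then have \<Psi>V: "\<Psi> ` V \<in> sets (restrict_space borel M)"
    by (auto simp: openin_open sets_restrict_space)
  from par obtain \<theta> \<theta>' where tr:
    "\<And>w. w \<in> V \<Longrightarrow> \<theta> w \<in> U" "\<And>w. w \<in> V \<Longrightarrow> \<Phi> (\<theta> w) = \<Psi> w"
    "\<And>w. w \<in> V \<Longrightarrow> (\<theta> has_derivative \<theta>' w) (at w)"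
    "\<And>v. continuous_on V (\<lambda>w. \<theta>' w v)" "inj_on \<theta> V"
    "\<And>w. w \<in> V \<Longrightarrow> area_element \<Psi> w = \<bar>jac (\<theta>' w)\<bar> * area_element \<Phi> (\<theta> w)"
    by (rule transition) blast
  define f where "f w = indicator U w * (ennreal (area_element \<Phi> w) * indicator B (\<Phi> w))" for w
  have f: "f \<in> borel_measurable borel"
  proof -
    have "(\<lambda>w. ennreal (area_element \<Phi> w) * indicator B (\<Phi> w)) \<in> borel_measurable (restrict_space lborel U)"
      using B' by (auto intro!: measurable_compose[OF measurable_Phi])
    then have "(\<lambda>w. ennreal (area_element \<Phi> w) * indicator B (\<Phi> w) * indicator U w) \<in> borel_measurable lborel"
      using open_U by (subst (asm) borel_measurable_restrict_space_iff_ennreal) auto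
    then show ?thesis unfolding f_def by (simp add: mult_ac)
  qed
  have img: "w \<in> \<theta> ` V \<longleftrightarrow> w \<in> U \<and> \<Phi> w \<in> \<Psi> ` V" for w
  proof
    assume "w \<in> U \<and> \<Phi> w \<in> \<Psi> ` V"
    then obtain v where v: "w \<in> U" "v \<in> V" "\<Phi> w = \<Psi> v" by auto
    then have "w = \<theta> v" using tr(1,2)[OF v(2)] inj_onD[OF inj_Phi] by metis
    then show "w \<in> \<theta> ` V" using v by blast
  qed (use tr(1,2) in auto)
  have "emeasure \<sigma> (B \<inter> \<Psi> ` V) = (\<integral>\<^sup>+w. indicator U w * (ennreal (area_element \<Phi> w) * indicator (B \<inter> \<Psi> ` V) (\<Phi> w)) \<partial>lborel)"
    using B' \<Psi>V by (intro emeasure_\<sigma>) auto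
  also have "\<dots> = (\<integral>\<^sup>+w. indicator (\<theta> ` V) w * f w \<partial>lborel)"
    by (intro nn_integral_cong) (auto simp: f_def indicator_def img)
  also have "\<dots> = (\<integral>\<^sup>+w. indicator V w * (ennreal \<bar>jac (\<theta>' w)\<bar> * f (\<theta> w)) \<partial>lborel)"
    by (rule nn_integral_change_of_variables_plane[OF V tr(3,4,5) f])
  also have "\<dots> = (\<integral>\<^sup>+w\<in>V. ennreal (area_element \<Psi> w) * indicator B (\<Psi> w) \<partial>lborel)"
    by (intro nn_integral_cong)
       (auto simp: f_def indicator_def tr(1,2,6) ennreal_mult area_element)
  finally show "emeasure \<sigma> (B \<inter> \<Psi> ` V) = (\<integral>\<^sup>+w\<in>V. ennreal (area_element \<Psi> w) * indicator B (\<Psi> w) \<partial>lborel)" .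
qed

text \<open>Uniqueness: the patch itself is one local parametrization covering the whole surface.\<close>

lemma surface_measure_eq: "surface_measure M = \<sigma>"
  unfolding surface_measure_def
proof (rule the_equality, rule is_surface_measure_\<sigma>)
  fix \<tau> assume \<tau>: "is_surface_measure M \<tau>"
  have eq: "emeasure \<rho> B = (\<integral>\<^sup>+w\<in>U. ennreal (area_element \<Phi> w) * indicator B (\<Phi> w) \<partial>lborel)"
    if "is_surface_measure M \<rho>" "B \<in> sets \<rho>" for \<rho> B
  proof -
    have "B \<subseteq> M" using that sets.sets_into_space[of B "restrict_space borel M"]
      by (auto simp: is_surface_measure_def space_restrict_space)
    then have "B \<inter> M = B" by blast
    with that(1)[unfolded is_surface_measure_def, THEN conjunct2, rule_format, OF local_parametrization that(2)]
    show ?thesis by simp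
  qed
  show "\<tau> = \<sigma>"
  proof (rule measure_eqI)
    show "sets \<tau> = sets \<sigma>" using \<tau> sets_\<sigma> by (simp add: is_surface_measure_def)
    then show "emeasure \<tau> B = emeasure \<sigma> B" if "B \<in> sets \<tau>" for B
      using eq[OF \<tau>] eq[OF is_surface_measure_\<sigma>] that by simp
  qed
qed

text \<open>The density \<open>W / |N|\<close> cancels the area element up to the horizontal part of the normal.\<close>

theorem H_perimeter_eq: "H_perimeter M = (LINT w:U|lborel. hnorm (normal w))"
proof -
  have U: "U \<in> sets lborel" using open_U by simp
  have meas: "perimeter_density M \<in> borel_measurable (restrict_space borel M)"
  proof (rule borel_measurable_continuous_on_restrict)
    have "continuous_on U (\<lambda>w. hnorm (normal w) / norm (normal w))"
      unfolding hnorm_def using normal_nonzero by (intro continuous_intros cont_normal) auto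
    then have "continuous_on M (\<lambda>g. hnorm (normal (G (snd g))) / norm (normal (G (snd g))))"
      by (rule continuous_on_compose2) (auto intro!: continuous_on_compose2[OF cont_G] continuous_intros)
    then show "continuous_on M (perimeter_density M)"
      by (rule continuous_on_eq) (auto simp: perimeter_density_eq)
  qed
  have "H_perimeter M = (\<integral>w. perimeter_density M (\<Phi> w) \<partial>density (restrict_space lborel U) (\<lambda>w. ennreal (area_element \<Phi> w)))"
    unfolding H_perimeter_def surface_measure_eq \<sigma>_def
    by (subst integral_distr) (use meas in auto)
  also have "\<dots> = (\<integral>w. area_element \<Phi> w *\<^sub>R perimeter_density M (\<Phi> w) \<partial>restrict_space lborel U)"
    by (subst integral_density)
       (auto intro!: measurable_compose[OF measurable_Phi meas] AE_I2 simp: area_element space_restrict_space)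
  also have "\<dots> = (\<integral>w. hnorm (normal w) \<partial>restrict_space lborel U)"
    by (intro Bochner_Integration.integral_cong)
       (auto simp: space_restrict_space area_element perimeter_density_eq normal_nonzero)
  also have "\<dots> = (LINT w:U|lborel. hnorm (normal w))"
    using U by (subst integral_restrict_space) (auto simp: set_lebesgue_integral_def)
  finally show ?thesis .
qed

end


section \<open>Differentiating a length integral\<close>

text \<open>The leading term \<open>p0\<close> keeps the length away from the singularity of the norm, uniformly on the compact box for
  small \<open>l\<close>, so Leibniz' rule applies twice.\<close>

lemma length_integral_derivatives:
  fixes p0 p1 p2 p3 q0 q1 q2 q3 :: "real \<times> real \<Rightarrow> real" and lo hi :: "real \<times> real"
  assumes cont: "continuous_on (cbox lo hi) p0" "continuous_on (cbox lo hi) p1" "continuous_on (cbox lo hi) p2"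
      "continuous_on (cbox lo hi) p3" "continuous_on (cbox lo hi) q0" "continuous_on (cbox lo hi) q1"
      "continuous_on (cbox lo hi) q2" "continuous_on (cbox lo hi) q3"
    and pos: "\<And>w. w \<in> cbox lo hi \<Longrightarrow> p0 w > 0"
  defines "P \<equiv> \<lambda>l w. p0 w + l * p1 w + l^2 * p2 w + l^3 * p3 w"
    and "Q \<equiv> \<lambda>l w. q0 w + l * q1 w + l^2 * q2 w + l^3 * q3 w"
    and "N \<equiv> \<lambda>w. sqrt ((p0 w)\<^sup>2 + (q0 w)\<^sup>2)"
  obtains F' e where "e > 0"
    "\<And>l. \<bar>l\<bar> < e \<Longrightarrow> ((\<lambda>l. integral (cbox lo hi) (\<lambda>w. sqrt ((P l w)\<^sup>2 + (Q l w)\<^sup>2))) has_real_derivative F' l) (at l)"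
    "F' 0 = integral (cbox lo hi) (\<lambda>w. (p0 w * p1 w + q0 w * q1 w) / N w)"
    "(F' has_real_derivative integral (cbox lo hi) (\<lambda>w.
        ((p1 w)\<^sup>2 + (q1 w)\<^sup>2 + 2 * p0 w * p2 w + 2 * q0 w * q2 w) / N w
        - (p0 w * p1 w + q0 w * q1 w)\<^sup>2 / (N w)^3)) (at 0)"
proof -
  let ?B = "cbox lo hi"
  have "\<exists>e>0. \<forall>l w. \<bar>l\<bar> < e \<longrightarrow> w \<in> ?B \<longrightarrow> P l w > 0"
  proof (cases "?B = {}")
    case False
    obtain w0 where w0: "w0 \<in> ?B" "\<And>w. w \<in> ?B \<Longrightarrow> p0 w0 \<le> p0 w"
      using continuous_attains_inf[OF compact_cbox False cont(1)] by blast
    have "continuous_on ?B (\<lambda>w. \<bar>p1 w\<bar> + \<bar>p2 w\<bar> + \<bar>p3 w\<bar>)"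
      by (intro continuous_intros cont)
    then obtain w1 where w1: "\<And>w. w \<in> ?B \<Longrightarrow> \<bar>p1 w\<bar> + \<bar>p2 w\<bar> + \<bar>p3 w\<bar> \<le> \<bar>p1 w1\<bar> + \<bar>p2 w1\<bar> + \<bar>p3 w1\<bar>"
      using continuous_attains_sup[OF compact_cbox False] by blast
    define C where "C = \<bar>p1 w1\<bar> + \<bar>p2 w1\<bar> + \<bar>p3 w1\<bar> + 1"
    have C: "C > 0" by (simp add: C_def add_nonneg_pos)
    define e where "e = min 1 (p0 w0 / C)"
    have "e > 0" using C pos[OF w0(1)] by (simp add: e_def)
    moreover have "P l w > 0" if l: "\<bar>l\<bar> < e" and w: "w \<in> ?B" for l w
    proof -
      have l1: "\<bar>l\<bar> \<le> 1" "\<bar>l\<bar> * C < p0 w0" using l C by (auto simp: e_def field_simps)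
      have "\<bar>l^2 * p2 w\<bar> \<le> \<bar>l\<bar> * \<bar>p2 w\<bar>" "\<bar>l^3 * p3 w\<bar> \<le> \<bar>l\<bar> * \<bar>p3 w\<bar>"
        using power_decreasing[of 1 2 "\<bar>l\<bar>"] power_decreasing[of 1 3 "\<bar>l\<bar>"] l1(1)
        by (auto simp: abs_mult power_abs intro!: mult_right_mono)
      then have "P l w \<ge> p0 w - \<bar>l\<bar> * (\<bar>p1 w\<bar> + \<bar>p2 w\<bar> + \<bar>p3 w\<bar>)"
        using abs_mult[of l "p1 w"] unfolding P_def distrib_left by linarith
      moreover have "\<bar>l\<bar> * (\<bar>p1 w\<bar> + \<bar>p2 w\<bar> + \<bar>p3 w\<bar>) \<le> \<bar>l\<bar> * C"
        using w1[OF w] by (intro mult_left_mono) (auto simp: C_def)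
      ultimately show ?thesis using w0(2)[OF w] l1(2) by linarith
    qed
    ultimately show ?thesis by blast
  qed (auto intro: exI[of _ 1])
  then obtain e where e: "e > 0" "\<And>l w. \<bar>l\<bar> < e \<Longrightarrow> w \<in> ?B \<Longrightarrow> P l w > 0" by blast
  let ?U = "{-e<..<e}"
  define P1 where "P1 l w = p1 w + 2 * l * p2 w + 3 * l^2 * p3 w" for l w
  define Q1 where "Q1 l w = q1 w + 2 * l * q2 w + 3 * l^2 * q3 w" for l w
  define P2 where "P2 l w = 2 * p2 w + 6 * l * p3 w" for l w
  define Q2 where "Q2 l w = 2 * q2 w + 6 * l * q3 w" for l w
  define S where "S l w = (P l w)\<^sup>2 + (Q l w)\<^sup>2" for l w
  define S1 where "S1 l w = 2 * P l w * P1 l w + 2 * Q l w * Q1 l w" for l w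
  define S2 where "S2 l w = 2 * (P1 l w)\<^sup>2 + 2 * P l w * P2 l w + 2 * (Q1 l w)\<^sup>2 + 2 * Q l w * Q2 l w" for l w
  have dP: "((\<lambda>l. P l w) has_real_derivative P1 l w) (at l)" "((\<lambda>l. P1 l w) has_real_derivative P2 l w) (at l)"
    and dQ: "((\<lambda>l. Q l w) has_real_derivative Q1 l w) (at l)" "((\<lambda>l. Q1 l w) has_real_derivative Q2 l w) (at l)" for l w
    unfolding P_def Q_def P1_def Q1_def P2_def Q2_def
    by (auto intro!: derivative_eq_intros simp: algebra_simps)
  have dS: "((\<lambda>l. S l w) has_real_derivative S1 l w) (at l)" "((\<lambda>l. S1 l w) has_real_derivative S2 l w) (at l)" for l w
    unfolding S_def S1_def S2_def
    by (auto intro!: derivative_eq_intros dP dQ simp: algebra_simps power2_eq_square)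
  have S_pos: "S l w > 0" if "l \<in> ?U" "w \<in> ?B" for l w
  proof -
    have "\<bar>l\<bar> < e" using that by auto
    then have "P l w > 0" by (rule e(2)) (rule that(2))
    then show ?thesis unfolding S_def by (intro add_pos_nonneg zero_less_power zero_le_power2)
  qed
  have cP: "continuous_on (?U \<times> ?B) (\<lambda>x. P (fst x) (snd x))" "continuous_on (?U \<times> ?B) (\<lambda>x. Q (fst x) (snd x))"
    "continuous_on (?U \<times> ?B) (\<lambda>x. P1 (fst x) (snd x))" "continuous_on (?U \<times> ?B) (\<lambda>x. Q1 (fst x) (snd x))"
    "continuous_on (?U \<times> ?B) (\<lambda>x. P2 (fst x) (snd x))" "continuous_on (?U \<times> ?B) (\<lambda>x. Q2 (fst x) (snd x))"
    unfolding P_def Q_def P1_def Q1_def P2_def Q2_def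
    by (intro continuous_intros cont[THEN continuous_on_compose2]; force)+
  have cS: "continuous_on (?U \<times> ?B) (\<lambda>x. S (fst x) (snd x))"
    "continuous_on (?U \<times> ?B) (\<lambda>x. S1 (fst x) (snd x))" "continuous_on (?U \<times> ?B) (\<lambda>x. S2 (fst x) (snd x))"
    unfolding S_def S1_def S2_def by (intro continuous_intros cP)+
  define T1 where "T1 l w = S1 l w / (2 * sqrt (S l w))" for l w
  define T2 where "T2 l w = S2 l w / (2 * sqrt (S l w)) - (S1 l w)\<^sup>2 / (4 * (sqrt (S l w))^3)" for l w
  have nz: "S (fst x) (snd x) \<noteq> 0" if "x \<in> ?U \<times> ?B" for x
    using S_pos[of "fst x" "snd x"] that by force
  have cT: "continuous_on (?U \<times> ?B) (\<lambda>x. sqrt (S (fst x) (snd x)))"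
    "continuous_on (?U \<times> ?B) (\<lambda>x. T1 (fst x) (snd x))" "continuous_on (?U \<times> ?B) (\<lambda>x. T2 (fst x) (snd x))"
    unfolding T1_def T2_def by (intro continuous_intros cS; use nz in auto)+
  have slice: "continuous_on ?B (f l)" if "continuous_on (?U \<times> ?B) (\<lambda>x. f (fst x) (snd x))" "l \<in> ?U"
    for f :: "real \<Rightarrow> real \<times> real \<Rightarrow> real" and l
  proof -
    have "continuous_on ?B (\<lambda>w. (l, w))" by (intro continuous_intros)
    moreover have "Pair l ` ?B \<subseteq> ?U \<times> ?B" using that(2) by auto
    ultimately have "continuous_on ?B (\<lambda>w. f (fst (l, w)) (snd (l, w)))"
      by (rule continuous_on_compose2[OF that(1)])
    then show ?thesis by simp
  qed
  have dT: "((\<lambda>l. sqrt (S l w)) has_real_derivative T1 l w) (at l within ?U)"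
    "((\<lambda>l. T1 l w) has_real_derivative T2 l w) (at l within ?U)" if "l \<in> ?U" "w \<in> ?B" for l w
  proof -
    have "S l w > 0" by (rule S_pos[OF that])
    then have d: "((\<lambda>l. sqrt (S l w)) has_real_derivative T1 l w) (at l)"
      by (auto intro!: derivative_eq_intros dS simp: T1_def field_simps)
    have "sqrt (S l w) > 0" using \<open>S l w > 0\<close> by simp
    then have "((\<lambda>l. T1 l w) has_real_derivative T2 l w) (at l)"
      unfolding T1_def
      by (auto intro!: derivative_eq_intros dS d)
         (simp add: T1_def T2_def field_simps power2_eq_square power3_eq_cube)
    then show "((\<lambda>l. sqrt (S l w)) has_real_derivative T1 l w) (at l within ?U)"
      "((\<lambda>l. T1 l w) has_real_derivative T2 l w) (at l within ?U)"
      using d DERIV_subset by blast+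
  qed
  have D1: "((\<lambda>l. integral ?B (\<lambda>w. sqrt (S l w))) has_real_derivative integral ?B (T1 l)) (at l)" if "\<bar>l\<bar> < e" for l
  proof -
    have l: "l \<in> ?U" using that by auto
    have "((\<lambda>l. integral ?B (\<lambda>w. sqrt (S l w))) has_real_derivative integral ?B (T1 l)) (at l within ?U)"
      by (rule leibniz_rule_field_derivative[OF dT(1)])
         (use l cT(2) slice[OF cT(1)] in \<open>simp_all add: split_beta integrable_continuous\<close>)
    then show ?thesis
      by (simp only: at_within_open[OF l open_greaterThanLessThan])
  qed
  have D2: "((\<lambda>l. integral ?B (T1 l)) has_real_derivative integral ?B (T2 0)) (at 0)"
  proof -
    have l: "0 \<in> ?U" using e by auto
    have "((\<lambda>l. integral ?B (T1 l)) has_real_derivative integral ?B (T2 0)) (at 0 within ?U)"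
      by (rule leibniz_rule_field_derivative[OF dT(2)])
         (use l cT(3) slice[OF cT(2)] in \<open>simp_all add: split_beta integrable_continuous\<close>)
    then show ?thesis
      by (simp only: at_within_open[OF l open_greaterThanLessThan])
  qed
  have at0: "S 0 w = (p0 w)\<^sup>2 + (q0 w)\<^sup>2" "S1 0 w = 2 * (p0 w * p1 w + q0 w * q1 w)"
    "S2 0 w = 2 * ((p1 w)\<^sup>2 + (q1 w)\<^sup>2 + 2 * p0 w * p2 w + 2 * q0 w * q2 w)" for w
    by (simp_all add: S_def S1_def S2_def P_def Q_def P1_def Q1_def P2_def Q2_def)
  have T: "T1 0 = (\<lambda>w. (p0 w * p1 w + q0 w * q1 w) / N w)"
    "T2 0 = (\<lambda>w. ((p1 w)\<^sup>2 + (q1 w)\<^sup>2 + 2 * p0 w * p2 w + 2 * q0 w * q2 w) / N w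
        - (p0 w * p1 w + q0 w * q1 w)\<^sup>2 / (N w)^3)"
  proof -
    have "2 * x / (2 * n) = x / n" "2 * y / (2 * n) - (2 * x)\<^sup>2 / (4 * n ^ 3) = y / n - x\<^sup>2 / n ^ 3" for x y n :: real
      by (simp_all add: power_mult_distrib)
    then show "T1 0 = (\<lambda>w. (p0 w * p1 w + q0 w * q1 w) / N w)"
      "T2 0 = (\<lambda>w. ((p1 w)\<^sup>2 + (q1 w)\<^sup>2 + 2 * p0 w * p2 w + 2 * q0 w * q2 w) / N w
        - (p0 w * p1 w + q0 w * q1 w)\<^sup>2 / (N w)^3)"
      by (simp_all only: fun_eq_iff T1_def T2_def at0 N_def simp_thms)
  qed
  show ?thesis
    by (rule that[OF e(1) D1[unfolded S_def] _ D2[unfolded T]]) (simp_all only: T)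
qed


section \<open>Functions on the plane with continuous partial derivatives\<close>

text \<open>\<open>C\<^sup>1\<close> functions with their two partial derivatives as explicit data, so that integrands can be computed.\<close>

definition has_partials :: "(real \<times> real \<Rightarrow> real) \<Rightarrow> (real \<times> real \<Rightarrow> real) \<Rightarrow> (real \<times> real \<Rightarrow> real) \<Rightarrow> bool" where
  "has_partials f fu fs \<longleftrightarrow>
     (\<forall>w. (f has_derivative (\<lambda>h. fst h * fu w + snd h * fs w)) (at w)) \<and>
     continuous_on UNIV fu \<and> continuous_on UNIV fs"

text \<open>Vanishing also on the lines \<open>|u| = R\<close> and \<open>|s| = R\<close> removes the boundary terms of integrations by parts over the
closed square.\<close>

definition vanishes_off :: "real \<Rightarrow> (real \<times> real \<Rightarrow> real) \<Rightarrow> bool" where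
  "vanishes_off R f \<longleftrightarrow> (\<forall>u s. \<bar>u\<bar> \<ge> R \<or> \<bar>s\<bar> \<ge> R \<longrightarrow> f (u, s) = 0)"

lemma has_partialsD:
  assumes "has_partials f fu fs"
  shows "(f has_derivative (\<lambda>h. fst h * fu w + snd h * fs w)) (at w)"
    and "continuous_on A f" "continuous_on A fu" "continuous_on A fs"
proof -
  show d: "(f has_derivative (\<lambda>h. fst h * fu w + snd h * fs w)) (at w)" for w
    using assms unfolding has_partials_def by blast
  show "continuous_on A f"
    by (rule continuous_at_imp_continuous_on) (auto intro: has_derivative_continuous[OF d])
  show "continuous_on A fu" "continuous_on A fs"
    using assms unfolding has_partials_def by (auto intro: continuous_on_subset)
qed

lemma has_partials_cong:
  "has_partials f fu fs \<Longrightarrow> fu = gu \<Longrightarrow> fs = gs \<Longrightarrow> has_partials f gu gs"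
  by simp

lemma has_partials_const: "has_partials (\<lambda>w. c) (\<lambda>w. 0) (\<lambda>w. 0)"
  by (simp add: has_partials_def)

lemma has_partials_add:
  assumes "has_partials f fu fs" "has_partials g gu gs"
  shows "has_partials (\<lambda>w. f w + g w) (\<lambda>w. fu w + gu w) (\<lambda>w. fs w + gs w)"
  unfolding has_partials_def
  by (intro conjI allI continuous_on_add has_partialsD[OF assms(1)] has_partialsD[OF assms(2)]
      has_derivative_eq_rhs[OF has_derivative_add[OF has_partialsD(1)[OF assms(1)] has_partialsD(1)[OF assms(2)]]])
     (simp add: algebra_simps)

lemma has_partials_mult:
  assumes "has_partials f fu fs" "has_partials g gu gs"
  shows "has_partials (\<lambda>w. f w * g w) (\<lambda>w. fu w * g w + f w * gu w) (\<lambda>w. fs w * g w + f w * gs w)"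
  unfolding has_partials_def
  by (intro conjI allI continuous_on_add continuous_on_mult has_partialsD[OF assms(1)] has_partialsD[OF assms(2)]
      has_derivative_eq_rhs[OF has_derivative_mult[OF has_partialsD(1)[OF assms(1)] has_partialsD(1)[OF assms(2)]]])
     (simp add: algebra_simps)

lemma has_partials_fst:
  assumes "\<And>x. (f has_real_derivative f' x) (at x)" "continuous_on UNIV f'"
  shows "has_partials (\<lambda>w. f (fst w)) (\<lambda>w. f' (fst w)) (\<lambda>w. 0)"
proof -
  have "((\<lambda>w. f (fst w)) has_derivative (\<lambda>h. fst h * f' (fst w) + snd h * 0)) (at w)" for w :: "real \<times> real"
    using has_derivative_compose[OF has_derivative_fst[OF has_derivative_ident] assms(1)[unfolded has_field_derivative_def], of w UNIV]
    by (simp add: mult.commute)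
  moreover have "continuous_on UNIV (\<lambda>w::real \<times> real. f' (fst w))"
    by (rule continuous_on_compose2[OF assms(2)]) (auto intro: continuous_intros)
  ultimately show ?thesis by (simp add: has_partials_def)
qed

lemma has_partials_snd:
  assumes "\<And>x. (f has_real_derivative f' x) (at x)" "continuous_on UNIV f'"
  shows "has_partials (\<lambda>w. f (snd w)) (\<lambda>w. 0) (\<lambda>w. f' (snd w))"
proof -
  have "((\<lambda>w. f (snd w)) has_derivative (\<lambda>h. fst h * 0 + snd h * f' (snd w))) (at w)" for w :: "real \<times> real"
    using has_derivative_compose[OF has_derivative_snd[OF has_derivative_ident] assms(1)[unfolded has_field_derivative_def], of w UNIV]
    by (simp add: mult.commute)
  moreover have "continuous_on UNIV (\<lambda>w::real \<times> real. f' (snd w))"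
    by (rule continuous_on_compose2[OF assms(2)]) (auto intro: continuous_intros)
  ultimately show ?thesis by (simp add: has_partials_def)
qed

lemma partials_zero_of_locally_zero:
  assumes "has_partials f fu fs" "open V" "w \<in> V" "\<And>w. w \<in> V \<Longrightarrow> f w = 0"
  shows "fu w = 0" "fs w = 0"
proof -
  have "(f has_derivative (\<lambda>h. 0)) (at w)"
    by (rule has_derivative_transform_within_open[of "\<lambda>_. 0", OF _ assms(2,3)]) (use assms(4) in auto)
  with has_partialsD(1)[OF assms(1)] have "(\<lambda>h. fst h * fu w + snd h * fs w) = (\<lambda>h. 0)"
    by (rule has_derivative_unique)
  then have "fst h * fu w + snd h * fs w = 0" for h by metis
  from this[of "(1, 0)"] this[of "(0, 1)"] show "fu w = 0" "fs w = 0" by auto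
qed

lemma has_partials_bounded:
  assumes "has_partials f fu fs" "vanishes_off R f"
  obtains C where "C > 0" "\<And>w. \<bar>fu w\<bar> \<le> C" "\<And>w. \<bar>fs w\<bar> \<le> C"
proof -
  let ?B = "cbox (-R, -R) (R, R)"
  have "bounded (fu ` ?B)" "bounded (fs ` ?B)"
    using has_partialsD(3,4)[OF assms(1)] by (auto intro!: compact_imp_bounded compact_continuous_image)
  then obtain C1 C2 where C: "\<And>w. w \<in> ?B \<Longrightarrow> \<bar>fu w\<bar> \<le> C1" "\<And>w. w \<in> ?B \<Longrightarrow> \<bar>fs w\<bar> \<le> C2"
    unfolding bounded_iff by (metis imageI real_norm_def)
  have off: "fu w = 0" "fs w = 0" if "w \<notin> ?B" for w
  proof -
    have "f v = 0" if "v \<in> - ?B" for v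
      using that assms(2) by (cases v) (auto simp: vanishes_off_def)
    then show "fu w = 0" "fs w = 0"
      using partials_zero_of_locally_zero[OF assms(1), of "- ?B" w] that by (auto simp: closed_cbox open_Compl)
  qed
  show ?thesis
  proof
    show "\<bar>C1\<bar> + \<bar>C2\<bar> + 1 > 0" by linarith
    show "\<bar>fu w\<bar> \<le> \<bar>C1\<bar> + \<bar>C2\<bar> + 1" "\<bar>fs w\<bar> \<le> \<bar>C1\<bar> + \<bar>C2\<bar> + 1" for w
      using C[of w] off[of w] by (cases "w \<in> ?B"; force)+
  qed
qed

lemma has_partials_lipschitz:
  assumes "has_partials f fu fs" "\<And>w. \<bar>fu w\<bar> \<le> C" "\<And>w. \<bar>fs w\<bar> \<le> C"
  shows "\<bar>f w - f w'\<bar> \<le> 2 * C * norm (w - w')"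
proof -
  have "norm (f w - f w') \<le> 2 * C * norm (w - w')"
  proof (rule differentiable_bound[of UNIV])
    show "(f has_derivative (\<lambda>h. fst h * fu v + snd h * fs v)) (at v within UNIV)" for v
      using has_partialsD(1)[OF assms(1)] by simp
    show "onorm (\<lambda>h. fst h * fu v + snd h * fs v) \<le> 2 * C" for v
    proof (rule onorm_le)
      fix h :: "real \<times> real"
      have "\<bar>fst h * fu v\<bar> \<le> norm h * C" "\<bar>snd h * fs v\<bar> \<le> norm h * C"
        using norm_fst_le[of "fst h" "snd h"] norm_snd_le[of "snd h" "fst h"] assms(2,3)[of v]
        by (auto simp: abs_mult intro!: mult_mono)
      then show "norm (fst h * fu v + snd h * fs v) \<le> 2 * C * norm h"
        by (simp add: algebra_simps)
    qed
  qed auto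
  then show ?thesis by simp
qed

text \<open>Fubini and the fundamental theorem of calculus in the direction of the derivative.\<close>

lemma integral_partials_zero:
  assumes "has_partials f fu fs" "vanishes_off R f" "R > 0"
  shows "integral (cbox (-R, -R) (R, R)) fu = 0" "integral (cbox (-R, -R) (R, R)) fs = 0"
proof -
  have pu: "((\<lambda>u. (u, s)) has_derivative (\<lambda>h. (h, 0))) (at u within A)" for u s :: real and A
    by (intro derivative_intros)
  have ps: "((\<lambda>s. (u, s)) has_derivative (\<lambda>h. (0, h))) (at s within A)" for u s :: real and A
    by (intro derivative_intros)
  have du: "((\<lambda>u. f (u, s)) has_vector_derivative fu (u, s)) (at u within A)" for u s A
    using has_derivative_compose[OF pu has_partialsD(1)[OF assms(1)], of s u A]
    by (simp add: has_vector_derivative_def)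
  have ds: "((\<lambda>s. f (u, s)) has_vector_derivative fs (u, s)) (at s within A)" for u s A
    using has_derivative_compose[OF ps has_partialsD(1)[OF assms(1)], of u s A]
    by (simp add: has_vector_derivative_def)
  have zu: "integral {-R..R} (\<lambda>u. fu (u, s)) = 0" for s
    using fundamental_theorem_of_calculus[of "-R" R "\<lambda>u. f (u, s)" "\<lambda>u. fu (u, s)", OF _ du] assms(2,3)
    by (simp add: vanishes_off_def integral_unique)
  have zs: "integral {-R..R} (\<lambda>s. fs (u, s)) = 0" for u
    using fundamental_theorem_of_calculus[of "-R" R "\<lambda>s. f (u, s)" "\<lambda>s. fs (u, s)", OF _ ds] assms(2,3)
    by (simp add: vanishes_off_def integral_unique)
  have "integral (cbox (-R, -R) (R, R)) fu = integral (cbox (-R) R) (\<lambda>u. integral (cbox (-R) R) (\<lambda>s. fu (u, s)))"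
    by (rule integral_prod_continuous[OF has_partialsD(3)[OF assms(1)]])
  also have "\<dots> = integral (cbox (-R) R) (\<lambda>s. integral (cbox (-R) R) (\<lambda>u. fu (u, s)))"
    by (rule integral_swap_continuous) (simp add: has_partialsD(3)[OF assms(1)])
  finally show "integral (cbox (-R, -R) (R, R)) fu = 0" by (simp add: zu)
  show "integral (cbox (-R, -R) (R, R)) fs = 0"
    using integral_prod_continuous[OF has_partialsD(4)[OF assms(1)], of "-R" "-R" R R] by (simp add: zs)
qed


section \<open>Variations of the surface in adapted coordinates\<close>

text \<open>The second parameter is the slope \<open>s = \<alpha> t + \<beta>\<close> of the ruling through the point, rather than \<open>t\<close>.\<close>

definition chart :: "real \<Rightarrow> real \<Rightarrow> real \<times> real \<Rightarrow> heis" where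
  "chart \<alpha> \<beta> w = (fst w * snd w, fst w, (snd w - \<beta>) / \<alpha>)"

definition coords :: "real \<Rightarrow> real \<Rightarrow> heis \<Rightarrow> real \<times> real" where
  "coords \<alpha> \<beta> g = (fst (snd g), \<alpha> * snd (snd g) + \<beta>)"

lemma coords_chart [simp]: "\<alpha> \<noteq> 0 \<Longrightarrow> coords \<alpha> \<beta> (chart \<alpha> \<beta> w) = w"
  by (simp add: coords_def chart_def)

lemma strip_eq_range: "\<alpha> \<noteq> 0 \<Longrightarrow> strip \<alpha> \<beta> = range (chart \<alpha> \<beta>)"
proof (intro equalityI subsetI)
  fix g assume "\<alpha> \<noteq> 0" "g \<in> strip \<alpha> \<beta>"
  then have "g = chart \<alpha> \<beta> (coords \<alpha> \<beta> g)"
    by (cases g) (simp add: strip_def chart_def coords_def)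
  then show "g \<in> range (chart \<alpha> \<beta>)" by blast
qed (auto simp: strip_def chart_def)

lemma continuous_chart: "continuous_on A (chart \<alpha> \<beta>)" and continuous_coords: "continuous_on B (coords \<alpha> \<beta>)"
  unfolding chart_def [abs_def] coords_def [abs_def] divide_inverse
  by (intro continuous_intros)+

lemma closed_strip: "closed (strip \<alpha> \<beta>)"
proof -
  have "strip \<alpha> \<beta> = {g. fst g = fst (snd g) * (\<alpha> * snd (snd g) + \<beta>)}"
    by (auto simp: strip_def)
  then show ?thesis by (simp only:) (intro closed_Collect_eq continuous_intros)
qed

lemma has_partials_coord: "has_partials fst (\<lambda>w. 1) (\<lambda>w. 0)" "has_partials snd (\<lambda>w. 0) (\<lambda>w. 1)"
  by (auto simp: has_partials_def intro!: derivative_eq_intros)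

text \<open>A variation field \<open>a X\<^sub>1 + b X\<^sub>2 + k T\<close> along the surface, read in the coordinates \<open>(u, s)\<close>. The
subscripts denote partial derivatives, and the coefficients vanish outside the open square of half-width \<open>R\<close>.\<close>

locale strip_variation =
  fixes \<alpha> \<beta> R :: real and a a\<^sub>u a\<^sub>s b b\<^sub>u b\<^sub>s k k\<^sub>u k\<^sub>s :: "real \<times> real \<Rightarrow> real"
  assumes \<alpha>: "\<alpha> > 0" and R: "R > 0"
    and partials: "has_partials a a\<^sub>u a\<^sub>s" "has_partials b b\<^sub>u b\<^sub>s" "has_partials k k\<^sub>u k\<^sub>s"
    and vanish: "vanishes_off R a" "vanishes_off R b" "vanishes_off R k"
begin

text \<open>The \<open>\<partial>\<^sub>t\<close>-component of the field.\<close>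

definition "c w = k w + (fst w * snd w * b w - fst w * a w) / 2"
definition "c\<^sub>u w = k\<^sub>u w + (snd w * b w + fst w * snd w * b\<^sub>u w - a w - fst w * a\<^sub>u w) / 2"
definition "c\<^sub>s w = k\<^sub>s w + (fst w * b w + fst w * snd w * b\<^sub>s w - fst w * a\<^sub>s w) / 2"

definition "field w = a w *\<^sub>R X1 (chart \<alpha> \<beta> w) + b w *\<^sub>R X2 (chart \<alpha> \<beta> w) + k w *\<^sub>R XT (chart \<alpha> \<beta> w)"

lemma field_eq: "field w = (a w, b w, c w)"
  by (simp add: field_def c_def chart_def field_simps)

lemma partials_c: "has_partials c c\<^sub>u c\<^sub>s"
proof -
  have eq: "c = (\<lambda>w. k w + ((fst w * snd w) * b w + (- 1) * (fst w * a w)) * (1 / 2))"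
    by (simp add: c_def fun_eq_iff)
  show ?thesis
    unfolding eq
    by (rule has_partials_cong, (rule has_partials_add has_partials_mult has_partials_coord
        has_partials_const partials)+)
       (simp_all add: c\<^sub>u_def c\<^sub>s_def fun_eq_iff field_simps)
qed

lemma vanish_c: "vanishes_off R c"
  using vanish by (simp add: vanishes_off_def c_def)

definition "\<Phi> l w = chart \<alpha> \<beta> w + l *\<^sub>R field w"
definition "\<Phi>' l w h = (fst h * (snd w + l * a\<^sub>u w) + snd h * (fst w + l * a\<^sub>s w),
    fst h * (1 + l * b\<^sub>u w) + snd h * (l * b\<^sub>s w), fst h * (l * c\<^sub>u w) + snd h * (1 / \<alpha> + l * c\<^sub>s w))"

lemma \<Phi>_eq: "\<Phi> l w = (fst w * snd w + l * a w, fst w + l * b w, snd w * (1 / \<alpha>) + (- \<beta> / \<alpha> + l * c w))"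
  by (simp add: \<Phi>_def field_eq chart_def diff_divide_distrib)

lemma partials_\<Phi>:
  "has_partials (\<lambda>w. fst w * snd w + l * a w) (\<lambda>w. snd w + l * a\<^sub>u w) (\<lambda>w. fst w + l * a\<^sub>s w)"
  "has_partials (\<lambda>w. fst w + l * b w) (\<lambda>w. 1 + l * b\<^sub>u w) (\<lambda>w. l * b\<^sub>s w)"
  "has_partials (\<lambda>w. snd w * (1 / \<alpha>) + (- \<beta> / \<alpha> + l * c w)) (\<lambda>w. l * c\<^sub>u w) (\<lambda>w. 1 / \<alpha> + l * c\<^sub>s w)"
proof -
  show "has_partials (\<lambda>w. fst w * snd w + l * a w) (\<lambda>w. snd w + l * a\<^sub>u w) (\<lambda>w. fst w + l * a\<^sub>s w)"
    by (rule has_partials_cong, (rule has_partials_add has_partials_mult has_partials_coord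
        has_partials_const partials)+) simp_all
  show "has_partials (\<lambda>w. fst w + l * b w) (\<lambda>w. 1 + l * b\<^sub>u w) (\<lambda>w. l * b\<^sub>s w)"
    by (rule has_partials_cong, (rule has_partials_add has_partials_mult has_partials_coord
        has_partials_const partials)+) simp_all
  show "has_partials (\<lambda>w. snd w * (1 / \<alpha>) + (- \<beta> / \<alpha> + l * c w)) (\<lambda>w. l * c\<^sub>u w) (\<lambda>w. 1 / \<alpha> + l * c\<^sub>s w)"
    by (rule has_partials_cong, (rule has_partials_add has_partials_mult has_partials_coord
        has_partials_const partials_c)+) simp_all
qed

lemma deriv_\<Phi>: "(\<Phi> l has_derivative \<Phi>' l w) (at w)"
  unfolding \<Phi>_eq [abs_def] \<Phi>'_def [abs_def]
  by (intro has_derivative_Pair partials_\<Phi>[THEN has_partialsD(1)])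

lemma cont_\<Phi>': "continuous_on A (\<lambda>w. \<Phi>' l w h)"
  unfolding \<Phi>'_def
  by (intro continuous_on_Pair continuous_on_add continuous_on_mult continuous_on_const
      partials_\<Phi>[THEN has_partialsD(3)] partials_\<Phi>[THEN has_partialsD(4)])

text \<open>For small \<open>l\<close> the deformed surface is still a graph over the \<open>yt\<close>-plane: its projection
  is a small Lipschitz perturbation of a linear isomorphism.\<close>

lemma deformed_patch:
  obtains e where "e > 0" "\<And>l U. \<bar>l\<bar> < e \<Longrightarrow> open U \<Longrightarrow> C1_graph_patch U (\<Phi> l) (\<Phi>' l)"
proof -
  obtain C1 where C1: "C1 > 0" "\<And>w. \<bar>b\<^sub>u w\<bar> \<le> C1" "\<And>w. \<bar>b\<^sub>s w\<bar> \<le> C1"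
    using has_partials_bounded[OF partials(2) vanish(2)] by blast
  obtain C2 where C2: "C2 > 0" "\<And>w. \<bar>c\<^sub>u w\<bar> \<le> C2" "\<And>w. \<bar>c\<^sub>s w\<bar> \<le> C2"
    using has_partials_bounded[OF partials_c vanish_c] by blast
  define C where "C = C1 + C2"
  have C: "C > 0" "\<And>w. \<bar>b\<^sub>u w\<bar> \<le> C" "\<And>w. \<bar>b\<^sub>s w\<bar> \<le> C" "\<And>w. \<bar>c\<^sub>u w\<bar> \<le> C" "\<And>w. \<bar>c\<^sub>s w\<bar> \<le> C"
    using C1 C2 by (auto simp: C_def add_increasing add_increasing2 less_imp_le)
  \<comment> \<open>\<open>C\<close> bounds the partial derivatives, so the perturbation has Lipschitz constant at most
    \<open>|l| * 2 C (1 + \<alpha>) < 1 / 2\<close> in the coordinates \<open>(u, s)\<close>.\<close>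
  define e where "e = 1 / (4 * C * (1 + \<alpha>))"
  have "e > 0" using C(1) \<alpha> by (simp add: e_def)
  moreover have "C1_graph_patch U (\<Phi> l) (\<Phi>' l)" if l: "\<bar>l\<bar> < e" and U: "open U" for l U
  proof
    have "\<bar>l\<bar> * (C * (1 + \<alpha>)) < e * (C * (1 + \<alpha>))"
      using l C(1) \<alpha> by (intro mult_strict_right_mono) auto
    also have "e * (C * (1 + \<alpha>)) = 1 / 4" using C(1) \<alpha> by (simp add: e_def)
    finally have small: "\<bar>l\<bar> * C + \<alpha> * (\<bar>l\<bar> * C) < 1 / 4" by (simp add: algebra_simps)
    have nonneg: "0 \<le> \<bar>l\<bar> * C" "0 \<le> \<alpha> * (\<bar>l\<bar> * C)" using C(1) \<alpha> by simp_all
    show "inj_on (snd \<circ> \<Phi> l) U"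
    proof (rule inj_onI)
      fix w w' assume "(snd \<circ> \<Phi> l) w = (snd \<circ> \<Phi> l) w'"
      then have eq: "fst w - fst w' = - l * (b w - b w')" "(snd w - snd w') / \<alpha> = - l * (c w - c w')"
        by (auto simp: \<Phi>_eq algebra_simps diff_divide_distrib)
      let ?n = "norm (w - w')"
      have "\<bar>fst w - fst w'\<bar> \<le> \<bar>l\<bar> * (2 * C * ?n)"
        unfolding eq abs_mult abs_minus
        by (intro mult_left_mono has_partials_lipschitz[OF partials(2)] C) auto
      moreover have "\<bar>snd w - snd w'\<bar> \<le> \<alpha> * (\<bar>l\<bar> * (2 * C * ?n))"
      proof -
        have "\<bar>snd w - snd w'\<bar> = \<alpha> * \<bar>(snd w - snd w') / \<alpha>\<bar>" using \<alpha> by simp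
        also have "\<dots> \<le> \<alpha> * (\<bar>l\<bar> * (2 * C * ?n))"
          unfolding eq abs_mult abs_minus using \<alpha>
          by (intro mult_left_mono has_partials_lipschitz[OF partials_c] C) auto
        finally show ?thesis .
      qed
      moreover have "?n \<le> \<bar>fst w - fst w'\<bar> + \<bar>snd w - snd w'\<bar>"
      proof -
        have "w - w' = (fst w - fst w', snd w - snd w')" by (simp add: prod_eq_iff)
        then show ?thesis using norm_Pair_le[of "fst w - fst w'" "snd w - snd w'"] by simp
      qed
      ultimately have "?n \<le> 2 * ?n * (\<bar>l\<bar> * C + \<alpha> * (\<bar>l\<bar> * C))"
        by (simp add: algebra_simps)
      also have "\<dots> \<le> 2 * ?n * (1 / 4)"
        using small by (intro mult_left_mono) auto
      finally show "w = w'" by simp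
    qed
    show "jac (snd \<circ> \<Phi>' l w) \<noteq> 0" for w
    proof -
      have bd: "\<bar>l * b\<^sub>u w\<bar> \<le> 1 / 4" "\<bar>l * b\<^sub>s w\<bar> \<le> 1 / 4" "\<bar>l * (\<alpha> * c\<^sub>u w)\<bar> \<le> 1 / 4" "\<bar>l * (\<alpha> * c\<^sub>s w)\<bar> \<le> 1 / 4"
      proof -
        have "\<bar>l\<bar> * x \<le> 1 / 4" "\<alpha> * (\<bar>l\<bar> * x) \<le> 1 / 4" if "x \<le> C" for x
          using mult_left_mono[OF that abs_ge_zero[of l]] mult_left_mono[OF mult_left_mono[OF that abs_ge_zero[of l]], of \<alpha>]
            small nonneg \<alpha> by linarith+
        then show "\<bar>l * b\<^sub>u w\<bar> \<le> 1 / 4" "\<bar>l * b\<^sub>s w\<bar> \<le> 1 / 4" "\<bar>l * (\<alpha> * c\<^sub>u w)\<bar> \<le> 1 / 4" "\<bar>l * (\<alpha> * c\<^sub>s w)\<bar> \<le> 1 / 4"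
          using C \<alpha> by (simp_all add: abs_mult mult.left_commute)
      qed
      have "\<alpha> * jac (snd \<circ> \<Phi>' l w) = (1 + l * b\<^sub>u w) * (1 + l * (\<alpha> * c\<^sub>s w)) - (l * b\<^sub>s w) * (l * (\<alpha> * c\<^sub>u w))"
        using \<alpha> by (simp add: jac_def \<Phi>'_def field_simps)
      moreover have "(3 / 4) * (3 / 4) \<le> (1 + l * b\<^sub>u w) * (1 + l * (\<alpha> * c\<^sub>s w))"
        using bd by (intro mult_mono) (auto simp: abs_le_iff)
      moreover have "\<bar>(l * b\<^sub>s w) * (l * (\<alpha> * c\<^sub>u w))\<bar> \<le> (1 / 4) * (1 / 4)"
        unfolding abs_mult[of "l * b\<^sub>s w"] using bd by (intro mult_mono) auto
      ultimately have "\<alpha> * jac (snd \<circ> \<Phi>' l w) > 0" by linarith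
      then show ?thesis by auto
    qed
  qed (use U in \<open>auto intro: deriv_\<Phi> cont_\<Phi>'\<close>)
  ultimately show ?thesis using that by blast
qed

text \<open>On the undeformed surface the contact form restricts to \<open>\<mu> ds\<close>; this is how \<open>\<mu>\<close> enters.\<close>

definition "\<mu> (w :: real \<times> real) = 1 / \<alpha> + (fst w)\<^sup>2 / 2"

text \<open>The contact form on the coordinate vectors of the deformed surface is \<open>l \<theta>1u + l\<^sup>2 \<theta>2u\<close> on \<open>\<Phi>\<^sub>u\<close> and
\<open>\<mu> + l \<theta>1s + l\<^sup>2 \<theta>2s\<close> on \<open>\<Phi>\<^sub>s\<close>.\<close>

definition "\<theta>1u w = k\<^sub>u w + snd w * b w - a w"
definition "\<theta>2u w = (b w * a\<^sub>u w - a w * b\<^sub>u w) / 2"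
definition "\<theta>1s w = k\<^sub>s w + fst w * b w"
definition "\<theta>2s w = (b w * a\<^sub>s w - a w * b\<^sub>s w) / 2"

text \<open>The coefficients of the powers of \<open>l\<close> in \<open>dy \<and> \<theta>\<close> and \<open>dx \<and> \<theta>\<close>.\<close>

definition "p0 w = \<mu> w"
definition "p1 w = \<theta>1s w + b\<^sub>u w * \<mu> w"
definition "p2 w = \<theta>2s w + b\<^sub>u w * \<theta>1s w - \<theta>1u w * b\<^sub>s w"
definition "p3 w = b\<^sub>u w * \<theta>2s w - \<theta>2u w * b\<^sub>s w"
definition "q0 w = snd w * \<mu> w"
definition "q1 w = snd w * \<theta>1s w + a\<^sub>u w * \<mu> w - fst w * \<theta>1u w"
definition "q2 w = snd w * \<theta>2s w + a\<^sub>u w * \<theta>1s w - fst w * \<theta>2u w - a\<^sub>s w * \<theta>1u w"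
definition "q3 w = a\<^sub>u w * \<theta>2s w - \<theta>2u w * a\<^sub>s w"

definition "len l w = sqrt ((p0 w + l * p1 w + l^2 * p2 w + l^3 * p3 w)\<^sup>2 + (q0 w + l * q1 w + l^2 * q2 w + l^3 * q3 w)\<^sup>2)"

lemma contact_\<Phi>':
  "frame_coords (\<Phi> l w) (\<Phi>' l w (1, 0)) = (snd w + l * a\<^sub>u w, 1 + l * b\<^sub>u w, l * \<theta>1u w + l^2 * \<theta>2u w)"
  "frame_coords (\<Phi> l w) (\<Phi>' l w (0, 1)) = (fst w + l * a\<^sub>s w, l * b\<^sub>s w, \<mu> w + l * \<theta>1s w + l^2 * \<theta>2s w)"
  by (simp_all add: \<Phi>_eq \<Phi>'_def c\<^sub>u_def c\<^sub>s_def \<theta>1u_def \<theta>2u_def \<theta>1s_def \<theta>2s_def \<mu>_def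
      algebra_simps power2_eq_square add_divide_distrib diff_divide_distrib)

lemma hnorm_normal: "hnorm (frame_normal (\<Phi> l w) (\<Phi>' l w)) = len l w"
proof -
  have "fst (frame_normal (\<Phi> l w) (\<Phi>' l w)) = p0 w + l * p1 w + l^2 * p2 w + l^3 * p3 w"
    "fst (snd (frame_normal (\<Phi> l w) (\<Phi>' l w))) = - (q0 w + l * q1 w + l^2 * q2 w + l^3 * q3 w)"
    unfolding frame_normal_def contact_\<Phi>' cross_def p0_def p1_def p2_def p3_def q0_def q1_def q2_def q3_def
    by (simp_all add: algebra_simps power2_eq_square power3_eq_cube)
  then show ?thesis by (simp only: hnorm_def len_def power2_minus)
qed

lemma cont_coeffs:
  "continuous_on A p0" "continuous_on A p1" "continuous_on A p2" "continuous_on A p3"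
  "continuous_on A q0" "continuous_on A q1" "continuous_on A q2" "continuous_on A q3"
  unfolding p0_def [abs_def] p1_def [abs_def] p2_def [abs_def] p3_def [abs_def]
    q0_def [abs_def] q1_def [abs_def] q2_def [abs_def] q3_def [abs_def]
    \<theta>1u_def \<theta>2u_def \<theta>1s_def \<theta>2s_def \<mu>_def
  by (intro continuous_intros partials[THEN has_partialsD(2)] partials[THEN has_partialsD(3)]
      partials[THEN has_partialsD(4)]; simp)+

lemma cont_len: "continuous_on A (len l)"
  unfolding len_def [abs_def] by (intro continuous_intros cont_coeffs)

lemma len_eq_off_support:
  assumes "open V" "w \<in> V" "\<And>w. w \<in> V \<Longrightarrow> field w = 0"
  shows "len l w = len 0 w"
proof -
  have z: "a w = 0" "b w = 0" "k w = 0" if "w \<in> V" for w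
    using assms(3)[OF that] by (auto simp: field_eq c_def zero_prod_def)
  note pz = partials_zero_of_locally_zero[OF _ assms(1,2)]
  have "a\<^sub>u w = 0" "a\<^sub>s w = 0" "b\<^sub>u w = 0" "b\<^sub>s w = 0" "k\<^sub>u w = 0" "k\<^sub>s w = 0"
    using pz[OF partials(1)] pz[OF partials(2)] pz[OF partials(3)] z by auto
  then show ?thesis
    using z[OF assms(2)] by (simp add: len_def p1_def p2_def p3_def q1_def q2_def q3_def
        \<theta>1u_def \<theta>2u_def \<theta>1s_def \<theta>2s_def)
qed

abbreviation "B \<equiv> cbox (-R, -R) (R, R)"

lemma field_zero_off_box: "w \<notin> B \<Longrightarrow> field w = 0"
  using vanish vanish_c by (cases w) (auto simp: field_eq vanishes_off_def zero_prod_def)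

text \<open>The perimeter of the undeformed piece is split off as a constant: the difference of the integrands vanishes both off
\<open>U\<close> and off the square, so its integral over the arbitrary domain \<open>U\<close> equals the one over the square.\<close>

lemma perimeter_of_deformation:
  assumes X: "\<And>w. X (chart \<alpha> \<beta> w) = field w" and K: "piece_for (strip \<alpha> \<beta>) X K"
  obtains e C where "e > 0" "\<And>l. \<bar>l\<bar> < e \<Longrightarrow> H_perimeter (deformation K X l) = C + integral B (len l)"
proof -
  let ?S = "strip \<alpha> \<beta>" and ?ch = "chart \<alpha> \<beta>"
  have range: "?S = range ?ch" using \<alpha> by (simp add: strip_eq_range)
  obtain e where e: "e > 0" "\<And>l U. \<bar>l\<bar> < e \<Longrightarrow> open U \<Longrightarrow> C1_graph_patch U (\<Phi> l) (\<Phi>' l)"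
    by (rule deformed_patch) blast
  from K obtain T where T: "open T" "K = ?S \<inter> T" and cK: "compact (closure K)"
    and supp: "support_in ?S X \<subseteq> K"
    by (auto simp: piece_for_def openin_open)
  define U where "U = ?ch -` T"
  have U: "open U" unfolding U_def by (rule open_vimage[OF T(1) continuous_chart])
  have KU: "K = ?ch ` U" using T(2) by (auto simp: U_def range)
  have "compact (coords \<alpha> \<beta> ` closure K)"
    by (rule compact_continuous_image[OF continuous_coords cK])
  moreover have "U \<subseteq> coords \<alpha> \<beta> ` closure K"
  proof
    fix w assume "w \<in> U"
    then have "?ch w \<in> K" by (simp add: KU)
    then have "?ch w \<in> closure K" by (rule closure_subset[THEN subsetD])
    moreover have "w = coords \<alpha> \<beta> (?ch w)" using \<alpha> by simp
    ultimately show "w \<in> coords \<alpha> \<beta> ` closure K" by (rule rev_image_eqI)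
  qed
  ultimately obtain D where D: "compact D" "U \<subseteq> D" by blast
  have integrable: "set_integrable lborel U (len l)" for l
  proof (rule set_integrable_subset)
    show "set_integrable lborel D (len l)"
      unfolding set_integrable_def by (rule borel_integrable_compact[OF D(1) cont_len])
  qed (use U D in auto)
  define Z where "Z = closure {w. field w \<noteq> 0}"
  have "Z \<subseteq> U"
  proof -
    have "?ch ` {w. field w \<noteq> 0} \<subseteq> closure {g \<in> ?S. X g \<noteq> 0}"
      by (rule subset_trans[OF _ closure_subset]) (auto simp: range X)
    then have "?ch ` Z \<subseteq> closure {g \<in> ?S. X g \<noteq> 0}"
      unfolding Z_def by (intro image_closure_subset continuous_chart closed_closure)
    also have "\<dots> \<subseteq> K" using supp by (simp add: support_in_def)
    finally show ?thesis using T(2) by (auto simp: U_def)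
  qed
  have off: "len l w = len 0 w" if "w \<notin> Z \<or> w \<notin> B" for w l
    using that
  proof
    assume "w \<notin> Z"
    then show ?thesis
      by (intro len_eq_off_support[of "- Z"]) (auto simp: Z_def intro: closure_subset[THEN subsetD])
  next
    assume "w \<notin> B"
    then show ?thesis
      by (intro len_eq_off_support[of "- B"] field_zero_off_box) (auto intro: closed_cbox open_Compl)
  qed
  have eq: "indicator U w *\<^sub>R (len l w - len 0 w) = indicator B w *\<^sub>R (len l w - len 0 w)" for w l
    using off[of w l] \<open>Z \<subseteq> U\<close> by (auto simp: indicator_def)
  have intB: "set_integrable lborel B (len l)" for l
    unfolding set_integrable_def by (rule borel_integrable_compact[OF compact_cbox cont_len])
  have per: "H_perimeter (deformation K X l) = (LINT w:U|lborel. len 0 w) - integral B (len 0) + integral B (len l)"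
    if l: "\<bar>l\<bar> < e" for l
  proof -
    interpret C1_graph_patch U "\<Phi> l" "\<Phi>' l" by (rule e(2)[OF l U])
    have "deformation K X l = \<Phi> l ` U"
      unfolding deformation_def KU image_image by (simp add: X \<Phi>_def)
    then have "H_perimeter (deformation K X l) = (LINT w:U|lborel. len l w)"
      by (simp add: H_perimeter_eq hnorm_normal)
    also have "\<dots> = (LINT w:U|lborel. len 0 w) + (LINT w:U|lborel. len l w - len 0 w)"
      using integrable by (simp add: set_integral_diff)
    also have "(LINT w:U|lborel. len l w - len 0 w) = (LINT w:B|lborel. len l w - len 0 w)"
      unfolding set_lebesgue_integral_def eq ..
    also have "\<dots> = integral B (len l) - integral B (len 0)"
      using intB by (simp add: set_integral_diff set_borel_integral_eq_integral)
    finally show ?thesis by simp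
  qed
  show ?thesis by (rule that[OF e(1) per])
qed

text \<open>A ball that contains the support cuts out such a piece.\<close>

lemma piece_exists:
  assumes X: "\<And>w. X (chart \<alpha> \<beta> w) = field w"
  shows "\<exists>K. piece_for (strip \<alpha> \<beta>) X K"
proof -
  let ?S = "strip \<alpha> \<beta>"
  have range: "?S = range (chart \<alpha> \<beta>)" using \<alpha> by (simp add: strip_eq_range)
  have comp: "compact (chart \<alpha> \<beta> ` B)"
    by (intro compact_continuous_image continuous_chart compact_cbox)
  have "{g \<in> ?S. X g \<noteq> 0} \<subseteq> chart \<alpha> \<beta> ` B"
  proof
    fix g assume "g \<in> {g \<in> ?S. X g \<noteq> 0}"
    then obtain w where "g = chart \<alpha> \<beta> w" "field w \<noteq> 0" by (auto simp: range X)
    then show "g \<in> chart \<alpha> \<beta> ` B" using field_zero_off_box by blast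
  qed
  then have supp: "support_in ?S X \<subseteq> chart \<alpha> \<beta> ` B"
    unfolding support_in_def by (rule closure_minimal[OF _ compact_imp_closed[OF comp]])
  obtain r where r: "chart \<alpha> \<beta> ` B \<subseteq> ball 0 r"
    using comp compact_imp_bounded bounded_subset_ballD by blast
  have "piece_for ?S X (?S \<inter> ball 0 r)"
    unfolding piece_for_def
  proof (intro conjI)
    show "openin (top_of_set ?S) (?S \<inter> ball 0 r)" by (simp add: openin_open_Int)
    show "compact (closure (?S \<inter> ball 0 r))"
      by (meson bounded_Int bounded_ball bounded_closure closed_closure compact_eq_bounded_closed)
    show "closure (?S \<inter> ball 0 r) \<subseteq> ?S"
      by (rule closure_minimal) (auto simp: closed_strip)
    show "support_in ?S X \<subseteq> ?S \<inter> ball 0 r" using supp r by (auto simp: range)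
  qed
  then show ?thesis by blast
qed

definition "speed w = sqrt ((p0 w)\<^sup>2 + (q0 w)\<^sup>2)"
definition "var1 w = (p0 w * p1 w + q0 w * q1 w) / speed w"
definition "var2 w = ((p1 w)\<^sup>2 + (q1 w)\<^sup>2 + 2 * p0 w * p2 w + 2 * q0 w * q2 w) / speed w
    - (p0 w * p1 w + q0 w * q1 w)\<^sup>2 / (speed w)^3"

lemma \<mu>_pos: "\<mu> w > 0"
  using \<alpha> by (simp add: \<mu>_def add_pos_nonneg)

theorem variations:
  assumes X: "\<And>w. X (chart \<alpha> \<beta> w) = field w"
  shows "has_first_variation (strip \<alpha> \<beta>) X (integral B var1)"
    and "has_second_variation (strip \<alpha> \<beta>) X (integral B var2)"
proof -
  have pos: "p0 w > 0" for w
    by (simp add: p0_def \<mu>_pos)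
  obtain F' d where d: "d > 0"
    "\<And>l. \<bar>l\<bar> < d \<Longrightarrow> ((\<lambda>l. integral B (len l)) has_real_derivative F' l) (at l)"
    "F' 0 = integral B var1" "(F' has_real_derivative integral B var2) (at 0)"
    unfolding len_def [abs_def] var1_def [abs_def] var2_def [abs_def] speed_def [abs_def]
    by (rule length_integral_derivatives[OF cont_coeffs pos, of "(-R, -R)" "(R, R)"]) blast
  have D: "\<exists>e>0. \<forall>l. \<bar>l\<bar> < e \<longrightarrow> ((\<lambda>l. H_perimeter (deformation K X l)) has_real_derivative F' l) (at l)"
    if K: "piece_for (strip \<alpha> \<beta>) X K" for K
  proof -
    obtain e C where e: "e > 0" "\<And>l. \<bar>l\<bar> < e \<Longrightarrow> H_perimeter (deformation K X l) = C + integral B (len l)"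
      using perimeter_of_deformation[OF X K] by blast
    have "((\<lambda>l. H_perimeter (deformation K X l)) has_real_derivative F' l) (at l)" if l: "\<bar>l\<bar> < min d e" for l
    proof (rule has_field_derivative_transform_within_open[where S = "{-e<..<e}"])
      show "((\<lambda>l. C + integral B (len l)) has_real_derivative F' l) (at l)"
        using DERIV_add[OF DERIV_const d(2)[of l], of C] l by simp
      show "C + integral B (len x) = H_perimeter (deformation K X x)" if "x \<in> {-e<..<e}" for x
        using e(2)[of x] that by auto
    qed (use l in auto)
    then show ?thesis using e(1) d(1) by (intro exI[of _ "min d e"]) auto
  qed
  show "has_first_variation (strip \<alpha> \<beta>) X (integral B var1)"
    unfolding has_first_variation_def
  proof (intro conjI allI impI piece_exists[of X] X)
    fix K assume "piece_for (strip \<alpha> \<beta>) X K"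
    from D[OF this] show "((\<lambda>l. H_perimeter (deformation K X l)) has_real_derivative integral B var1) (at 0)"
      unfolding d(3)[symmetric] by auto
  qed
  show "has_second_variation (strip \<alpha> \<beta>) X (integral B var2)"
    unfolding has_second_variation_def
  proof (intro conjI allI impI piece_exists[of X] X)
    fix K assume "piece_for (strip \<alpha> \<beta>) X K"
    from D[OF this] have "\<forall>\<^sub>F l in nhds 0. ((\<lambda>l. H_perimeter (deformation K X l)) has_real_derivative F' l) (at l)"
      by (simp add: eventually_nhds_metric dist_real_def)
    then show "\<exists>P'. (\<forall>\<^sub>F l in nhds 0. ((\<lambda>l. H_perimeter (deformation K X l)) has_real_derivative P' l) (at l)) \<and>
        (P' has_real_derivative integral B var2) (at 0)"
      using d(4) by (intro exI[of _ F'] conjI)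
  qed
qed

end


section \<open>First and second variation of the surface\<close>

text \<open>The reciprocal length \<open>(1 + s\<^sup>2) powr (-1/2)\<close> of the vector \<open>X\<^sub>1 - s X\<^sub>2\<close>, which is normal to the ruling of slope \<open>s\<close>.\<close>

definition ir :: "real \<Rightarrow> real" where "ir s = inverse (sqrt (1 + s\<^sup>2))"

lemma ir_pos: "ir s > 0"
  by (simp add: ir_def add_pos_nonneg)

lemma ir_sq: "(1 + s\<^sup>2) * (ir s)\<^sup>2 = 1"
proof -
  have "1 + s\<^sup>2 > 0" by (simp add: add_pos_nonneg)
  then show ?thesis by (simp add: ir_def power_inverse)
qed

lemma sqrt_eq_ir: "sqrt (1 + s\<^sup>2) = (1 + s\<^sup>2) * ir s"
proof -
  have "1 + s\<^sup>2 > 0" by (simp add: add_pos_nonneg)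
  then show ?thesis by (simp add: ir_def real_div_sqrt flip: divide_inverse)
qed

lemma inverse_ir: "inverse ((1 + s\<^sup>2) * ir s) = ir s"
  using ir_sq[of s] by (intro inverse_unique) (simp add: power2_eq_square mult.assoc)

lemma ir_deriv: "(ir has_real_derivative - s * ir s ^ 3) (at s)"
proof -
  have "1 + s\<^sup>2 > 0" by (simp add: add_pos_nonneg)
  then show ?thesis unfolding ir_def
    by (auto intro!: derivative_eq_intros simp: power2_eq_square power3_eq_cube)
qed

lemma continuous_ir: "continuous_on A ir"
  by (meson DERIV_isCont continuous_at_imp_continuous_on ir_deriv)

lemma has_partials_ir: "has_partials (\<lambda>w. ir (snd w)) (\<lambda>w. 0) (\<lambda>w. - snd w * ir (snd w) ^ 3)"
  by (rule has_partials_snd[OF ir_deriv]) (intro continuous_intros continuous_ir)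

context strip_variation begin

lemma speed_eq: "speed w = \<mu> w * ((1 + (snd w)\<^sup>2) * ir (snd w))"
proof -
  have "(p0 w)\<^sup>2 + (q0 w)\<^sup>2 = (\<mu> w)\<^sup>2 * (1 + (snd w)\<^sup>2)"
    by (simp add: p0_def q0_def algebra_simps power2_eq_square)
  then show ?thesis
    using \<mu>_pos[of w] by (simp add: speed_def real_sqrt_mult sqrt_eq_ir)
qed

lemma inverse_speed: "inverse (speed w) = ir (snd w) / \<mu> w"
  unfolding speed_eq inverse_mult_distrib[of "\<mu> w"] inverse_ir by (simp add: field_simps)

lemma partials_\<mu>: "has_partials \<mu> fst (\<lambda>w. 0)"
proof -
  have "((\<lambda>u. 1 / \<alpha> + u\<^sup>2 / 2) has_real_derivative u) (at u)" for u
    by (auto intro!: derivative_eq_intros)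
  from has_partials_fst[OF this continuous_on_id] show ?thesis
    by (simp add: \<mu>_def [abs_def])
qed

text \<open>The integrand is the divergence of \<open>((\<mu> b + s \<mu> a - s u k) / sqrt (1 + s\<^sup>2), sqrt (1 + s\<^sup>2) k)\<close>. The functions \<open>A\<close> and \<open>E\<close> are
  its components, with \<open>sqrt (1 + s\<^sup>2) = (1 + s\<^sup>2) ir s\<close>.\<close>

lemma first_variation_zero: "integral B var1 = 0"
proof -
  define A where "A w = (\<mu> w * b w + snd w * (\<mu> w * a w) + (- 1) * (snd w * (fst w * k w))) * ir (snd w)" for w
  define A\<^sub>u where "A\<^sub>u w = ((fst w * b w + \<mu> w * b\<^sub>u w) + snd w * (fst w * a w + \<mu> w * a\<^sub>u w)
    - snd w * (k w + fst w * k\<^sub>u w)) * ir (snd w)" for w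
  define E where "E w = (1 + snd w * snd w) * ir (snd w) * k w" for w
  define E\<^sub>s where "E\<^sub>s w = snd w * ir (snd w) * k w + (1 + (snd w)\<^sup>2) * ir (snd w) * k\<^sub>s w" for w
  have "\<exists>fs. has_partials A A\<^sub>u fs"
    unfolding A_def [abs_def]
    by (rule exI, rule has_partials_cong[OF _ _ refl], (rule has_partials_add has_partials_mult has_partials_coord
        has_partials_const partials partials_\<mu> has_partials_ir)+, simp add: A\<^sub>u_def fun_eq_iff algebra_simps)
  moreover have "vanishes_off R A" using vanish by (simp add: A_def vanishes_off_def)
  ultimately have "integral B A\<^sub>u = 0" "continuous_on B A\<^sub>u"
    using integral_partials_zero R has_partialsD(3) by blast+
  moreover have "\<exists>fu. has_partials E fu E\<^sub>s"
  proof -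
    have "snd w * ir (snd w) = 2 * snd w * ir (snd w) - (1 + (snd w)\<^sup>2) * snd w * ir (snd w) ^ 3" for w :: "real \<times> real"
      using ir_sq[of "snd w"] by algebra
    then have *: "E\<^sub>s w = (2 * snd w * ir (snd w) - (1 + (snd w)\<^sup>2) * snd w * ir (snd w) ^ 3) * k w
        + (1 + (snd w)\<^sup>2) * ir (snd w) * k\<^sub>s w" for w
      by (simp add: E\<^sub>s_def)
    show ?thesis
      unfolding E_def [abs_def]
      by (rule exI, rule has_partials_cong[OF _ refl], (rule has_partials_add has_partials_mult has_partials_coord
          has_partials_const partials has_partials_ir)+, simp add: * fun_eq_iff algebra_simps power2_eq_square)
  qed
  moreover have "vanishes_off R E" using vanish by (simp add: E_def vanishes_off_def)
  ultimately have "integral B E\<^sub>s = 0" "continuous_on B E\<^sub>s"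
    using integral_partials_zero R has_partialsD(4) by blast+
  have "var1 w = A\<^sub>u w + E\<^sub>s w" for w
  proof -
    let ?i = "ir (snd w)"
    have "var1 w = (p1 w + snd w * q1 w) / ((1 + (snd w)\<^sup>2) * ?i)"
    proof -
      have "p0 w * p1 w + q0 w * q1 w = \<mu> w * (p1 w + snd w * q1 w)"
        by (simp add: p0_def q0_def algebra_simps)
      then show ?thesis using \<mu>_pos[of w] by (simp only: var1_def speed_eq) simp
    qed
    also have "\<dots> = (p1 w + snd w * q1 w) * ?i"
      unfolding divide_inverse inverse_ir ..
    also have "\<dots> = A\<^sub>u w + E\<^sub>s w"
      by (simp add: A\<^sub>u_def E\<^sub>s_def p1_def q1_def \<theta>1u_def \<theta>1s_def algebra_simps power2_eq_square)
    finally show ?thesis .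
  qed
  then have "var1 = (\<lambda>w. A\<^sub>u w + E\<^sub>s w)" by blast
  then show ?thesis
    using \<open>integral B A\<^sub>u = 0\<close> \<open>integral B E\<^sub>s = 0\<close> \<open>continuous_on B A\<^sub>u\<close> \<open>continuous_on B E\<^sub>s\<close>
    by (simp add: integral_add integrable_continuous)
qed

end

text \<open>The raw integrand contains the term \<open>s (1 + s\<^sup>2) powr (-1/2) (a\<^sup>2)\<^sub>s\<close>. Integrating it by parts turns it into
\<open>- (1 + s\<^sup>2) powr (-3/2) a\<^sup>2\<close>, the negative term of the result.\<close>

lemma second_variation_X1:
  fixes a :: "real \<times> real \<Rightarrow> real"
  assumes "\<alpha> > 0" "R > 0" and a: "has_partials a a\<^sub>u a\<^sub>s" and van: "vanishes_off R a"
    and X: "\<And>w. X (chart \<alpha> \<beta> w) = a w *\<^sub>R X1 (chart \<alpha> \<beta> w)"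
  defines "m \<equiv> \<lambda>w::real \<times> real. 1 / \<alpha> + (fst w)\<^sup>2 / 2"
  shows "has_second_variation (strip \<alpha> \<beta>) X (integral (cbox (-R, -R) (R, R))
    (\<lambda>w. ir (snd w) ^ 3 * ((m w * a\<^sub>u w + fst w * a w)\<^sup>2 / m w - (a w)\<^sup>2)))"
proof -
  interpret strip_variation \<alpha> \<beta> R a a\<^sub>u a\<^sub>s "\<lambda>w. 0" "\<lambda>w. 0" "\<lambda>w. 0" "\<lambda>w. 0" "\<lambda>w. 0" "\<lambda>w. 0"
    by unfold_locales (use assms in \<open>auto simp: has_partials_const vanishes_off_def\<close>)
  have \<mu>_eq: "\<mu> = m" by (simp add: m_def \<mu>_def fun_eq_iff)
  let ?g = "\<lambda>w. ir (snd w) ^ 3 * ((m w * a\<^sub>u w + fst w * a w)\<^sup>2 / m w - (a w)\<^sup>2)"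
  \<comment> \<open>The \<open>s\<close>-derivative of \<open>E = s a\<^sup>2 / sqrt (1 + s\<^sup>2)\<close>, which integrates to zero.\<close>
  define E\<^sub>s where "E\<^sub>s w = ir (snd w) ^ 3 * (a w)\<^sup>2 + snd w * ir (snd w) * (2 * a w * a\<^sub>s w)" for w
  define E where "E w = snd w * ir (snd w) * (a w * a w)" for w
  have "\<exists>fu. has_partials E fu E\<^sub>s"
  proof -
    have "ir (snd w) ^ 3 = ir (snd w) - (snd w)\<^sup>2 * ir (snd w) ^ 3" for w :: "real \<times> real"
      using ir_sq[of "snd w"] by algebra
    then have *: "E\<^sub>s w = (ir (snd w) - (snd w)\<^sup>2 * ir (snd w) ^ 3) * (a w)\<^sup>2 + snd w * ir (snd w) * (2 * a w * a\<^sub>s w)" for w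
      unfolding E\<^sub>s_def by metis
    show ?thesis
      unfolding E_def [abs_def]
      by (rule exI, rule has_partials_cong[OF _ refl], (rule has_partials_mult has_partials_coord
          a has_partials_ir)+, simp add: * fun_eq_iff algebra_simps power2_eq_square)
  qed
  moreover have "vanishes_off R E" using van by (simp add: E_def vanishes_off_def)
  ultimately have E: "integral B E\<^sub>s = 0" "continuous_on B E\<^sub>s"
    using integral_partials_zero \<open>R > 0\<close> has_partialsD(4) by blast+
  have "var2 w = ?g w + E\<^sub>s w" for w
  proof -
    let ?s = "snd w" let ?i = "ir ?s" let ?D = "m w * a\<^sub>u w + fst w * a w"
    have mpos: "m w > 0" using \<mu>_pos[of w] by (simp add: \<mu>_eq)
    have i: "(1 + ?s\<^sup>2) * ?i\<^sup>2 = 1" "?i > 0" by (rule ir_sq, rule ir_pos)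
    have sp: "inverse (speed w) = ?i / m w"
      by (simp add: inverse_speed \<mu>_eq)
    have coef: "p0 w = m w" "p1 w = 0" "p2 w = 0" "q0 w = ?s * m w" "q1 w = ?D" "q2 w = a\<^sub>s w * a w"
      by (simp_all add: p0_def p1_def p2_def q0_def q1_def q2_def \<theta>1u_def \<theta>2u_def \<theta>1s_def \<theta>2s_def \<mu>_eq algebra_simps)
    have "var2 w = (?D\<^sup>2 + 2 * ?s * m w * (a\<^sub>s w * a w)) * inverse (speed w) - (?s * m w * ?D)\<^sup>2 * inverse (speed w) ^ 3"
      by (simp add: var2_def coef divide_inverse power_inverse)
    also have "\<dots> = ?D\<^sup>2 / m w * (?i - ?s\<^sup>2 * ?i ^ 3) + ?s * ?i * (2 * a w * a\<^sub>s w)"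
      unfolding sp using mpos by (simp add: field_simps power2_eq_square power3_eq_cube)
    also have "?i - ?s\<^sup>2 * ?i ^ 3 = ?i ^ 3"
      using i(1) by algebra
    finally show ?thesis by (simp add: E\<^sub>s_def algebra_simps)
  qed
  then have v: "var2 = (\<lambda>w. ?g w + E\<^sub>s w)" by blast
  have "\<mu> w \<noteq> 0" for w using \<mu>_pos[of w] by simp
  then have "continuous_on B ?g"
    unfolding \<mu>_eq[symmetric]
    by (intro continuous_intros continuous_on_compose2[OF continuous_ir[of UNIV]] has_partialsD(2,3)[OF a]
        has_partialsD(2)[OF partials_\<mu>]) simp_all
  then have "integral B var2 = integral B ?g"
    using E by (simp add: v integral_add integrable_continuous)
  then show ?thesis
    using variations(2)[of X] X by (simp add: field_def)
qed

text \<open>The planar vector \<open>(p0, q0)\<close> is a multiple of \<open>(1, s)\<close> and its first-order change \<open>(p1, q1)\<close> a multiple of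
\<open>(- s, 1)\<close>. So the first-order change of the length vanishes pointwise, and the second variation comes out without
any integration by parts.\<close>

lemma second_variation_normal:
  fixes h :: "real \<times> real \<Rightarrow> real"
  assumes "\<alpha> > 0" "R > 0" and h: "has_partials h h\<^sub>u h\<^sub>s" and van: "vanishes_off R h"
    and X: "\<And>w. X (chart \<alpha> \<beta> w) = h w *\<^sub>R (ir (snd w) *\<^sub>R X1 (chart \<alpha> \<beta> w) - (snd w * ir (snd w)) *\<^sub>R X2 (chart \<alpha> \<beta> w))"
  defines "m \<equiv> \<lambda>w::real \<times> real. 1 / \<alpha> + (fst w)\<^sup>2 / 2"
  shows "has_second_variation (strip \<alpha> \<beta>) X (integral (cbox (-R, -R) (R, R))
    (\<lambda>w. ir (snd w) * ((m w * h\<^sub>u w + fst w * h w)\<^sup>2 / m w - (h w)\<^sup>2)))"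
proof -
  define \<kappa> where "\<kappa> w = h w * ir (snd w)" for w
  define \<kappa>\<^sub>u where "\<kappa>\<^sub>u w = h\<^sub>u w * ir (snd w)" for w
  define \<kappa>\<^sub>s where "\<kappa>\<^sub>s w = h\<^sub>s w * ir (snd w) + h w * (- snd w * ir (snd w) ^ 3)" for w
  have \<kappa>: "has_partials \<kappa> \<kappa>\<^sub>u \<kappa>\<^sub>s"
    unfolding \<kappa>_def [abs_def]
    by (rule has_partials_cong[OF has_partials_mult[OF h has_partials_ir]]) (simp_all add: \<kappa>\<^sub>u_def \<kappa>\<^sub>s_def fun_eq_iff)
  define b where "b w = - (snd w * \<kappa> w)" for w
  define b\<^sub>u where "b\<^sub>u w = - (snd w * \<kappa>\<^sub>u w)" for w
  define b\<^sub>s where "b\<^sub>s w = - (\<kappa> w + snd w * \<kappa>\<^sub>s w)" for w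
  have "b = (\<lambda>w. - 1 * (snd w * \<kappa> w))" by (simp add: b_def fun_eq_iff)
  then have b: "has_partials b b\<^sub>u b\<^sub>s"
    by (simp only:) (rule has_partials_cong[OF has_partials_mult[OF has_partials_const
          has_partials_mult[OF has_partials_coord(2) \<kappa>]]], simp_all add: b\<^sub>u_def b\<^sub>s_def fun_eq_iff)
  interpret strip_variation \<alpha> \<beta> R \<kappa> \<kappa>\<^sub>u \<kappa>\<^sub>s b b\<^sub>u b\<^sub>s "\<lambda>w. 0" "\<lambda>w. 0" "\<lambda>w. 0"
    by unfold_locales (use assms \<kappa> b in \<open>auto simp: has_partials_const vanishes_off_def \<kappa>_def b_def\<close>)
  have \<mu>_eq: "\<mu> = m" by (simp add: m_def \<mu>_def fun_eq_iff)
  have "var2 w = ir (snd w) * ((m w * h\<^sub>u w + fst w * h w)\<^sup>2 / m w - (h w)\<^sup>2)" for w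
  proof -
    let ?s = "snd w" let ?i = "ir ?s" let ?D = "m w * \<kappa>\<^sub>u w + fst w * \<kappa> w"
    have mpos: "m w > 0" using \<mu>_pos[of w] by (simp add: \<mu>_eq)
    have i: "(1 + ?s\<^sup>2) * ?i\<^sup>2 = 1" "?i > 0" by (rule ir_sq, rule ir_pos)
    have sp: "inverse (speed w) = ?i / m w"
      by (simp add: inverse_speed \<mu>_eq)
    have coef: "p0 w = m w" "p1 w = - ?s * ?D" "q0 w = ?s * m w" "q1 w = ?D"
      "p2 w + ?s * q2 w = - (1 + ?s\<^sup>2) * (\<kappa> w)\<^sup>2 / 2"
      unfolding p0_def p1_def p2_def q0_def q1_def q2_def \<theta>1u_def \<theta>2u_def \<theta>1s_def \<theta>2s_def \<mu>_eq
        b_def b\<^sub>u_def b\<^sub>s_def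
      by (simp_all add: field_simps power2_eq_square)
    have "p0 w * p1 w + q0 w * q1 w = 0" by (simp add: coef)
    then have "var2 w = ((p1 w)\<^sup>2 + (q1 w)\<^sup>2 + 2 * (p0 w * p2 w + q0 w * q2 w)) * inverse (speed w)"
      by (simp add: var2_def divide_inverse algebra_simps)
    also have "p0 w * p2 w + q0 w * q2 w = m w * (- (1 + ?s\<^sup>2) * (\<kappa> w)\<^sup>2 / 2)"
      unfolding coef(5)[symmetric] by (simp add: coef(1,3) algebra_simps)
    also have "(p1 w)\<^sup>2 + (q1 w)\<^sup>2 = (1 + ?s\<^sup>2) * (?i * (m w * h\<^sub>u w + fst w * h w))\<^sup>2"
      by (simp add: coef(2,4) \<kappa>_def \<kappa>\<^sub>u_def power2_eq_square algebra_simps)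
    also have "((1 + ?s\<^sup>2) * (?i * (m w * h\<^sub>u w + fst w * h w))\<^sup>2 + 2 * (m w * (- (1 + ?s\<^sup>2) * (\<kappa> w)\<^sup>2 / 2))) * inverse (speed w)
        = ((1 + ?s\<^sup>2) * ?i\<^sup>2) * (?i / m w) * ((m w * h\<^sub>u w + fst w * h w)\<^sup>2 - m w * (h w)\<^sup>2)"
    proof -
      have "(S * (i * E)\<^sup>2 + 2 * (M * (- S * (H * i)\<^sup>2 / 2))) * t = (S * i\<^sup>2) * t * (E\<^sup>2 - M * H\<^sup>2)"
        for S i E M H t :: real
        by (simp add: power2_eq_square algebra_simps)
      then show ?thesis unfolding sp \<kappa>_def by blast
    qed
    finally have "var2 w = ((1 + ?s\<^sup>2) * ?i\<^sup>2) * (?i / m w) * ((m w * h\<^sub>u w + fst w * h w)\<^sup>2 - m w * (h w)\<^sup>2)" .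
    then show ?thesis
      unfolding i(1) using mpos by (simp add: field_simps power2_eq_square)
  qed
  then have "var2 = (\<lambda>w. ir (snd w) * ((m w * h\<^sub>u w + fst w * h w)\<^sup>2 / m w - (h w)\<^sup>2))" by blast
  moreover have "X (chart \<alpha> \<beta> w) = field w" for w
    by (simp add: X field_def \<kappa>_def b_def algebra_simps)
  ultimately show ?thesis using variations(2)[of X] by simp
qed


section \<open>Geometry of the surface\<close>

lemma bounded_linear_coordinates:
  "bounded_linear (\<lambda>g::heis. fst g)" "bounded_linear (\<lambda>g::heis. fst (snd g))" "bounded_linear (\<lambda>g::heis. snd (snd g))"
  by (auto intro: bounded_linear_fst bounded_linear_snd bounded_linear_compose[of fst snd] bounded_linear_compose[of snd snd])

lemma strip_phi_eq: "strip_phi \<alpha> \<beta> = (\<lambda>g. fst g - fst (snd g) * (\<alpha> * snd (snd g) + \<beta>))"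
  by (auto simp: strip_phi_def)

lemma C_on_strip_phi: "C_on n (strip_phi \<alpha> \<beta>) UNIV"
  unfolding strip_phi_eq
  by (intro C_onI Ck_on_diff Ck_on_mult Ck_on_add Ck_on_const open_UNIV Ck_on_bounded_linear bounded_linear_coordinates)

lemma frame_deriv_strip_phi:
  "frame_deriv (strip_phi \<alpha> \<beta>) (x, y, t) = (1 + \<alpha> * y\<^sup>2 / 2, - (\<alpha> * t + \<beta>) - \<alpha> * x * y / 2, - (\<alpha> * y))"
proof -
  have "(strip_phi \<alpha> \<beta> has_derivative (\<lambda>v. fst v - (y * (\<alpha> * snd (snd v)) + fst (snd v) * (\<alpha> * t + \<beta>)))) (at (x, y, t))"
    unfolding strip_phi_eq by (auto intro!: derivative_eq_intros)
  from frechet_derivative_at[OF this, symmetric] show ?thesis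
    by (simp add: frame_deriv_def deriv_along_def power2_eq_square algebra_simps)
qed

lemma defining_function_strip_phi:
  assumes "\<alpha> > 0"
  shows "defining_function n (strip \<alpha> \<beta>) UNIV (strip_phi \<alpha> \<beta>)"
proof -
  have "heis_grad (strip_phi \<alpha> \<beta>) g \<noteq> 0" for g
  proof -
    obtain x y t where g: "g = (x, y, t)" by (metis prod_cases3)
    have "1 + \<alpha> * y\<^sup>2 / 2 > 0" using assms by (simp add: add_pos_nonneg)
    then have "frame_deriv (strip_phi \<alpha> \<beta>) g \<noteq> 0" by (simp add: g frame_deriv_strip_phi zero_prod_def)
    then show ?thesis by (simp only: heis_grad_eq_0_iff not_False_eq_True)
  qed
  moreover have "strip \<alpha> \<beta> = {g. strip_phi \<alpha> \<beta> g = 0}"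
    by (auto simp: strip_def strip_phi_def)
  ultimately show ?thesis
    by (simp add: defining_function_def C_on_strip_phi)
qed

lemma oriented_defining_function_strip_phi:
  "\<alpha> > 0 \<Longrightarrow> oriented_defining_function (strip \<alpha> \<beta>) (heis_grad (strip_phi \<alpha> \<beta>)) UNIV (strip_phi \<alpha> \<beta>)"
  by (simp add: oriented_defining_function_def defining_function_strip_phi)

text \<open>Solving \<open>v = t + x y / 2\<close> for the parameters of a point leaves an equation that is affine in \<open>x\<close>.\<close>

lemma strip_is_X1_graph:
  assumes "\<alpha> > 0"
  shows "strip \<alpha> \<beta> = global_X1_graph (strip_psi \<alpha> \<beta>)"
proof -
  have pos: "2 + \<alpha> * u\<^sup>2 > 0" for u using assms by (simp add: add_pos_nonneg)
  have "(x, y, t) \<in> global_X1_graph (strip_psi \<alpha> \<beta>) \<longleftrightarrow> (x, y, t) \<in> strip \<alpha> \<beta>" for x y t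
  proof -
    have "(x, y, t) \<in> global_X1_graph (strip_psi \<alpha> \<beta>) \<longleftrightarrow> x = strip_psi \<alpha> \<beta> (y, t + x * y / 2)"
      by (auto simp: global_X1_graph_def algebra_simps)
    also have "\<dots> \<longleftrightarrow> x * (2 + \<alpha> * y\<^sup>2) = 2 * y * (\<alpha> * (t + x * y / 2) + \<beta>)"
      using pos[of y] by (simp add: strip_psi_def eq_divide_eq)
    also have "\<dots> \<longleftrightarrow> x = y * (\<alpha> * t + \<beta>)"
      by (auto simp: algebra_simps power2_eq_square)
    finally show ?thesis by (simp add: strip_def)
  qed
  then show ?thesis by auto
qed

lemma derivative_of_unit_vector:
  fixes P Q :: "'a::real_normed_vector \<Rightarrow> real"
  assumes P: "(P has_derivative P') (at g)" and Q: "(Q has_derivative Q') (at g)" and "P g \<noteq> 0"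
  shows "((\<lambda>g. P g / sqrt ((P g)\<^sup>2 + (Q g)\<^sup>2)) has_derivative
    (\<lambda>v. Q g * (Q g * P' v - P g * Q' v) / sqrt ((P g)\<^sup>2 + (Q g)\<^sup>2) ^ 3)) (at g)"
    "((\<lambda>g. Q g / sqrt ((P g)\<^sup>2 + (Q g)\<^sup>2)) has_derivative
    (\<lambda>v. P g * (P g * Q' v - Q g * P' v) / sqrt ((P g)\<^sup>2 + (Q g)\<^sup>2) ^ 3)) (at g)"
proof -
  define r where "r = sqrt ((P g)\<^sup>2 + (Q g)\<^sup>2)"
  have S: "(P g)\<^sup>2 + (Q g)\<^sup>2 > 0" using \<open>P g \<noteq> 0\<close> by (intro add_pos_nonneg) auto
  then have r: "r \<noteq> 0" "r * r = (P g)\<^sup>2 + (Q g)\<^sup>2" unfolding r_def by auto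
  have W: "((\<lambda>g. sqrt ((P g)\<^sup>2 + (Q g)\<^sup>2)) has_derivative (\<lambda>v. (P g * P' v + Q g * Q' v) / r)) (at g)"
    using S \<open>P g \<noteq> 0\<close> unfolding r_def by (auto intro!: derivative_eq_intros P Q simp: divide_simps)
  have alg: "(a * r - n * (c / r)) / (r * r) = (a * (r * r) - n * c) / r ^ 3" for a n c :: real
    using r(1) by (simp add: field_simps power3_eq_cube)
  show "((\<lambda>g. P g / sqrt ((P g)\<^sup>2 + (Q g)\<^sup>2)) has_derivative
    (\<lambda>v. Q g * (Q g * P' v - P g * Q' v) / sqrt ((P g)\<^sup>2 + (Q g)\<^sup>2) ^ 3)) (at g)"
    by (rule has_derivative_eq_rhs[OF has_derivative_divide'[OF P W]], use r(1) r_def in simp, rule ext,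
        simp only: r_def [symmetric] alg, simp only: r(2), simp add: algebra_simps power2_eq_square)
  show "((\<lambda>g. Q g / sqrt ((P g)\<^sup>2 + (Q g)\<^sup>2)) has_derivative
    (\<lambda>v. P g * (P g * Q' v - Q g * P' v) / sqrt ((P g)\<^sup>2 + (Q g)\<^sup>2) ^ 3)) (at g)"
    by (rule has_derivative_eq_rhs[OF has_derivative_divide'[OF Q W]], use r(1) r_def in simp, rule ext,
        simp only: r_def [symmetric] alg, simp only: r(2), simp add: algebra_simps power2_eq_square)
qed

text \<open>\<open>X\<^sub>1\<close> annihilates both \<open>p\<close> and \<open>q\<close>, and \<open>X\<^sub>2\<close> of \<open>q / W\<close> is proportional to \<open>p X\<^sub>2 q - q X\<^sub>2 p\<close>, which vanishes
on the surface.\<close>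

lemma hor_mean_curvature_strip_phi:
  assumes "\<alpha> > 0" "g \<in> strip \<alpha> \<beta>"
  shows "hor_mean_curvature (strip_phi \<alpha> \<beta>) g = 0"
proof -
  let ?\<phi> = "strip_phi \<alpha> \<beta>"
  obtain x y t where g: "g = (x, y, t)" by (metis prod_cases3)
  have x: "x = y * (\<alpha> * t + \<beta>)" using assms(2) by (simp add: g strip_def)
  define P where "P = (\<lambda>h::heis. 1 + \<alpha> * (fst (snd h))\<^sup>2 / 2)"
  define Q where "Q = (\<lambda>h::heis. - (\<alpha> * snd (snd h) + \<beta>) - \<alpha> * fst h * fst (snd h) / 2)"
  have bars: "p_bar ?\<phi> = (\<lambda>h. P h / sqrt ((P h)\<^sup>2 + (Q h)\<^sup>2))" "q_bar ?\<phi> = (\<lambda>h. Q h / sqrt ((P h)\<^sup>2 + (Q h)\<^sup>2))"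
  proof -
    have "deriv_along X1 ?\<phi> h = P h" "deriv_along X2 ?\<phi> h = Q h" for h
      using frame_deriv_strip_phi[of \<alpha> \<beta> "fst h" "fst (snd h)" "snd (snd h)"]
      by (simp_all add: frame_deriv_def P_def Q_def)
    then show "p_bar ?\<phi> = (\<lambda>h. P h / sqrt ((P h)\<^sup>2 + (Q h)\<^sup>2))" "q_bar ?\<phi> = (\<lambda>h. Q h / sqrt ((P h)\<^sup>2 + (Q h)\<^sup>2))"
      by (simp_all add: fun_eq_iff p_bar_def q_bar_def hor_W_def)
  qed
  have P: "(P has_derivative (\<lambda>v. \<alpha> * y * fst (snd v))) (at g)"
    unfolding P_def g by (auto intro!: derivative_eq_intros simp: algebra_simps)
  have Q: "(Q has_derivative (\<lambda>v. - (\<alpha> * snd (snd v)) - \<alpha> * (x * fst (snd v) + fst v * y) / 2)) (at g)"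
    unfolding Q_def g by (auto intro!: derivative_eq_intros simp: algebra_simps)
  have "P g \<noteq> 0"
  proof -
    have "1 + \<alpha> * y\<^sup>2 / 2 > 0" using assms(1) by (simp add: add_pos_nonneg)
    then show ?thesis by (simp add: P_def g)
  qed
  note der = derivative_of_unit_vector[OF P Q this, THEN frechet_derivative_at, symmetric]
  have "P g * (- (\<alpha> * (x / 2)) - \<alpha> * x / 2) - Q g * (\<alpha> * y) = 0"
    by (simp add: P_def Q_def g x algebra_simps power2_eq_square)
  then show ?thesis
    unfolding hor_mean_curvature_def deriv_along_def bars der by (simp add: g)
qed

lemma H_minimal_strip:
  assumes "\<alpha> > 0"
  shows "H_minimal (strip \<alpha> \<beta>) (heis_grad (strip_phi \<alpha> \<beta>))"
  unfolding H_minimal_def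
  using oriented_defining_function_strip_phi[OF assms] hor_mean_curvature_strip_phi[OF assms] by blast

lemma nu_H_chart:
  assumes "\<alpha> > 0"
  shows "nu_H (strip_phi \<alpha> \<beta>) (chart \<alpha> \<beta> w) =
    ir (snd w) *\<^sub>R X1 (chart \<alpha> \<beta> w) - (snd w * ir (snd w)) *\<^sub>R X2 (chart \<alpha> \<beta> w)"
proof -
  let ?\<phi> = "strip_phi \<alpha> \<beta>" and ?g = "chart \<alpha> \<beta> w"
  define m where "m = 1 + \<alpha> * (fst w)\<^sup>2 / 2"
  have m: "m > 0" using assms by (simp add: m_def add_pos_nonneg)
  have d: "deriv_along X1 ?\<phi> ?g = m" "deriv_along X2 ?\<phi> ?g = - (snd w * m)"
  proof -
    have "\<alpha> * ((snd w - \<beta>) / \<alpha>) + \<beta> = snd w" using assms by simp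
    then show "deriv_along X1 ?\<phi> ?g = m" "deriv_along X2 ?\<phi> ?g = - (snd w * m)"
      using frame_deriv_strip_phi[of \<alpha> \<beta> "fst w * snd w" "fst w" "(snd w - \<beta>) / \<alpha>"]
      unfolding frame_deriv_def chart_def m_def by (auto simp: power2_eq_square algebra_simps)
  qed
  have "m\<^sup>2 + (- (snd w * m))\<^sup>2 = m\<^sup>2 * (1 + (snd w)\<^sup>2)"
    by (simp add: power_mult_distrib algebra_simps)
  then have W: "hor_W ?\<phi> ?g = m * sqrt (1 + (snd w)\<^sup>2)"
    using m by (simp add: hor_W_def d real_sqrt_mult)
  have "p_bar ?\<phi> ?g = ir (snd w)" "q_bar ?\<phi> ?g = - (snd w * ir (snd w))"
    using m by (simp_all add: p_bar_def q_bar_def d W ir_def divide_inverse)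
  then show ?thesis by (simp add: nu_H_def)
qed

lemma defining_function_mono:
  "defining_function n S U \<phi> \<Longrightarrow> m \<le> n \<Longrightarrow> defining_function m S U \<phi>"
  by (auto simp: defining_function_def intro: C_on_mono)

text \<open>Every defining function has its gradient parallel to the normal of the chart, whose horizontal part has length at
least \<open>\<mu> > 0\<close>.\<close>

lemma characteristic_locus_strip:
  assumes "\<alpha> > 0"
  shows "characteristic_locus (strip \<alpha> \<beta>) = {}"
proof -
  interpret strip_variation \<alpha> \<beta> 1 "\<lambda>w. 0" "\<lambda>w. 0" "\<lambda>w. 0" "\<lambda>w. 0" "\<lambda>w. 0" "\<lambda>w. 0" "\<lambda>w. 0" "\<lambda>w. 0" "\<lambda>w. 0"
    by unfold_locales (use assms in \<open>auto simp: has_partials_const vanishes_off_def\<close>)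
  have \<Phi>0: "\<Phi> 0 = chart \<alpha> \<beta>" by (simp add: \<Phi>_def fun_eq_iff)
  have range: "strip \<alpha> \<beta> = range (chart \<alpha> \<beta>)" using assms by (simp add: strip_eq_range)
  have "hor_W \<phi> (chart \<alpha> \<beta> w) \<noteq> 0"
    if \<phi>: "defining_function 2 (strip \<alpha> \<beta>) U \<phi>" "chart \<alpha> \<beta> w \<in> U" for U \<phi> w
  proof -
    have "len 0 w > 0"
      using \<mu>_pos[of w] by (simp add: len_def p0_def add_pos_nonneg)
    then have pos: "hnorm (frame_normal (chart \<alpha> \<beta> w) (\<Phi>' 0 w)) > 0"
      using hnorm_normal[of 0 w] by (simp add: \<Phi>0)
    then have nz: "frame_normal (chart \<alpha> \<beta> w) (\<Phi>' 0 w) \<noteq> 0"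
      by (auto simp: hnorm_def)
    have "(1::enat) \<le> 2" by (simp add: one_enat_def numeral_eq_enat)
    then obtain c where "c \<noteq> 0" "frame_deriv \<phi> (chart \<alpha> \<beta> w) = c *\<^sub>R frame_normal (chart \<alpha> \<beta> w) (\<Phi>' 0 w)"
      using C1_defining_function_normal[OF defining_function_mono[OF \<phi>(1)] open_UNIV UNIV_I \<phi>(2) _ continuous_chart
          deriv_\<Phi>[of 0 w, unfolded \<Phi>0] nz] range by blast
    then show ?thesis using pos by (simp add: hor_W_eq hnorm_scaleR)
  qed
  then show ?thesis by (auto simp: characteristic_locus_def range)
qed


section \<open>Test functions\<close>

lemma vanishes_off_mono: "vanishes_off R f \<Longrightarrow> R \<le> R' \<Longrightarrow> vanishes_off R' f"
  by (auto simp: vanishes_off_def)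

text \<open>Near each point the function is the restriction of a \<open>C\<^sup>2\<close> function of three variables, so the chain rule
expresses its partial derivatives through those of the extension.\<close>

lemma C0_surface_partials:
  assumes "\<alpha> > 0" and f: "C0_surface 2 (strip \<alpha> \<beta>) f"
  obtains f\<^sub>u f\<^sub>s R where "has_partials (\<lambda>w. f (chart \<alpha> \<beta> w)) f\<^sub>u f\<^sub>s" "vanishes_off R (\<lambda>w. f (chart \<alpha> \<beta> w))"
proof -
  let ?S = "strip \<alpha> \<beta>" and ?ch = "chart \<alpha> \<beta>"
  have range: "?S = range ?ch" using assms(1) by (simp add: strip_eq_range)
  have dch: "(?ch has_derivative (\<lambda>h. (fst h * snd w + fst w * snd h, fst h, snd h / \<alpha>))) (at w)" for w
    unfolding chart_def [abs_def] using assms(1) by (auto intro!: derivative_eq_intros simp: algebra_simps)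
  define f\<^sub>u where "f\<^sub>u w = frechet_derivative (\<lambda>w. f (?ch w)) (at w) (1, 0)" for w
  define f\<^sub>s where "f\<^sub>s w = frechet_derivative (\<lambda>w. f (?ch w)) (at w) (0, 1)" for w
  have loc: "((\<lambda>w. f (?ch w)) has_derivative (\<lambda>h. fst h * f\<^sub>u w + snd h * f\<^sub>s w)) (at w) \<and> isCont f\<^sub>u w \<and> isCont f\<^sub>s w" for w
  proof -
    have "?ch w \<in> ?S" by (simp add: range)
    then obtain U F where U: "open U" "?ch w \<in> U" "C_on 2 F U" "\<And>h. h \<in> ?S \<Longrightarrow> h \<in> U \<Longrightarrow> F h = f h"
      using f unfolding C0_surface_def by blast
    have "C_on 1 F U" by (rule C_on_mono[OF U(3)]) (simp add: one_enat_def numeral_eq_enat)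
    note F = C_on_1D[OF this]
    define V where "V = ?ch -` U"
    have V: "open V" "w \<in> V" using U continuous_chart by (auto simp: V_def intro: open_vimage)
    define F' where "F' v = frechet_derivative F (at (?ch v))" for v
    have der: "((\<lambda>w. f (?ch w)) has_derivative (\<lambda>h. F' v (fst h * snd v + fst v * snd h, fst h, snd h / \<alpha>))) (at v)"
      if "v \<in> V" for v
    proof (rule has_derivative_transform_within_open[OF _ V(1) that])
      show "((\<lambda>w. F (?ch w)) has_derivative (\<lambda>h. F' v (fst h * snd v + fst v * snd h, fst h, snd h / \<alpha>))) (at v)"
        unfolding F'_def by (rule has_derivative_compose[OF dch F(1)]) (use that in \<open>simp add: V_def\<close>)
    qed (auto simp: V_def U(4) range)
    have lin: "linear (F' v)" if "v \<in> V" for v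
      using F(1)[of "?ch v"] that by (auto simp: V_def F'_def intro: has_derivative_linear)
    have split: "F' v (x, y, z) = x * F' v (1, 0, 0) + y * F' v (0, 1, 0) + z * F' v (0, 0, 1)" if "v \<in> V" for v x y z
    proof -
      have "(x, y, z) = x *\<^sub>R (1, 0, 0) + y *\<^sub>R (0, 1, 0) + z *\<^sub>R (0, 0, 1)" by simp
      then show ?thesis
        using linear_add[OF lin[OF that]] linear_scale[OF lin[OF that]] by (metis real_scaleR_def)
    qed
    have fu: "f\<^sub>u v = snd v * F' v (1, 0, 0) + F' v (0, 1, 0)" and fs: "f\<^sub>s v = fst v * F' v (1, 0, 0) + (1 / \<alpha>) * F' v (0, 0, 1)"
      if "v \<in> V" for v
      unfolding f\<^sub>u_def f\<^sub>s_def frechet_derivative_at[OF der[OF that], symmetric]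
      using split[OF that, of "snd v" 1 0] split[OF that, of "fst v" 0 "1 / \<alpha>"] by simp_all
    have cF: "continuous_on V (\<lambda>v. F' v x)" for x
      unfolding F'_def by (rule continuous_on_compose2[OF F(2) continuous_chart]) (auto simp: V_def)
    have "continuous_on V f\<^sub>u"
      by (rule continuous_on_eq[of _ "\<lambda>v. snd v * F' v (1, 0, 0) + F' v (0, 1, 0)"]) (auto intro!: continuous_intros cF simp: fu)
    moreover have "continuous_on V f\<^sub>s"
      by (rule continuous_on_eq[of _ "\<lambda>v. fst v * F' v (1, 0, 0) + (1 / \<alpha>) * F' v (0, 0, 1)"]) (use assms(1) in \<open>auto intro!: continuous_intros cF simp: fs\<close>)
    moreover have "(\<lambda>h. F' w (fst h * snd w + fst w * snd h, fst h, snd h / \<alpha>)) = (\<lambda>h. fst h * f\<^sub>u w + snd h * f\<^sub>s w)"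
      by (rule ext, subst split) (simp_all add: V(2) fu fs algebra_simps)
    ultimately show ?thesis
      using der[OF V(2)] V by (simp add: continuous_on_eq_continuous_at)
  qed
  then have hp: "has_partials (\<lambda>w. f (?ch w)) f\<^sub>u f\<^sub>s"
    by (auto simp: has_partials_def continuous_at_imp_continuous_on)
  have "compact (coords \<alpha> \<beta> ` support_in ?S f)"
    using f by (intro compact_continuous_image continuous_coords) (simp add: C0_surface_def)
  then obtain R where R: "\<And>v. v \<in> coords \<alpha> \<beta> ` support_in ?S f \<Longrightarrow> norm v < R"
    using compact_imp_bounded bounded_subset_ballD[of _ "0::real \<times> real"] by (metis dist_0_norm mem_ball subsetD)
  have "vanishes_off R (\<lambda>w. f (?ch w))"
    unfolding vanishes_off_def
  proof (intro allI impI, rule ccontr)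
    fix u s assume us: "R \<le> \<bar>u\<bar> \<or> R \<le> \<bar>s\<bar>" and "f (?ch (u, s)) \<noteq> 0"
    then have "?ch (u, s) \<in> support_in ?S f"
      unfolding support_in_def by (intro closure_subset[THEN subsetD]) (simp add: range)
    moreover have "(u, s) = coords \<alpha> \<beta> (?ch (u, s))" using assms(1) by simp
    ultimately have "norm (u, s) < R" by (intro R) (rule rev_image_eqI)
    then show False
      using us norm_fst_le[of u s] norm_snd_le[of s u] by auto
  qed
  with hp show ?thesis by (rule that)
qed

lemma first_variation_strip:
  assumes "\<alpha> > 0" "test_field (strip \<alpha> \<beta>) X"
  shows "has_first_variation (strip \<alpha> \<beta>) X 0"
proof -
  let ?S = "strip \<alpha> \<beta>" and ?ch = "chart \<alpha> \<beta>"
  have range: "?S = range ?ch" using assms(1) by (simp add: strip_eq_range)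
  obtain a b k where C: "C0_surface 2 ?S a" "C0_surface 2 ?S b" "C0_surface 2 ?S k"
    and X: "\<And>g. g \<in> ?S \<Longrightarrow> X g = a g *\<^sub>R X1 g + b g *\<^sub>R X2 g + k g *\<^sub>R XT g"
    using assms(2) unfolding test_field_def by blast
  obtain a\<^sub>u a\<^sub>s Ra where a: "has_partials (\<lambda>w. a (?ch w)) a\<^sub>u a\<^sub>s" "vanishes_off Ra (\<lambda>w. a (?ch w))"
    using C0_surface_partials[OF assms(1) C(1)] .
  obtain b\<^sub>u b\<^sub>s Rb where b: "has_partials (\<lambda>w. b (?ch w)) b\<^sub>u b\<^sub>s" "vanishes_off Rb (\<lambda>w. b (?ch w))"
    using C0_surface_partials[OF assms(1) C(2)] .
  obtain k\<^sub>u k\<^sub>s Rk where k: "has_partials (\<lambda>w. k (?ch w)) k\<^sub>u k\<^sub>s" "vanishes_off Rk (\<lambda>w. k (?ch w))"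
    using C0_surface_partials[OF assms(1) C(3)] .
  define R where "R = \<bar>Ra\<bar> + \<bar>Rb\<bar> + \<bar>Rk\<bar> + 1"
  have R: "R > 0" "Ra \<le> R" "Rb \<le> R" "Rk \<le> R" by (auto simp: R_def)
  interpret strip_variation \<alpha> \<beta> R "\<lambda>w. a (?ch w)" a\<^sub>u a\<^sub>s "\<lambda>w. b (?ch w)" b\<^sub>u b\<^sub>s "\<lambda>w. k (?ch w)" k\<^sub>u k\<^sub>s
    by unfold_locales (use assms(1) R a b k in \<open>auto intro: vanishes_off_mono\<close>)
  have "X (?ch w) = field w" for w
    by (simp add: X range field_def)
  from variations(1)[of X, OF this] show ?thesis by (simp add: first_variation_zero)
qed

text \<open>The second factor is \<open>1 / (\<alpha> \<mu>)\<close>: it makes the product with \<open>\<mu>\<close>, whose derivative enters the second variation, a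
multiple of a dilated bump.\<close>

definition test_profile :: "real \<Rightarrow> real \<Rightarrow> real \<Rightarrow> real" where
  "test_profile \<alpha> \<rho> u = bump (u / \<rho>) * inverse (1 + \<alpha> * u\<^sup>2 / 2)"

definition test_function :: "real \<Rightarrow> real \<Rightarrow> real \<Rightarrow> heis \<Rightarrow> real" where
  "test_function \<alpha> \<beta> \<rho> g = test_profile \<alpha> \<rho> (fst (snd g)) * bump (\<alpha> * snd (snd g) + \<beta>)"

lemma test_function_chart:
  "\<alpha> \<noteq> 0 \<Longrightarrow> test_function \<alpha> \<beta> \<rho> (chart \<alpha> \<beta> w) = test_profile \<alpha> \<rho> (fst w) * bump (snd w)"
  by (simp add: test_function_def chart_def)

lemma vanishes_off_test_function:
  "\<rho> \<ge> 1 \<Longrightarrow> vanishes_off \<rho> (\<lambda>w. test_profile \<alpha> \<rho> (fst w) * bump (snd w))"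
  by (auto simp: vanishes_off_def test_profile_def abs_divide intro!: bump_eq_0)

lemma C0_surface_test_function:
  assumes "\<alpha> > 0" "\<rho> \<ge> 1"
  shows "C0_surface n (strip \<alpha> \<beta>) (test_function \<alpha> \<beta> \<rho>)"
proof -
  let ?S = "strip \<alpha> \<beta>" and ?f = "test_function \<alpha> \<beta> \<rho>" and ?K = "chart \<alpha> \<beta> ` cbox (-\<rho>, -\<rho>) (\<rho>, \<rho>)"
  have range: "?S = range (chart \<alpha> \<beta>)" using assms(1) by (simp add: strip_eq_range)
  have nz: "1 + \<alpha> * y\<^sup>2 / 2 \<noteq> 0" for y
  proof -
    have "1 + \<alpha> * y\<^sup>2 / 2 > 0" using assms(1) by (simp add: add_pos_nonneg)
    then show ?thesis by simp
  qed
  have eq: "?f = (\<lambda>g. bump (fst (snd g) * inverse \<rho>) * inverse (1 + \<alpha> * (fst (snd g))\<^sup>2 * inverse 2) * bump (\<alpha> * snd (snd g) + \<beta>))"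
    unfolding test_function_def [abs_def] test_profile_def divide_inverse ..
  have y: "Ck_on j (\<lambda>g::heis. fst (snd g)) UNIV" and t: "Ck_on j (\<lambda>g::heis. snd (snd g)) UNIV" for j
    by (rule Ck_on_bounded_linear[OF open_UNIV], rule bounded_linear_coordinates)+
  have "C_on n ?f UNIV"
    unfolding eq
    by (rule C_onI, (rule open_UNIV y t nz[unfolded divide_inverse] Ck_on_const
        Ck_on_bump Ck_on_inverse Ck_on_mult Ck_on_add Ck_on_power)+)
  moreover have comp: "compact ?K"
    by (intro compact_continuous_image continuous_chart compact_cbox)
  have sub: "{g \<in> ?S. ?f g \<noteq> 0} \<subseteq> ?K"
  proof
    fix g assume "g \<in> {g \<in> ?S. ?f g \<noteq> 0}"
    then obtain u s where g: "g = chart \<alpha> \<beta> (u, s)" and "?f (chart \<alpha> \<beta> (u, s)) \<noteq> 0" by (auto simp: range)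
    then have "\<not> (\<bar>u\<bar> \<ge> \<rho> \<or> \<bar>s\<bar> \<ge> \<rho>)"
      using vanishes_off_test_function[OF assms(2), of \<alpha>] assms(1) by (auto simp: test_function_chart vanishes_off_def)
    then show "g \<in> ?K" unfolding g by (intro imageI) auto
  qed
  have supp: "support_in ?S ?f \<subseteq> ?K"
    unfolding support_in_def by (rule closure_minimal[OF sub compact_imp_closed[OF comp]])
  have "compact (support_in ?S ?f)"
  proof -
    have "support_in ?S ?f = ?K \<inter> support_in ?S ?f" using supp by blast
    moreover have "compact (?K \<inter> support_in ?S ?f)"
      unfolding support_in_def by (rule compact_Int_closed[OF comp closed_closure])
    ultimately show ?thesis by simp
  qed
  moreover have "?K \<subseteq> ?S" by (auto simp: range)
  ultimately show ?thesis
    using supp unfolding C0_surface_def by blast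
qed

lemma test_function_nonzero:
  assumes "\<alpha> > 0"
  shows "\<exists>g\<in>strip \<alpha> \<beta>. test_function \<alpha> \<beta> \<rho> g \<noteq> 0"
proof
  show "chart \<alpha> \<beta> (0, 0) \<in> strip \<alpha> \<beta>" using assms by (simp add: strip_eq_range)
  show "test_function \<alpha> \<beta> \<rho> (chart \<alpha> \<beta> (0, 0)) \<noteq> 0"
    using assms bump_pos[of 0] by (simp add: test_function_chart test_profile_def)
qed

text \<open>The one-dimensional integrand to which the second variation reduces for \<^const>\<open>test_function\<close>.\<close>

definition gap :: "real \<Rightarrow> real \<Rightarrow> real \<Rightarrow> real" where
  "gap \<alpha> \<rho> u = (bump' (u / \<rho>) / \<rho>)\<^sup>2 / (1 / \<alpha> + u\<^sup>2 / 2) - (bump (u / \<rho>) / (1 / \<alpha> + u\<^sup>2 / 2))\<^sup>2"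

lemma denominator_pos: "\<alpha> > 0 \<Longrightarrow> 1 / \<alpha> + u\<^sup>2 / 2 > (0::real)"
  by (simp add: add_pos_nonneg)

lemma continuous_dilated_bump: "continuous_on A (\<lambda>u. bump (u / \<rho>))" "continuous_on A (\<lambda>u. bump' (u / \<rho>))"
  by (rule continuous_on_compose2[OF continuous_bump[of UNIV]] continuous_on_compose2[OF continuous_bump'[of UNIV]];
      simp add: divide_inverse continuous_on_mult)+

lemma continuous_gap_terms:
  assumes "\<alpha> > 0"
  shows "continuous_on A (\<lambda>u. (bump' (u / \<rho>) / \<rho>)\<^sup>2 / (1 / \<alpha> + u\<^sup>2 / 2))"
    "continuous_on A (\<lambda>u. (bump (u / \<rho>) / (1 / \<alpha> + u\<^sup>2 / 2))\<^sup>2)"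
proof -
  have nz: "1 / \<alpha> + u\<^sup>2 / 2 \<noteq> 0" for u using denominator_pos[OF assms, of u] by simp
  have "continuous_on A (\<lambda>u. inverse \<rho> * bump' (u / \<rho>))"
    by (intro continuous_on_mult continuous_on_const continuous_dilated_bump)
  then have "continuous_on A (\<lambda>u. bump' (u / \<rho>) / \<rho>)"
    by (simp add: divide_inverse mult.commute)
  moreover have "continuous_on A (\<lambda>u. 1 / \<alpha> + u\<^sup>2 / 2)"
    by (intro continuous_on_add continuous_on_const continuous_on_divide continuous_on_power continuous_on_id) simp
  ultimately show "continuous_on A (\<lambda>u. (bump' (u / \<rho>) / \<rho>)\<^sup>2 / (1 / \<alpha> + u\<^sup>2 / 2))"
    "continuous_on A (\<lambda>u. (bump (u / \<rho>) / (1 / \<alpha> + u\<^sup>2 / 2))\<^sup>2)"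
    using nz by (auto intro!: continuous_on_divide continuous_on_power continuous_dilated_bump)
qed

lemma continuous_gap: "\<alpha> > 0 \<Longrightarrow> continuous_on A (gap \<alpha> \<rho>)"
  unfolding gap_def [abs_def] by (intro continuous_on_diff continuous_gap_terms)

text \<open>The positive term is at most \<open>(C / \<rho>)\<^sup>2 \<alpha>\<close> on an interval of length \<open>2 \<rho>\<close>, where \<open>C\<close> bounds the derivative of the
bump. The negative term contributes at least a constant \<open>c\<close> from \<open>[-1/2, 1/2]\<close> alone, whatever \<open>\<rho> \<ge> 1\<close> is.\<close>

lemma gap_integral_negative:
  assumes "\<alpha> > 0"
  obtains \<rho> where "\<rho> \<ge> 1" "integral {-\<rho>..\<rho>} (gap \<alpha> \<rho>) < 0"
proof -
  let ?m = "\<lambda>u::real. 1 / \<alpha> + u\<^sup>2 / 2"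
  have "bounded (bump' ` {-1..1})"
    by (intro compact_imp_bounded compact_continuous_image continuous_bump') auto
  then obtain C0 where C0: "\<And>x. x \<in> {-1..1} \<Longrightarrow> \<bar>bump' x\<bar> \<le> C0"
    unfolding bounded_iff by (metis imageI real_norm_def)
  define C where "C = \<bar>C0\<bar>"
  have C: "\<bar>bump' x\<bar> \<le> C" for x
    using C0[of x] bump'_eq_0[of x] by (cases "x \<in> {-1..1}") (auto simp: C_def)
  have "\<exists>x\<in>{-1/2..1/2}. \<forall>y\<in>{-1/2..1/2}. bump x \<le> bump y"
    by (rule continuous_attains_inf) (auto intro: continuous_bump)
  then obtain x0 where x0: "x0 \<in> {-1/2..1/2}" "\<And>y. y \<in> {-1/2..1/2} \<Longrightarrow> bump x0 \<le> bump y" by blast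
  define \<delta> where "\<delta> = bump x0"
  have "\<delta> > 0" unfolding \<delta>_def by (rule bump_pos) (use x0(1) in auto)
  define c where "c = (\<delta> / (1 / \<alpha> + 1 / 8))\<^sup>2"
  have "1 / \<alpha> + 1 / 8 > 0" using assms by (simp add: add_pos_pos)
  then have c: "c > 0" using \<open>\<delta> > 0\<close> by (simp add: c_def)
  \<comment> \<open>The positive term integrates to at most \<open>2 \<alpha> C\<^sup>2 / \<rho>\<close>, which has to be less than \<open>c\<close>.\<close>
  define \<rho> where "\<rho> = 2 * \<alpha> * C\<^sup>2 / c + 1"
  have \<rho>: "\<rho> \<ge> 1" "\<rho> > 0" "2 * \<alpha> * C\<^sup>2 < c * \<rho>"
  proof -
    have "2 * \<alpha> * C\<^sup>2 / c \<ge> 0" using assms c by simp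
    then show "\<rho> \<ge> 1" "\<rho> > 0" by (simp_all add: \<rho>_def)
    show "2 * \<alpha> * C\<^sup>2 < c * \<rho>" using c by (simp add: \<rho>_def distrib_left)
  qed
  define D1 where "D1 u = (bump' (u / \<rho>) / \<rho>)\<^sup>2 / ?m u" for u
  define D2 where "D2 u = (bump (u / \<rho>) / ?m u)\<^sup>2" for u
  have cont: "continuous_on A D1" "continuous_on A D2" for A
    unfolding D1_def [abs_def] D2_def [abs_def] by (intro continuous_gap_terms assms)+
  have int: "D1 integrable_on {a..b}" "D2 integrable_on {a..b}" for a b
    using cont by (auto intro: integrable_continuous_interval)
  have "integral {-\<rho>..\<rho>} D1 \<le> integral {-\<rho>..\<rho>} (\<lambda>u. (C / \<rho>)\<^sup>2 * \<alpha>)"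
  proof (rule integral_le[OF int(1)])
    fix u
    have "(bump' (u / \<rho>) / \<rho>)\<^sup>2 \<le> (C / \<rho>)\<^sup>2"
      using C[of "u / \<rho>"] \<rho>(2) by (intro abs_le_square_iff[THEN iffD1]) (simp add: abs_divide divide_right_mono)
    moreover have "inverse (?m u) \<le> \<alpha>"
    proof -
      have "inverse (?m u) \<le> inverse (1 / \<alpha>)" using assms by (intro le_imp_inverse_le) auto
      then show ?thesis by simp
    qed
    ultimately show "D1 u \<le> (C / \<rho>)\<^sup>2 * \<alpha>"
      unfolding D1_def divide_inverse[of _ "?m u"] using denominator_pos[OF assms, of u] by (intro mult_mono) auto
  qed auto
  also have "\<dots> = 2 * \<alpha> * C\<^sup>2 / \<rho>"
    using \<rho>(2) by (simp add: power2_eq_square field_simps)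
  also have "\<dots> < c" using \<rho> by (simp add: field_simps)
  also have "c = integral {-1/2..1/2} (\<lambda>u::real. c)" by simp
  also have "\<dots> \<le> integral {-1/2..1/2} D2"
  proof (rule integral_le[OF _ int(2)])
    fix u :: real assume u: "u \<in> {-1/2..1/2}"
    have "u\<^sup>2 \<le> (1/2)\<^sup>2" using u by (intro abs_le_square_iff[THEN iffD1]) auto
    then have "?m u \<le> 1 / \<alpha> + 1 / 8" by (simp add: power2_eq_square)
    moreover have "\<delta> \<le> bump (u / \<rho>)"
    proof -
      have "\<bar>u / \<rho>\<bar> \<le> \<bar>u\<bar>" using \<rho> by (simp add: abs_divide divide_le_eq mult_le_cancel_left1)
      moreover have "\<bar>u\<bar> \<le> 1 / 2" using u by (auto simp: abs_le_iff)
      ultimately have "\<bar>u / \<rho>\<bar> \<le> 1 / 2" by linarith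
      then have "u / \<rho> \<in> {-1/2..1/2}" unfolding abs_le_iff atLeastAtMost_iff by linarith
      then show ?thesis unfolding \<delta>_def by (rule x0(2))
    qed
    ultimately have "\<delta> / (1 / \<alpha> + 1 / 8) \<le> bump (u / \<rho>) / ?m u"
      using denominator_pos[OF assms, of u] \<open>\<delta> > 0\<close> by (intro frac_le) auto
    then show "c \<le> D2 u"
      unfolding c_def D2_def using \<open>\<delta> > 0\<close> \<open>1 / \<alpha> + 1 / 8 > 0\<close> by (intro power_mono) auto
  qed auto
  also have "\<dots> \<le> integral {-\<rho>..\<rho>} D2"
    by (rule integral_subset_le) (use \<rho> int in \<open>auto simp: D2_def\<close>)
  finally have "integral {-\<rho>..\<rho>} D1 - integral {-\<rho>..\<rho>} D2 < 0" by simp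
  moreover have "integral {-\<rho>..\<rho>} (gap \<alpha> \<rho>) = integral {-\<rho>..\<rho>} D1 - integral {-\<rho>..\<rho>} D2"
    unfolding gap_def [abs_def] D1_def[symmetric] D2_def[symmetric] by (rule integral_diff[OF int])
  ultimately show ?thesis using that \<rho>(1) by simp
qed

lemma weighted_integral_negative:
  fixes \<omega> g :: "real \<Rightarrow> real"
  assumes "\<rho> > 0" "continuous_on UNIV \<omega>" "\<And>s. \<omega> s \<ge> 0" "\<omega> 0 > 0" "continuous_on UNIV g"
    and neg: "integral {-\<rho>..\<rho>} g < 0"
  shows "integral (cbox (-\<rho>, -\<rho>) (\<rho>, \<rho>)) (\<lambda>w. \<omega> (snd w) * g (fst w)) < 0"
proof -
  have "continuous_on (cbox (-\<rho>, -\<rho>) (\<rho>, \<rho>)) (\<lambda>w. \<omega> (snd w) * g (fst w))"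
    by (intro continuous_intros continuous_on_compose2[OF assms(2)] continuous_on_compose2[OF assms(5)]) auto
  from integral_prod_continuous[OF this]
  have "integral (cbox (-\<rho>, -\<rho>) (\<rho>, \<rho>)) (\<lambda>w. \<omega> (snd w) * g (fst w)) = integral {-\<rho>..\<rho>} \<omega> * integral {-\<rho>..\<rho>} g"
    by simp
  moreover have "integral {-\<rho>..\<rho>} \<omega> > 0"
  proof -
    have c: "continuous_on {-\<rho>..\<rho>} \<omega>" using assms(2) continuous_on_subset by blast
    have "integral {-\<rho>..\<rho>} \<omega> \<ge> 0"
      using c assms(3) by (intro integral_nonneg integrable_continuous_interval) auto
    moreover have "integral {-\<rho>..\<rho>} \<omega> \<noteq> 0"
      using integral_eq_0_iff[OF c] assms(1,3,4) by (metis atLeastAtMost_iff less_irrefl less_imp_le neg_less_0_iff_less less_trans)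
    ultimately show ?thesis by simp
  qed
  ultimately show ?thesis using neg by (simp add: mult_pos_neg)
qed

definition test_profile' :: "real \<Rightarrow> real \<Rightarrow> real \<Rightarrow> real" where
  "test_profile' \<alpha> \<rho> u = bump' (u / \<rho>) / \<rho> * inverse (1 + \<alpha> * u\<^sup>2 / 2) - bump (u / \<rho>) * (\<alpha> * u) * (inverse (1 + \<alpha> * u\<^sup>2 / 2))\<^sup>2"

lemma test_profile_deriv:
  assumes "\<alpha> > 0" "\<rho> > 0"
  shows "(test_profile \<alpha> \<rho> has_real_derivative test_profile' \<alpha> \<rho> u) (at u)" "continuous_on UNIV (test_profile' \<alpha> \<rho>)"
    "(1 / \<alpha> + u\<^sup>2 / 2) * test_profile' \<alpha> \<rho> u + u * test_profile \<alpha> \<rho> u = bump' (u / \<rho>) / (\<rho> * \<alpha>)"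
proof -
  have pos: "1 + \<alpha> * u\<^sup>2 / 2 > 0" for u using assms(1) by (simp add: add_pos_nonneg)
  have b: "((\<lambda>u. bump (u / \<rho>)) has_real_derivative bump' (u / \<rho>) * (1 / \<rho>)) (at u)"
    by (rule DERIV_chain2[OF bump_deriv]) (use assms(2) in \<open>auto intro!: derivative_eq_intros\<close>)
  have "((\<lambda>u. inverse (1 + \<alpha> * u\<^sup>2 / 2)) has_real_derivative - ((\<alpha> * u) * (inverse (1 + \<alpha> * u\<^sup>2 / 2))\<^sup>2)) (at u)"
    using pos[of u] by (auto intro!: derivative_eq_intros simp: power2_eq_square)
  from DERIV_mult[OF b this] show "(test_profile \<alpha> \<rho> has_real_derivative test_profile' \<alpha> \<rho> u) (at u)"
    unfolding test_profile_def [abs_def] test_profile'_def by (simp add: algebra_simps)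
  have nz: "1 + \<alpha> * u\<^sup>2 / 2 \<noteq> 0" for u using pos[of u] by simp
  have ci: "continuous_on UNIV (\<lambda>u. inverse (1 + \<alpha> * u\<^sup>2 / 2))"
    by (intro continuous_on_inverse continuous_on_add continuous_on_const continuous_on_divide continuous_on_mult
        continuous_on_power continuous_on_id) (simp_all add: nz)
  show "continuous_on UNIV (test_profile' \<alpha> \<rho>)"
    unfolding test_profile'_def [abs_def]
    by (intro continuous_on_diff continuous_on_mult continuous_on_power continuous_on_divide continuous_on_const
        continuous_on_id ci continuous_dilated_bump) (use assms(2) in auto)
  define m where "m = 1 + \<alpha> * u\<^sup>2 / 2"
  have m: "m \<noteq> 0" "1 / \<alpha> + u\<^sup>2 / 2 = m / \<alpha>" using nz assms(1) by (simp_all add: m_def field_simps)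
  show "(1 / \<alpha> + u\<^sup>2 / 2) * test_profile' \<alpha> \<rho> u + u * test_profile \<alpha> \<rho> u = bump' (u / \<rho>) / (\<rho> * \<alpha>)"
    unfolding test_profile'_def test_profile_def m(2) m_def[symmetric] using m(1) assms(1,2)
    by (simp add: field_simps power2_eq_square)
qed


section \<open>Instability\<close>

lemma second_variation_integrand:
  assumes "\<alpha> > 0" "\<rho> > 0" "\<mu> * hu + u * (test_profile \<alpha> \<rho> u * x) = bump' (u / \<rho>) / (\<rho> * \<alpha>) * x" "\<mu> = 1 / \<alpha> + u\<^sup>2 / 2"
  shows "(\<mu> * hu + u * (test_profile \<alpha> \<rho> u * x))\<^sup>2 / \<mu> - (test_profile \<alpha> \<rho> u * x)\<^sup>2 = (x / \<alpha>)\<^sup>2 * gap \<alpha> \<rho> u"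
proof -
  have \<mu>: "\<mu> > 0" using assms(4) denominator_pos[OF assms(1)] by simp
  have eq: "1 + \<alpha> * u\<^sup>2 / 2 = \<alpha> * \<mu>" using assms(1,4) by (simp add: field_simps)
  have tp: "test_profile \<alpha> \<rho> u = bump (u / \<rho>) / (\<alpha> * \<mu>)"
    unfolding test_profile_def eq divide_inverse[of "bump (u / \<rho>)"] ..
  show ?thesis
    unfolding assms(3) unfolding tp gap_def assms(4)[symmetric] using \<mu> assms(1,2)
    by (simp add: field_simps power2_eq_square)
qed

text \<open>For this function the integrand is a nonnegative weight in \<open>s\<close> times \<^const>\<open>gap\<close> in \<open>u\<close>; only the
exponent \<open>j\<close> of \<^const>\<open>ir\<close> in the weight differs between the two fields.\<close>

lemma second_variation_test_function:
  assumes "\<alpha> > 0"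
  obtains \<rho> v1 v2 where "\<rho> \<ge> 1" "v1 < 0" "v2 < 0"
    "has_second_variation (strip \<alpha> \<beta>) (\<lambda>g. test_function \<alpha> \<beta> \<rho> g *\<^sub>R X1 g) v1"
    "has_second_variation (strip \<alpha> \<beta>) (\<lambda>g. test_function \<alpha> \<beta> \<rho> g *\<^sub>R nu_H (strip_phi \<alpha> \<beta>) g) v2"
proof -
  obtain \<rho> where \<rho>: "\<rho> \<ge> 1" and neg: "integral {-\<rho>..\<rho>} (gap \<alpha> \<rho>) < 0"
    using gap_integral_negative[OF assms] .
  have \<rho>0: "\<rho> > 0" using \<rho> by simp
  let ?B = "cbox (-\<rho>, -\<rho>) (\<rho>, \<rho>)"
  note F = test_profile_deriv[OF assms \<rho>0]
  define h where "h w = test_profile \<alpha> \<rho> (fst w) * bump (snd w)" for w :: "real \<times> real"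
  define h\<^sub>u where "h\<^sub>u w = test_profile' \<alpha> \<rho> (fst w) * bump (snd w)" for w :: "real \<times> real"
  define h\<^sub>s where "h\<^sub>s w = test_profile \<alpha> \<rho> (fst w) * bump' (snd w)" for w :: "real \<times> real"
  have h: "has_partials h h\<^sub>u h\<^sub>s"
    unfolding h_def [abs_def]
    by (rule has_partials_cong[OF has_partials_mult[OF has_partials_fst[OF F(1,2)] has_partials_snd[OF bump_deriv continuous_bump']]])
       (simp_all add: h\<^sub>u_def h\<^sub>s_def fun_eq_iff)
  have van: "vanishes_off \<rho> h"
    unfolding h_def [abs_def] by (rule vanishes_off_test_function[OF \<rho>])
  have tf: "test_function \<alpha> \<beta> \<rho> (chart \<alpha> \<beta> w) = h w" for w
    using assms by (simp add: test_function_chart h_def)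
  define \<mu> where "\<mu> w = 1 / \<alpha> + (fst w)\<^sup>2 / 2" for w :: "real \<times> real"
  have integrand: "(\<mu> w * h\<^sub>u w + fst w * h w)\<^sup>2 / \<mu> w - (h w)\<^sup>2 = (bump (snd w) / \<alpha>)\<^sup>2 * gap \<alpha> \<rho> (fst w)" for w
    unfolding h_def
  proof (rule second_variation_integrand[OF assms \<rho>0])
    show "\<mu> w * h\<^sub>u w + fst w * (test_profile \<alpha> \<rho> (fst w) * bump (snd w)) = bump' (fst w / \<rho>) / (\<rho> * \<alpha>) * bump (snd w)"
      unfolding F(3)[of "fst w", symmetric] by (simp add: \<mu>_def h\<^sub>u_def algebra_simps)
  qed (simp add: \<mu>_def)
  define v where "v j = integral ?B (\<lambda>w. ir (snd w) ^ j * ((\<mu> w * h\<^sub>u w + fst w * h w)\<^sup>2 / \<mu> w - (h w)\<^sup>2))" for j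
  have "v j < 0" for j
  proof -
    have "integral ?B (\<lambda>w. (ir (snd w) ^ j * (bump (snd w) / \<alpha>)\<^sup>2) * gap \<alpha> \<rho> (fst w)) < 0"
    proof (rule weighted_integral_negative[OF \<rho>0 _ _ _ continuous_gap[OF assms] neg])
      show "continuous_on UNIV (\<lambda>s. ir s ^ j * (bump s / \<alpha>)\<^sup>2)"
        using assms by (intro continuous_intros continuous_ir continuous_bump) auto
      show "0 \<le> ir s ^ j * (bump s / \<alpha>)\<^sup>2" for s using ir_pos[of s] by simp
      show "0 < ir 0 ^ j * (bump 0 / \<alpha>)\<^sup>2" using ir_pos[of 0] bump_pos[of 0] assms by simp
    qed
    then show ?thesis unfolding v_def integrand by (simp add: mult.assoc)
  qed
  moreover have "has_second_variation (strip \<alpha> \<beta>) (\<lambda>g. test_function \<alpha> \<beta> \<rho> g *\<^sub>R X1 g) (v 3)"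
    unfolding v_def \<mu>_def by (rule second_variation_X1[OF assms \<rho>0 h van]) (simp add: tf)
  moreover have "has_second_variation (strip \<alpha> \<beta>) (\<lambda>g. test_function \<alpha> \<beta> \<rho> g *\<^sub>R nu_H (strip_phi \<alpha> \<beta>) g) (v 1)"
    unfolding v_def \<mu>_def power_one_right
    by (rule second_variation_normal[OF assms \<rho>0 h van]) (simp add: tf nu_H_chart[OF assms])
  ultimately show ?thesis using that \<rho> by blast
qed

lemma test_field_X1:
  assumes "\<alpha> > 0" "C0_surface 2 (strip \<alpha> \<beta>) a" "\<exists>g\<in>strip \<alpha> \<beta>. a g \<noteq> 0"
  shows "test_field (strip \<alpha> \<beta>) (\<lambda>g. a g *\<^sub>R X1 g)"
proof -
  have "C_on 2 (\<lambda>g::heis. 0::real) UNIV"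
    by (intro C_onI Ck_on_const open_UNIV)
  then have "C0_surface 2 (strip \<alpha> \<beta>) (\<lambda>g. 0)"
    unfolding C0_surface_def support_in_def by auto
  moreover have "X1 g \<noteq> 0" for g by (cases g) (simp add: zero_prod_def)
  ultimately show ?thesis
    unfolding test_field_def using assms(2,3)
    by (intro conjI exI[of _ a] exI[of _ "\<lambda>g. 0"]) auto
qed

theorem theorem1p2:
  fixes \<alpha> \<beta> :: real
  assumes "\<alpha> > 0"
  shows "strip \<alpha> \<beta> = global_X1_graph (strip_psi \<alpha> \<beta>) \<and>
         H_minimal (strip \<alpha> \<beta>) (heis_grad (strip_phi \<alpha> \<beta>)) \<and>
         unstable (strip \<alpha> \<beta>) (heis_grad (strip_phi \<alpha> \<beta>)) \<and>
         (\<exists>a v. C0_surface \<infinity> (strip \<alpha> \<beta>) a \<and> (\<exists>g\<in>strip \<alpha> \<beta>. a g \<noteq> 0) \<and>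
            has_second_variation (strip \<alpha> \<beta>) (\<lambda>g. a g *\<^sub>R X1 g) v \<and> v < 0) \<and>
         (\<exists>h v. C0_surface \<infinity> (strip \<alpha> \<beta>) h \<and> (\<exists>g\<in>strip \<alpha> \<beta>. h g \<noteq> 0) \<and>
            has_second_variation (strip \<alpha> \<beta>) (\<lambda>g. h g *\<^sub>R nu_H (strip_phi \<alpha> \<beta>) g) v \<and> v < 0)"
proof -
  let ?S = "strip \<alpha> \<beta>" and ?N = "heis_grad (strip_phi \<alpha> \<beta>)"
  obtain \<rho> v1 v2 where \<rho>: "\<rho> \<ge> 1" and v: "v1 < 0" "v2 < 0"
    and V1: "has_second_variation ?S (\<lambda>g. test_function \<alpha> \<beta> \<rho> g *\<^sub>R X1 g) v1"
    and V2: "has_second_variation ?S (\<lambda>g. test_function \<alpha> \<beta> \<rho> g *\<^sub>R nu_H (strip_phi \<alpha> \<beta>) g) v2"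
    by (rule second_variation_test_function[OF assms])
  note smooth = C0_surface_test_function[OF assms \<rho>] and nonzero = test_function_nonzero[OF assms]
  have "oriented_C2_surface ?S ?N"
    unfolding oriented_C2_surface_def using oriented_defining_function_strip_phi[OF assms] by blast
  then have "stationary ?S ?N"
    unfolding stationary_def
    using H_minimal_strip[OF assms] characteristic_locus_strip[OF assms] first_variation_strip[OF assms] by blast
  then have "unstable ?S ?N"
    unfolding unstable_def using test_field_X1[OF assms smooth nonzero] V1 v(1) by blast
  then show ?thesis
    using strip_is_X1_graph[OF assms] H_minimal_strip[OF assms] smooth nonzero V1 V2 v by blast
qed

end
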